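(* Let $G$ be a finite connected graph of minimal degree $\geq 3$ and first Betti number $b>1$, with universal covering tree $\mathcal{T}$ and fundamental group $\Gamma$, and let $\mu$ be a $\Gamma$-conformal measure on $\partial\mathcal{T}$. Let $(\mathcal{T}',\Gamma',\mu')$ be the same data associated to another finite connected graph $G'$ of minimal degree $\geq 3$ with the same first Betti number $b>1$. Let $C$ be the boundary of the Cayley graph of the free group $\mathbf{F}_b$, and let $\Phi_G\colon\partial\mathcal{T}\to C$ and $\Phi_{G'}\colon\partial\mathcal{T}'\to C$ be the homeomorphisms fixed in the context. Then $G$ and $G'$ are isomorphic if and only if the push-forward measures $\Phi_{G*}\mu$ and $\Phi_{G'*}\mu'$ on $C$ have the same dimension and are mutually absolutely continuous.
   Context: Graphs $G=(V,E)$ have edges that are unordered pairs of elements of $V$. The fundamental group $\Gamma\cong\mathbf{F}_b$ (free of rank $b$) acts on the universal covering tree $\mathcal{T}$ with quotient $G$. The boundary $\partial\mathcal{T}$ is the space of ends of $\mathcal{T}$: fixing a base vertex $x_0$, it is the set of infinite non-backtracking paths starting at $x_0$, and its topology and Borel sigma-algebra are generated by the cylinder sets $\mathrm{Cyl}_{x_0}(f)$, the set of such paths that pass through the edge $f$. The group $\Gamma$ acts on $\partial\mathcal{T}$. The Cayley graph of $\mathbf{F}_b$, for free generators $g_1,\dots,g_b$ and their inverses, is a $2b$-regular tree. $C$ denotes its boundary, on which $\mathbf{F}_b$ acts. The map $\Phi_G$ is fixed as follows. Choose a base point $x_0\in\mathcal{T}$ and a group isomorphism $\alpha\colon\mathbf{F}_b\to\Gamma$.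 The map $g\mapsto\alpha(g)(x_0)$ is a quasi-isometry from the Cayley graph to $\mathcal{T}$ and extends to a homeomorphism $\Phi\colon C\to\partial\mathcal{T}$, $\lim g\mapsto\lim\alpha(g)(x_0)$. Put $\Phi_G=\Phi^{-1}$ and $\alpha_G=\alpha^{-1}$. Then $(\Phi_G,\alpha_G)\colon(\partial\mathcal{T},\Gamma)\to(C,\mathbf{F}_b)$ is a topological conjugacy: $\Phi_G$ is a homeomorphism, $\alpha_G$ is a group isomorphism, and $\Phi_G(\gamma x)=\alpha_G(\gamma)\Phi_G(x)$ for all $x\in\partial\mathcal{T}$, $\gamma\in\Gamma$. The map $\Phi_{G'}$ is fixed in the same way for $G'$. Let $d$ be the distance between vertices of $\mathcal{T}$ (adjacent vertices are at distance $1$). For $\xi\in\partial\mathcal{T}$ and $x,y\in\mathcal{T}$, the Busemann function is $B_\xi(x,y)=\lim_{z\to\xi}(d(x,z)-d(y,z))$, with $z\in\mathcal{T}$. A family $(\mu_x)_{x\in\mathcal{T}}$ of positive finite Borel measures on $\partial\mathcal{T}$ is $\Gamma$-conformal of dimension $\delta$ if (1) $\mu_{\gamma x}=\gamma_*\mu_x$ for all $x\in\mathcal{T}$, $\gamma\in\Gamma$, and (2) for all $x,y\in\mathcal{T}$ the Radon–Nikodym derivative of $\mu_x$ with respect to $\mu_y$ exists and equals $\frac{d\mu_x}{d\mu_y}(\xi)=e^{-\delta B_\xi(x,y)}$. Such measures are considered only up to scaling by a global constant. A $\Gamma$-conformal measure is a member of such a family, and its dimension (and that of its push-forward to $C$)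 is $\delta$. Push-forward is $\varphi_*\mu(A)=\mu(\varphi^{-1}(A))$. Two measures $\mu_1,\mu_2$ are mutually absolutely continuous if $\mu_1(A)=0\iff\mu_2(A)=0$ for all measurable $A$.
   Formalization: The choices for Φ_G' are not fixed independently: for every choice (x0, α) for G, G and G' are isomorphic iff some choice (x0', α') for G' gives push-forwards of equal dimension that are mutually absolutely continuous; for unrelated choices "only if" fails. *)

theory Defs
  imports "HOL-Analysis.Analysis" "HOL-Algebra.Bij"
begin

section \<open>Graphs\<close>

record 'v graph =
  verts :: "'v set"
  edges :: "'v set set"

text \<open>Edges are unordered pairs of distinct vertices; the vertex set may be infinite.\<close>

definition wf_graph :: "'v graph \<Rightarrow> bool" where
  "wf_graph G \<longleftrightarrow> edges G \<subseteq> {{u, v} | u v. u \<in> verts G \<and> v \<in> verts G \<and> u \<noteq> v}"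

definition adj_rel :: "'v graph \<Rightarrow> 'v rel" where
  "adj_rel G = {(u, v). {u, v} \<in> edges G}"

definition nbhd :: "'v graph \<Rightarrow> 'v \<Rightarrow> 'v set" where
  "nbhd G v = {w. {v, w} \<in> edges G}"

definition min_degree_ge :: "nat \<Rightarrow> 'v graph \<Rightarrow> bool" where
  "min_degree_ge k G \<longleftrightarrow> (\<forall>v\<in>verts G. k \<le> card (nbhd G v))"

definition connected_graph :: "'v graph \<Rightarrow> bool" where
  "connected_graph G \<longleftrightarrow>
     verts G \<noteq> {} \<and> (\<forall>u\<in>verts G. \<forall>v\<in>verts G. (u, v) \<in> (adj_rel G)\<^sup>*)"

definition graph_dist :: "'v graph \<Rightarrow> 'v \<Rightarrow> 'v \<Rightarrow> nat" where
  "graph_dist G u v = (LEAST n. (u, v) \<in> adj_rel G ^^ n)"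

text \<open>The first Betti number of a finite connected graph. By connectedness
  \<open>card (verts G) \<le> card (edges G) + 1\<close>, so the subtraction does not truncate.\<close>

definition betti :: "'v graph \<Rightarrow> nat" where
  "betti G = card (edges G) + 1 - card (verts G)"

definition graph_iso :: "'v graph \<Rightarrow> 'w graph \<Rightarrow> ('v \<Rightarrow> 'w) \<Rightarrow> bool" where
  "graph_iso G H f \<longleftrightarrow> bij_betw f (verts G) (verts H) \<and>
     (\<forall>u\<in>verts G. \<forall>v\<in>verts G. {u, v} \<in> edges G \<longleftrightarrow> {f u, f v} \<in> edges H)"

definition isomorphic_graphs :: "'v graph \<Rightarrow> 'w graph \<Rightarrow> bool" where
  "isomorphic_graphs G H \<longleftrightarrow> (\<exists>f. graph_iso G H f)"

definition is_cycle :: "'v graph \<Rightarrow> 'v list \<Rightarrow> bool" where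
  "is_cycle G c \<longleftrightarrow> 3 \<le> length c \<and> distinct c \<and>
     (\<forall>i<length c. {c ! i, c ! (Suc i mod length c)} \<in> edges G)"

definition tree :: "'v graph \<Rightarrow> bool" where
  "tree T \<longleftrightarrow> wf_graph T \<and> connected_graph T \<and> (\<nexists>c. is_cycle T c)"


section \<open>Universal covering tree and fundamental group\<close>

definition covering :: "'t graph \<Rightarrow> 'v graph \<Rightarrow> ('t \<Rightarrow> 'v) \<Rightarrow> bool" where
  "covering T G p \<longleftrightarrow> p ` verts T = verts G \<and>
     (\<forall>x\<in>verts T. bij_betw p (nbhd T x) (nbhd G (p x)))"

definition universal_covering :: "'t graph \<Rightarrow> 'v graph \<Rightarrow> ('t \<Rightarrow> 'v) \<Rightarrow> bool" where
  "universal_covering T G p \<longleftrightarrow> tree T \<and> covering T G p"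

text \<open>The fundamental group in its action on the universal covering tree: the group of deck
  transformations.\<close>

definition deck_group :: "'t graph \<Rightarrow> ('t \<Rightarrow> 'v) \<Rightarrow> ('t \<Rightarrow> 't) monoid" where
  "deck_group T p = BijGroup (verts T)
     \<lparr>carrier := {\<gamma> \<in> Bij (verts T). graph_iso T T \<gamma> \<and> (\<forall>x\<in>verts T. p (\<gamma> x) = p x)}\<rparr>"


section \<open>Ends of a tree\<close>

definition rays :: "'t graph \<Rightarrow> (nat \<Rightarrow> 't) set" where
  "rays T = {r. \<forall>n. {r n, r (Suc n)} \<in> edges T \<and> r (Suc (Suc n)) \<noteq> r n}"

text \<open>An end is a class of rays (non-backtracking infinite paths) that eventually coincide up to
  a shift. In a tree every end contains exactly one ray from each vertex, so \<open>ends T\<close> is the set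
  of rays from a fixed base vertex, with no base vertex having to be singled out.\<close>

type_synonym 't tree_end = "(nat \<Rightarrow> 't) set"

definition cofinal :: "'t graph \<Rightarrow> (nat \<Rightarrow> 't) rel" where
  "cofinal T = {(r, s). r \<in> rays T \<and> s \<in> rays T \<and> (\<exists>m n. \<forall>k. r (m + k) = s (n + k))}"

definition ends :: "'t graph \<Rightarrow> 't tree_end set" where
  "ends T = rays T // cofinal T"

definition end_map :: "('t \<Rightarrow> 's) \<Rightarrow> 't tree_end \<Rightarrow> 's tree_end" where
  "end_map \<gamma> \<xi> = (\<lambda>r. \<gamma> \<circ> r) ` \<xi>"

definition Cyl :: "'t graph \<Rightarrow> 't \<Rightarrow> 't set \<Rightarrow> 't tree_end set" where
  "Cyl T x f = {\<xi> \<in> ends T. \<exists>r\<in>\<xi>. r 0 = x \<and> (\<exists>n. {r n, r (Suc n)} = f)}"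

text \<open>In a locally finite tree the complement of a cylinder set is a finite union of cylinder
  sets from the same base vertex, so the sigma-algebra is the one generated by the cylinder sets
  from any single base vertex.\<close>

definition end_borel :: "'t graph \<Rightarrow> 't tree_end measure" where
  "end_borel T = sigma (ends T) {Cyl T x f | x f. x \<in> verts T \<and> f \<in> edges T}"

text \<open>The filter on the vertices describing \<open>z \<rightarrow> \<xi>\<close>: for each \<open>r \<in> \<xi>\<close> and \<open>k\<close>, the geodesic from
  \<open>r 0\<close> to \<open>z\<close> eventually passes through \<open>r k\<close>.\<close>

definition to_end :: "'t graph \<Rightarrow> 't tree_end \<Rightarrow> 't filter" where
  "to_end T \<xi> = (INF r\<in>\<xi>. INF k. principal {z \<in> verts T.
     graph_dist T (r 0) z = graph_dist T (r 0) (r k) + graph_dist T (r k) z})"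

definition busemann :: "'t graph \<Rightarrow> 't tree_end \<Rightarrow> 't \<Rightarrow> 't \<Rightarrow> real" where
  "busemann T \<xi> x y =
     Lim (to_end T \<xi>) (\<lambda>z. real (graph_dist T x z) - real (graph_dist T y z))"


section \<open>Conformal measures\<close>

text \<open>Positivity excludes the zero measure. The equation with \<open>density\<close> says that the
  Radon--Nikodym derivative exists and is the given function.\<close>

definition conformal_family ::
  "'t graph \<Rightarrow> ('t \<Rightarrow> 'v) \<Rightarrow> real \<Rightarrow> ('t \<Rightarrow> 't tree_end measure) \<Rightarrow> bool" where
  "conformal_family T p \<delta> \<mu> \<longleftrightarrow>
     (\<forall>x\<in>verts T. finite_measure (\<mu> x) \<and> sets (\<mu> x) = sets (end_borel T) \<and>
        emeasure (\<mu> x) (ends T) > 0) \<and>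
     (\<forall>x\<in>verts T. \<forall>\<gamma>\<in>carrier (deck_group T p).
        \<mu> (\<gamma> x) = distr (\<mu> x) (end_borel T) (end_map \<gamma>)) \<and>
     (\<forall>x\<in>verts T. \<forall>y\<in>verts T.
        \<mu> x = density (\<mu> y) (\<lambda>\<xi>. ennreal (exp (- \<delta> * busemann T \<xi> x y))))"

definition conformal_measure ::
  "'t graph \<Rightarrow> ('t \<Rightarrow> 'v) \<Rightarrow> real \<Rightarrow> 't tree_end measure \<Rightarrow> bool" where
  "conformal_measure T p \<delta> m \<longleftrightarrow> (\<exists>\<mu>. conformal_family T p \<delta> \<mu> \<and> (\<exists>x\<in>verts T. m = \<mu> x))"

definition mutually_absolutely_continuous :: "'a measure \<Rightarrow> 'a measure \<Rightarrow> bool" where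
  "mutually_absolutely_continuous M N \<longleftrightarrow>
     sets M = sets N \<and> (\<forall>A\<in>sets M. emeasure M A = 0 \<longleftrightarrow> emeasure N A = 0)"


section \<open>The free group and its Cayley graph\<close>

text \<open>The letter \<open>(i, True)\<close> stands for the \<open>i\<close>-th free generator, \<open>(i, False)\<close> for its inverse.
  Elements of the free group are reduced words.\<close>

type_synonym letter = "nat \<times> bool"

definition inv_letter :: "letter \<Rightarrow> letter" where
  "inv_letter a = (fst a, \<not> snd a)"

fun cons_reduce :: "letter \<Rightarrow> letter list \<Rightarrow> letter list" where
  "cons_reduce a [] = [a]"
| "cons_reduce a (c # w) = (if c = inv_letter a then w else a # c # w)"

definition letters :: "nat \<Rightarrow> letter set" where
  "letters b = {..<b} \<times> UNIV"

definition free_group :: "nat \<Rightarrow> letter list monoid" where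
  "free_group b =
     \<lparr>carrier = {w \<in> lists (letters b). successively (\<lambda>a c. c \<noteq> inv_letter a) w},
      mult = (\<lambda>u v. foldr cons_reduce u v),
      one = []\<rparr>"

definition cayley_tree :: "nat \<Rightarrow> letter list graph" where
  "cayley_tree b =
     \<lparr>verts = carrier (free_group b),
      edges = {{g, g \<otimes>\<^bsub>free_group b\<^esub> [a]} | g a. g \<in> carrier (free_group b) \<and> a \<in> letters b}\<rparr>"


section \<open>The homeomorphism onto the boundary of the Cayley graph\<close>

text \<open>The choices on which the homeomorphism depends: a base vertex and an isomorphism from the
  free group of rank \<open>b\<close> to the fundamental group.\<close>

definition marking ::
  "nat \<Rightarrow> 't graph \<Rightarrow> ('t \<Rightarrow> 'v) \<Rightarrow> 't \<Rightarrow> (letter list \<Rightarrow> 't \<Rightarrow> 't) \<Rightarrow> bool" where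
  "marking b T p x\<^sub>0 \<alpha> \<longleftrightarrow> x\<^sub>0 \<in> verts T \<and> \<alpha> \<in> iso (free_group b) (deck_group T p)"

text \<open>The map \<open>lim g \<mapsto> lim \<alpha>(g)(x\<^sub>0)\<close> from the ends of the Cayley graph to the ends of \<open>T\<close>.\<close>

definition orbit_end_map ::
  "nat \<Rightarrow> 't graph \<Rightarrow> 't \<Rightarrow> (letter list \<Rightarrow> 't \<Rightarrow> 't) \<Rightarrow> letter list tree_end \<Rightarrow> 't tree_end" where
  "orbit_end_map b T x\<^sub>0 \<alpha> \<eta> =
     (THE \<xi>. \<xi> \<in> ends T \<and> filterlim (\<lambda>g. \<alpha> g x\<^sub>0) (to_end T \<xi>) (to_end (cayley_tree b) \<eta>))"

definition boundary_map ::
  "nat \<Rightarrow> 't graph \<Rightarrow> 't \<Rightarrow> (letter list \<Rightarrow> 't \<Rightarrow> 't) \<Rightarrow> 't tree_end \<Rightarrow> letter list tree_end" where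
  "boundary_map b T x\<^sub>0 \<alpha> = inv_into (ends (cayley_tree b)) (orbit_end_map b T x\<^sub>0 \<alpha>)"

definition boundary_push ::
  "nat \<Rightarrow> 't graph \<Rightarrow> 't \<Rightarrow> (letter list \<Rightarrow> 't \<Rightarrow> 't) \<Rightarrow> 't tree_end measure \<Rightarrow>
     letter list tree_end measure" where
  "boundary_push b T x\<^sub>0 \<alpha> m = distr m (end_borel (cayley_tree b)) (boundary_map b T x\<^sub>0 \<alpha>)"

end

theory Submission
  imports Defs
begin

text \<open>A conformal family of dimension \<open>\<delta>\<close> gives every oriented edge of the tree a weight, the mass of
  the ends beyond the edge seen from its origin. The weight depends only on the edge of the
  finite graph below, and conformality says that \<open>exp \<delta>\<close> times the weight of an edge is the sum
  of the weights of the edges that continue it without backtracking. So the weights form a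
  positive eigenvector of the non-backtracking operator of the graph. If all degrees are at least
  three, this operator is irreducible (\<open>nonbacktracking_irreducible\<close>), and the Perron--Frobenius
  argument (\<open>perron_frobenius_unique\<close>) shows that the graph determines \<open>\<delta>\<close> and, up to a factor,
  the family (\<open>conformal_unique\<close>). An isomorphism of graphs lifts to the universal coverings
  (\<open>lift_iso\<close>) and transports the marking (\<open>transport_marking\<close>); with the transported marking the
  two push-forward measures are proportional up to the choice of base vertices. This is one
  implication.

  For the converse, the two markings define an equivariant coarse map between the trees whose
  extension \<open>\<Psi>\<close> to the ends relates the two boundary maps. Absolute continuity gives a density
  that is nearly constant on some cylinder (\<open>density_cylinder\<close>). Translation by the group moves
  this cylinder to one of finitely many edges without changing \<open>\<Psi>\<close>, and moves the base vertex of
  the measure on the second tree to a vertex that may be far away; but such a vertex is seen from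
  the cylinder through one of finitely many vertices (\<open>shadow_point\<close>). By the pigeonhole
  principle the measures of the two trees are exactly proportional beyond some edge, for a
  suitable base vertex in the second tree (\<open>proportional_somewhere\<close>), and irreducibility extends
  this to all edges, with base vertices that stay close to the corresponding vertices of the
  second tree (\<open>proportional_nearby\<close>).

  Along a ray to an end these base vertices converge to the image of the end. Comparing two of them
  shows, because \<open>\<delta>\<close> is positive, that no edge of the second tree separates the images of
  \<open>\<zeta>1, \<eta>1\<close> from those of \<open>\<zeta>2, \<eta>2\<close> if at some vertex of the first tree the branches of \<open>\<zeta>1, \<zeta>2\<close>
  differ from those of \<open>\<eta>1, \<eta>2\<close> (\<open>no_crossing\<close>). Since all degrees are at least three, this
  forces the set of ends beyond each edge of the second tree to be the image of the set of ends
  beyond an edge of the first (\<open>edge_preimage\<close>). By symmetry the oriented edges of the trees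
  correspond, these determine the vertices (\<open>vertex_map\<close>), and the isomorphism of trees obtained
  is equivariant, hence descends to the graphs (\<open>graphs_iso\<close>).\<close>

section \<open>Oriented edges\<close>

abbreviation adj :: "'t graph \<Rightarrow> 't \<Rightarrow> 't \<Rightarrow> bool" where
  "adj T u v \<equiv> {u, v} \<in> edges T"

text \<open>The component containing \<open>v\<close> that is left when the edge \<open>{u, v}\<close> is removed. Comparing the
  distances to the two vertices of the edge decides membership without any mention of paths.\<close>

definition half_tree :: "'t graph \<Rightarrow> 't \<Rightarrow> 't \<Rightarrow> 't set" where
  "half_tree T u v = {z \<in> verts T. graph_dist T z u = Suc (graph_dist T z v)}"

text \<open>The ends beyond the oriented edge from \<open>u\<close> to \<open>v\<close>: the cylinder sets, freed from the choice
  of a base vertex (\<open>Cyl_half_ends\<close>).\<close>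

definition half_ends :: "'t graph \<Rightarrow> 't \<Rightarrow> 't \<Rightarrow> 't tree_end set" where
  "half_ends T u v = {\<xi> \<in> ends T. \<exists>r\<in>\<xi>. \<forall>\<^sub>F n in sequentially. r n \<in> half_tree T u v}"

lemma adj_sym: "adj T u v \<Longrightarrow> adj T v u"
  by (simp add: insert_commute)

lemma adj_iff: "adj T u v \<longleftrightarrow> adj T v u"
  by (simp add: insert_commute)

lemma wf_graph_adj:
  assumes "wf_graph G" "adj G u v" shows "u \<in> verts G" "v \<in> verts G" "u \<noteq> v"
proof -
  have "{u, v} \<in> {{u, v} | u v. u \<in> verts G \<and> v \<in> verts G \<and> u \<noteq> v}"
    using assms unfolding wf_graph_def by blast
  then show "u \<in> verts G" "v \<in> verts G" "u \<noteq> v" by (auto simp: doubleton_eq_iff)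
qed

locale tree_graph =
  fixes T :: "'t graph"
  assumes tree: "tree T"
begin

abbreviation "V \<equiv> verts T"
abbreviation "d \<equiv> graph_dist T"

lemma adj_verts: assumes "adj T u v" shows "u \<in> V" "v \<in> V" "u \<noteq> v"
  using tree wf_graph_adj[OF _ assms] by (simp_all add: tree_def)

lemma V_nonempty: "V \<noteq> {}"
  using tree unfolding tree_def connected_graph_def by blast

section \<open>Distance in a tree\<close>

lemma dist_le: "(u, v) \<in> adj_rel T ^^ n \<Longrightarrow> d u v \<le> n"
  unfolding graph_dist_def by (rule Least_le)

lemma dist_walk: assumes "u \<in> V" "v \<in> V" shows "(u, v) \<in> adj_rel T ^^ d u v"
proof -
  have "(u, v) \<in> (adj_rel T)\<^sup>*"
    using tree assms unfolding tree_def connected_graph_def by blast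
  then obtain n where "(u, v) \<in> adj_rel T ^^ n" using rtrancl_power by blast
  then show ?thesis unfolding graph_dist_def by (rule LeastI)
qed

lemma walk_rev: "(u, v) \<in> adj_rel T ^^ n \<Longrightarrow> (v, u) \<in> adj_rel T ^^ n"
proof (induction n arbitrary: v)
  case 0 then show ?case by auto
next
  case (Suc n)
  then obtain w where w: "(u, w) \<in> adj_rel T ^^ n" "(w, v) \<in> adj_rel T" by auto
  then have "(v, w) \<in> adj_rel T" by (simp add: adj_rel_def insert_commute)
  with Suc.IH[OF w(1)] show ?case by (meson relpow_Suc_I2)
qed

lemma dist_sym: "d u v = d v u"
  unfolding graph_dist_def using walk_rev by metis

lemma dist_triangle:
  assumes "u \<in> V" "v \<in> V" "w \<in> V" shows "d u w \<le> d u v + d v w"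
proof -
  have "(u, w) \<in> adj_rel T ^^ (d u v + d v w)"
    using dist_walk[OF assms(1,2)] dist_walk[OF assms(2,3)] by (metis relcompI relpow_add)
  then show ?thesis by (rule dist_le)
qed

lemma dist_refl [simp]: "d u u = 0"
  using dist_le[of u u 0] by simp

lemma dist_0: assumes "u \<in> V" "v \<in> V" shows "d u v = 0 \<longleftrightarrow> u = v"
  using dist_walk[OF assms] by (cases "d u v = 0") auto

lemma dist_1: assumes "u \<in> V" "v \<in> V" shows "d u v = 1 \<longleftrightarrow> adj T u v"
proof
  assume "d u v = 1" then show "adj T u v"
    using dist_walk[OF assms] by (simp add: adj_rel_def)
next
  assume a: "adj T u v"
  then have "d u v \<le> 1" using dist_le[of u v 1] by (simp add: adj_rel_def)
  moreover have "d u v \<noteq> 0" using adj_verts[OF a] dist_0 by blast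
  ultimately show "d u v = 1" by simp
qed

lemma adj_dist: "adj T u v \<Longrightarrow> d u v = 1"
  using dist_1 adj_verts by blast

lemma geodesic:
  assumes "u \<in> V" "v \<in> V"
  obtains f where "f 0 = u" "f (d u v) = v" "\<And>i. i < d u v \<Longrightarrow> adj T (f i) (f (Suc i))"
    "\<And>i. i \<le> d u v \<Longrightarrow> f i \<in> V" "\<And>i. i \<le> d u v \<Longrightarrow> d u (f i) = i"
    "\<And>i. i \<le> d u v \<Longrightarrow> d (f i) v = d u v - i"
proof -
  obtain f where f: "f 0 = u" "f (d u v) = v" "\<And>i. i < d u v \<Longrightarrow> adj T (f i) (f (Suc i))"
    using dist_walk[OF assms] unfolding relpow_fun_conv adj_rel_def by auto
  have fV: "f i \<in> V" if "i \<le> d u v" for i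
    using that f(1) assms(1) f(3)[of "i-1"] adj_verts(2)[of "f (i-1)" "f i"] by (cases i) auto
  have a: "d u (f i) \<le> i" if "i \<le> d u v" for i
    using that
  proof (induction i)
    case (Suc i)
    have "d u (f (Suc i)) \<le> d u (f i) + d (f i) (f (Suc i))"
      using dist_triangle fV assms Suc.prems by simp
    then show ?case using Suc f(3)[of i] adj_dist[of "f i" "f (Suc i)"] by simp
  qed (use f in simp)
  have b: "d (f (d u v - i)) v \<le> i" if "i \<le> d u v" for i
    using that
  proof (induction i)
    case (Suc i)
    have e: "Suc (d u v - Suc i) = d u v - i" using Suc.prems by simp
    have "d (f (d u v - Suc i)) v \<le> d (f (d u v - Suc i)) (f (d u v - i)) + d (f (d u v - i)) v"
      using dist_triangle fV assms Suc.prems by simp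
    moreover have "d (f (d u v - Suc i)) (f (d u v - i)) = 1"
      using f(3)[of "d u v - Suc i"] adj_dist Suc.prems e by simp
    ultimately show ?case using Suc by simp
  qed (use f in simp)
  have c: "d u (f i) = i \<and> d (f i) v = d u v - i" if "i \<le> d u v" for i
  proof -
    have "d u v \<le> d u (f i) + d (f i) v" using dist_triangle fV assms that by simp
    moreover have "d (f i) v \<le> d u v - i" using b[of "d u v - i"] that by simp
    ultimately show ?thesis using a[OF that] that by linarith
  qed
  show ?thesis using that[of f] f fV c by blast
qed

lemma closer_ex:
  assumes "u \<in> V" "z \<in> V" "u \<noteq> z"
  obtains v where "adj T u v" "d u z = Suc (d v z)"
proof -
  obtain f where f: "f 0 = u" "f (d u z) = z" "\<And>i. i < d u z \<Longrightarrow> adj T (f i) (f (Suc i))"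
    "\<And>i. i \<le> d u z \<Longrightarrow> d (f i) z = d u z - i"
    using geodesic[OF assms(1,2)] by metis
  have "d u z > 0" using dist_0 assms by blast
  then show ?thesis using that[of "f 1"] f(1) f(3)[of 0] f(4)[of 1] by simp
qed

section \<open>Acyclicity in terms of distances\<close>

text \<open>A shortest piece of the walk that returns to its first vertex would be a cycle.\<close>

lemma nb_walk_inj:
  assumes adj: "\<And>i. i < n \<Longrightarrow> adj T (w i) (w (Suc i))"
    and nb: "\<And>i. i + 2 \<le> n \<Longrightarrow> w (i + 2) \<noteq> w i"
    and ij: "i < j" "j \<le> n"
  shows "w i \<noteq> w j"
  using ij
proof (induction "j - i" arbitrary: i j rule: less_induct)
  case less
  show ?case
  proof
    assume eq: "w i = w j"
    let ?c = "map w [i..<j]"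
    have "j - i \<noteq> 1" using adj[of i] adj_verts(3)[of "w i" "w (Suc i)"] eq less.prems
      by (metis One_nat_def Suc_leI add_diff_inverse_nat not_less_iff_gr_or_eq plus_1_eq_Suc add.commute order_less_le_trans)
    moreover have "j - i \<noteq> 2"
    proof
      assume "j - i = 2" then have "j = i + 2" by simp
      then show False using nb[of i] less.prems eq by simp
    qed
    ultimately have l: "3 \<le> length ?c" using less.prems by simp
    have ne: "w a \<noteq> w b" if "i \<le> a" "a < b" "b < j" for a b
      using less.hyps[of b a] that less.prems by force
    have "inj_on w {i..<j}"
      by (rule linorder_inj_onI') (use ne in auto)
    then have dist: "distinct ?c" by (simp add: distinct_map)
    have "adj T (?c ! k) (?c ! (Suc k mod length ?c))" if "k < length ?c" for k
    proof (cases "Suc k < length ?c")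
      case True then show ?thesis using adj[of "i + k"] less.prems by simp
    next
      case False
      then have k: "Suc k = j - i" using that by simp
      then have "Suc (i + k) = j" using less.prems by linarith
      then have "w (Suc (i + k)) = w i" using eq by simp
      then show ?thesis using adj[of "i + k"] less.prems k by simp
    qed
    then have "is_cycle T ?c" using l dist by (simp add: is_cycle_def)
    then show False using tree by (auto simp: tree_def)
  qed
qed

text \<open>Otherwise the geodesics from \<open>z\<close> to \<open>u\<close> and to \<open>v\<close>, joined by the edge, form a closed walk.
  It does not backtrack, because the distances to \<open>z\<close> of its vertices number \<open>i\<close> and \<open>i + 2\<close> are
  always different.\<close>

lemma adj_dist_ne:
  assumes uv: "adj T u v" and z: "z \<in> V" shows "d z u \<noteq> d z v"
proof
  assume eq: "d z u = d z v"
  define k where "k = d z u"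
  note V = adj_verts[OF uv]
  obtain f where f: "f 0 = z" "f k = u" "\<And>i. i < k \<Longrightarrow> adj T (f i) (f (Suc i))"
    "\<And>i. i \<le> k \<Longrightarrow> d z (f i) = i"
    using geodesic[OF z V(1)] unfolding k_def by metis
  obtain g where g: "g 0 = z" "g k = v" "\<And>i. i < k \<Longrightarrow> adj T (g i) (g (Suc i))"
    "\<And>i. i \<le> k \<Longrightarrow> d z (g i) = i"
    using geodesic[OF z V(2)] unfolding k_def eq by metis
  define w where "w i = (if i \<le> k then f i else g (2 * k + 1 - i))" for i
  have dw: "d z (w i) = (if i \<le> k then i else 2 * k + 1 - i)" if "i \<le> 2 * k + 1" for i
    using f(4) g(4) that by (simp add: w_def)
  have "w 0 \<noteq> w (2 * k + 1)"
  proof (rule nb_walk_inj[of "2 * k + 1"])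
    fix i assume i: "i < 2 * k + 1"
    consider "i < k" | "i = k" | "i > k" by linarith
    then show "adj T (w i) (w (Suc i))"
    proof cases
      case 1 then show ?thesis using f(3) by (simp add: w_def)
    next
      case 2 then show ?thesis using f(2) g(2) uv by (simp add: w_def)
    next
      case 3
      have "adj T (g (2 * k + 1 - Suc i)) (g (Suc (2 * k + 1 - Suc i)))" using g(3) 3 i by simp
      moreover have "Suc (2 * k + 1 - Suc i) = 2 * k + 1 - i" using i by simp
      ultimately show ?thesis using 3 by (simp add: w_def insert_commute)
    qed
  next
    fix i assume i: "i + 2 \<le> 2 * k + 1"
    have "d z (w (i + 2)) \<noteq> d z (w i)" using dw[of i] dw[of "i+2"] i by (simp split: if_splits) presburger
    then show "w (i + 2) \<noteq> w i" by metis
  qed auto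
  then show False using f(1) g(1) by (simp add: w_def)
qed

lemma adj_dist_cases:
  assumes uv: "adj T u v" and z: "z \<in> V" shows "d z u = Suc (d z v) \<or> d z v = Suc (d z u)"
proof -
  note V = adj_verts[OF uv]
  have "d z u \<le> d z v + 1" "d z v \<le> d z u + 1"
    using dist_triangle[of z v u] dist_triangle[of z u v] z V adj_dist[OF uv] dist_sym[of u v] by auto
  then show ?thesis using adj_dist_ne[OF assms] by linarith
qed

text \<open>Geodesics from \<open>z\<close> to two different neighbours of \<open>u\<close> would close up at \<open>u\<close> to a
  non-backtracking walk. This and the parity statement \<open>adj_dist_cases\<close> carry the whole geometry
  of half-trees.\<close>

lemma closer_unique:
  assumes uv: "adj T u v" and uw: "adj T u w" and z: "z \<in> V"
    and "d z u = Suc (d z v)" "d z u = Suc (d z w)"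
  shows "v = w"
proof (rule ccontr)
  assume ne: "v \<noteq> w"
  define k where "k = d z v"
  note V = adj_verts[OF uv] adj_verts[OF uw]
  have k: "d z w = k" "d z u = Suc k" using assms by (auto simp: k_def)
  obtain f where f: "f 0 = z" "f k = v" "\<And>i. i < k \<Longrightarrow> adj T (f i) (f (Suc i))"
    "\<And>i. i \<le> k \<Longrightarrow> d z (f i) = i"
    using geodesic[OF z V(2)] unfolding k_def by metis
  obtain g where g: "g 0 = z" "g k = w" "\<And>i. i < k \<Longrightarrow> adj T (g i) (g (Suc i))"
    "\<And>i. i \<le> k \<Longrightarrow> d z (g i) = i"
    using geodesic[OF z V(5)] unfolding k by metis
  define h where "h i = (if i \<le> k then f i else if i = Suc k then u else g (2 * k + 2 - i))" for i
  have dh: "d z (h i) = (if i \<le> Suc k then i else 2 * k + 2 - i)" if "i \<le> 2 * k + 2" for i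
    using f(4) g(4) that k by (auto simp: h_def)
  have "h 0 \<noteq> h (2 * k + 2)"
  proof (rule nb_walk_inj[of "2 * k + 2"])
    fix i assume i: "i < 2 * k + 2"
    consider "i < k" | "i = k" | "i = Suc k" | "i > Suc k" by linarith
    then show "adj T (h i) (h (Suc i))"
    proof cases
      case 1 then show ?thesis using f(3) by (simp add: h_def)
    next
      case 2 then show ?thesis using f(2) adj_sym[OF uv] by (simp add: h_def)
    next
      case 3 then show ?thesis using g(2) uw by (simp add: h_def)
    next
      case 4
      have "adj T (g (2 * k + 2 - Suc i)) (g (Suc (2 * k + 2 - Suc i)))" using g(3) 4 i by simp
      moreover have "Suc (2 * k + 2 - Suc i) = 2 * k + 2 - i" using i by simp
      ultimately show ?thesis using 4 by (simp add: h_def insert_commute)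
    qed
  next
    fix i assume i: "i + 2 \<le> 2 * k + 2"
    show "h (i + 2) \<noteq> h i"
    proof (cases "i = k")
      case True then show ?thesis using f(2) g(2) ne by (simp add: h_def)
    next
      case False
      then have "d z (h (i + 2)) \<noteq> d z (h i)" using dh[of i] dh[of "i+2"] i by auto
      then show ?thesis by metis
    qed
  qed auto
  then show False using f(1) g(1) by (simp add: h_def)
qed

section \<open>Half-trees\<close>

lemma half_V: "z \<in> half_tree T u v \<Longrightarrow> z \<in> V"
  by (simp add: half_tree_def)

lemma half_Un: "adj T u v \<Longrightarrow> z \<in> V \<Longrightarrow> z \<in> half_tree T u v \<or> z \<in> half_tree T v u"
  using adj_dist_cases by (auto simp: half_tree_def)

lemma half_disj: "z \<in> half_tree T u v \<Longrightarrow> z \<notin> half_tree T v u"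
  by (simp add: half_tree_def)

lemma half_not: "adj T u v \<Longrightarrow> z \<in> V \<Longrightarrow> z \<notin> half_tree T u v \<longleftrightarrow> z \<in> half_tree T v u"
  using half_Un half_disj by blast

lemma half_self: "adj T u v \<Longrightarrow> v \<in> half_tree T u v"
  using adj_verts[of u v] adj_dist[of v u] by (simp add: half_tree_def insert_commute)

lemma half_self': "adj T u v \<Longrightarrow> u \<notin> half_tree T u v"
  by (simp add: half_tree_def)

text \<open>A path from one side of an edge to the other has to use the edge. In the induction \<open>z'\<close> is
  the neighbour of \<open>z\<close> towards \<open>v\<close>; if \<open>z\<close> were nearer to \<open>a\<close> than \<open>z'\<close> is, then the unique
  neighbour of \<open>z'\<close> nearer to \<open>a\<close> would at once be \<open>z\<close> and the neighbour of \<open>z'\<close> towards \<open>v\<close>.\<close>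

lemma half_dist:
  assumes uv: "adj T u v" and a: "a \<in> half_tree T v u" and z: "z \<in> half_tree T u v"
  shows "d a z = d a u + 1 + d v z"
  using z
proof (induction "d v z" arbitrary: z rule: less_induct)
  case less
  note V = adj_verts[OF uv]
  have aV: "a \<in> V" and zV: "z \<in> V" using a less.prems by (auto simp: half_tree_def)
  have av: "d a v = Suc (d a u)" using a by (simp add: half_tree_def)
  show ?case
  proof (cases "z = v")
    case True then show ?thesis using av by simp
  next
    case False
    obtain z' where z': "adj T z z'" "d z v = Suc (d z' v)" using closer_ex[OF zV V(2) False] by blast
    have z'V: "z' \<in> V" using adj_verts[OF z'(1)] by simp
    have "d u z = Suc (d v z)" using less.prems by (simp add: half_tree_def dist_sym)
    moreover have "d u z \<le> d u z' + 1"
      using dist_triangle[of u z' z] V zV z'V adj_dist[OF z'(1)] dist_sym[of z z'] by simp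
    ultimately have "z' \<in> half_tree T u v"
      using adj_dist_cases[OF uv z'V] z'V z'(2) by (auto simp: half_tree_def dist_sym)
    then have IH: "d a z' = d a u + 1 + d v z'"
      using less.hyps[of z'] z'(2) by (simp add: dist_sym[of z' v] dist_sym[of z v])
    have "\<not> d a z' = Suc (d a z)"
    proof
      assume c: "d a z' = Suc (d a z)"
      show False
      proof (cases "z' = v")
        case True
        then have "z = u" using closer_unique[of v z u a] z'(1) uv aV c av by (simp add: insert_commute)
        then show False using less.prems by (simp add: half_tree_def)
      next
        case F2: False
        obtain z'' where z'': "adj T z' z''" "d z' v = Suc (d z'' v)" using closer_ex[OF z'V V(2) F2] by blast
        have z''V: "z'' \<in> V" using adj_verts[OF z''(1)] by simp
        have "d u z' = Suc (d v z')" using \<open>z' \<in> half_tree T u v\<close> by (simp add: half_tree_def dist_sym)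
        moreover have "d u z' \<le> d u z'' + 1"
          using dist_triangle[of u z'' z'] V z''V z'V adj_dist[OF z''(1)] dist_sym[of z' z''] by simp
        ultimately have "z'' \<in> half_tree T u v"
          using adj_dist_cases[OF uv z''V] z''V z''(2) by (auto simp: half_tree_def dist_sym)
        then have "d a z'' = d a u + 1 + d v z''"
          using less.hyps[of z''] z'(2) z''(2) by (simp add: dist_sym[of z' v] dist_sym[of z v] dist_sym[of z'' v])
        then have "d a z' = Suc (d a z'')" using IH z''(2) by (simp add: dist_sym[of z' v] dist_sym[of z'' v])
        then have "z'' = z" using closer_unique[OF z''(1) adj_sym[OF z'(1)] aV] c by blast
        then show False using z'(2) z''(2) by simp
      qed
    qed
    then have "d a z = Suc (d a z')" using adj_dist_cases[OF z'(1) aV] by blast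
    then show ?thesis using IH z'(2) by (simp add: dist_sym[of z' v] dist_sym[of z v])
  qed
qed

lemma half_cross:
  assumes uv: "adj T u v" and ab: "adj T a b" and "a \<in> half_tree T v u" "b \<in> half_tree T u v"
  shows "a = u" "b = v"
proof -
  have "d a u = 0" "d v b = 0" using half_dist[OF uv assms(3,4)] adj_dist[OF ab] by auto
  then show "a = u" "b = v" using dist_0 adj_verts[OF uv] adj_verts[OF ab] by auto
qed

lemma half_sub:
  assumes uv: "adj T u v" and ac: "adj T a c"
    and "v \<in> half_tree T a c" "a \<in> half_tree T v u"
  shows "half_tree T u v \<subseteq> half_tree T a c"
proof
  fix z assume z: "z \<in> half_tree T u v"
  show "z \<in> half_tree T a c"
  proof (rule ccontr)
    assume "z \<notin> half_tree T a c"
    then have z2: "z \<in> half_tree T c a" using half_not[OF ac] z half_V by blast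
    have "d a z = d a u + 1 + d v z" by (rule half_dist[OF uv assms(4) z])
    moreover have "d z v = d z a + 1 + d c v" by (rule half_dist[OF ac z2 assms(3)])
    ultimately show False using dist_sym by (metis add.assoc add.commute add_diff_cancel_right' diff_add_zero less_add_same_cancel1 not_less_iff_gr_or_eq trans_less_add1 zero_less_one add_is_0 one_neq_zero add_cancel_left_right)
  qed
qed

lemma half_succ:
  assumes uv: "adj T u v" and vw: "adj T v w" and "w \<noteq> u"
  shows "half_tree T v w \<subseteq> half_tree T u v" "w \<in> half_tree T u v" "u \<in> half_tree T w v"
proof -
  have u: "u \<in> half_tree T w v"
  proof (rule ccontr)
    assume "u \<notin> half_tree T w v"
    then have "u \<in> half_tree T v w" using half_not[OF adj_sym[OF vw]] adj_verts[OF uv] by blast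
    then show False using half_cross[OF vw, of v u] uv half_self[OF adj_sym[OF vw]] assms(3) by (metis adj_sym)
  qed
  then have "d u w = d u v + 1 + d w w" using half_dist[OF vw u half_self[OF vw]] by simp
  then show w: "w \<in> half_tree T u v"
    using adj_dist[OF uv] adj_verts[OF vw] adj_dist[OF vw] by (simp add: half_tree_def dist_sym)
  show "half_tree T v w \<subseteq> half_tree T u v" by (rule half_sub[OF vw uv w u])
  show "u \<in> half_tree T w v" by (rule u)
qed

lemma half_towards:
  assumes "x \<in> V" "z \<in> V" "x \<noteq> z"
  shows "\<exists>!w. adj T x w \<and> z \<in> half_tree T x w"
proof -
  obtain w where w: "adj T x w" "d x z = Suc (d w z)" using closer_ex[OF assms] by blast
  then have "adj T x w \<and> z \<in> half_tree T x w" using assms by (simp add: half_tree_def dist_sym)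
  moreover have "w1 = w2" if "adj T x w1 \<and> z \<in> half_tree T x w1" "adj T x w2 \<and> z \<in> half_tree T x w2" for w1 w2
    using closer_unique[of x w1 w2 z] that assms by (simp add: half_tree_def)
  ultimately show ?thesis by blast
qed

text \<open>Half-trees are connected: every vertex is reached from \<open>v\<close> inside the half-tree.\<close>

lemma half_induct [consumes 2, case_names start step]:
  assumes uv: "adj T u v" and z: "z \<in> half_tree T u v"
    and P0: "P v" and step: "\<And>a b. adj T a b \<Longrightarrow> a \<in> half_tree T u v \<Longrightarrow> b \<in> half_tree T u v \<Longrightarrow> P a \<Longrightarrow> P b"
  shows "P z"
  using z
proof (induction "d v z" arbitrary: z)
  case 0
  then have "z = v" using dist_0[of v z] adj_verts[OF uv] half_V by auto
  then show ?case using P0 by simp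
next
  case (Suc n)
  note V = adj_verts[OF uv] and zV = half_V[OF Suc.prems]
  have "z \<noteq> v" using Suc.hyps(2) by auto
  then obtain z' where z': "adj T z z'" "d z v = Suc (d z' v)" using closer_ex[OF zV V(2)] by blast
  have z'V: "z' \<in> V" using adj_verts[OF z'(1)] by simp
  have "z' \<in> half_tree T u v"
  proof (rule ccontr)
    assume "z' \<notin> half_tree T u v"
    then have "z' \<in> half_tree T v u" using half_not[OF uv z'V] by simp
    then show False using half_cross[OF uv adj_sym[OF z'(1)] _ Suc.prems] \<open>z \<noteq> v\<close> by blast
  qed
  then show ?case using step[OF adj_sym[OF z'(1)] _ Suc.prems] Suc.hyps(1)[of z'] Suc.hyps(2) z'(2)
    by (simp add: dist_sym)
qed

lemma V_induct [consumes 2, case_names start step]: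
  assumes x: "x \<in> V" and z: "z \<in> V"
    and P0: "P x" and step: "\<And>a b. adj T a b \<Longrightarrow> d x b = Suc (d x a) \<Longrightarrow> P a \<Longrightarrow> P b"
  shows "P z"
  using z
proof (induction "d x z" arbitrary: z)
  case 0
  then have "z = x" using dist_0[of x z] x by auto
  then show ?case using P0 by simp
next
  case (Suc n)
  have "z \<noteq> x" using Suc.hyps(2) by auto
  then obtain z' where z': "adj T z z'" "d z x = Suc (d z' x)" using closer_ex[OF Suc.prems x] by blast
  have z'V: "z' \<in> V" using adj_verts[OF z'(1)] by simp
  show ?case using step[OF adj_sym[OF z'(1)]] Suc.hyps(1)[of z'] Suc.hyps(2) z'(2) z'V
    by (simp add: dist_sym)
qed

end

context tree_graph
begin

section \<open>Rays and ends\<close>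

lemma rays_adj: "r \<in> rays T \<Longrightarrow> adj T (r n) (r (Suc n))"
  by (simp add: rays_def)

lemma rays_nb: "r \<in> rays T \<Longrightarrow> r (Suc (Suc n)) \<noteq> r n"
  by (simp add: rays_def)

lemma rays_V: "r \<in> rays T \<Longrightarrow> r n \<in> V"
  using rays_adj adj_verts by blast

lemma ray_half_mono: 
  assumes r: "r \<in> rays T" and "m \<le> n"
  shows "half_tree T (r n) (r (Suc n)) \<subseteq> half_tree T (r m) (r (Suc m))"
  using assms(2)
proof (induction n rule: dec_induct)
  case (step n)
  have "half_tree T (r (Suc n)) (r (Suc (Suc n))) \<subseteq> half_tree T (r n) (r (Suc n))"
    by (rule half_succ(1)) (use rays_adj rays_nb r in blast)+
  then show ?case using step by blast
qed simp

lemma ray_half_mono': 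
  assumes r: "r \<in> rays T" and "m \<le> n"
  shows "half_tree T (r (Suc m)) (r m) \<subseteq> half_tree T (r (Suc n)) (r n)"
  using assms(2)
proof (induction n rule: dec_induct)
  case (step n)
  have "half_tree T (r (Suc n)) (r n) \<subseteq> half_tree T (r (Suc (Suc n))) (r (Suc n))"
    by (rule half_succ(1)) (use rays_adj[OF r] rays_nb[OF r] adj_sym in metis)+
  then show ?case using step by blast
qed simp

lemma ray_in_half:
  assumes r: "r \<in> rays T" and "n < m" shows "r m \<in> half_tree T (r n) (r (Suc n))"
proof -
  obtain k where k: "m = Suc k" "n \<le> k" using assms(2) by (cases m) auto
  then show ?thesis using ray_half_mono[OF r k(2)] half_self[OF rays_adj[OF r]] by blast
qed

lemma ray_in_half': "r \<in> rays T \<Longrightarrow> m \<le> n \<Longrightarrow> r m \<in> half_tree T (r (Suc n)) (r n)"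
  using ray_half_mono'[of r m n] half_self[OF adj_sym[OF rays_adj[of r m]]] by blast

lemma ray_dist: assumes r: "r \<in> rays T" shows "d (r m) (r (m + k)) = k"
proof (induction k)
  case (Suc k)
  have "r m \<in> half_tree T (r (Suc (m + k))) (r (m + k))" by (rule ray_in_half'[OF r]) simp
  then show ?case using Suc by (simp add: half_tree_def)
qed simp

lemma ray_leave: 
  assumes r: "r \<in> rays T" and x: "x \<in> V" shows "\<forall>\<^sub>F n in sequentially. x \<in> half_tree T (r (Suc n)) (r n)"
proof -
  have "x \<in> half_tree T (r (Suc n)) (r n)" if "n \<ge> d (r 0) x" for n
  proof (rule ccontr)
    assume "x \<notin> half_tree T (r (Suc n)) (r n)"
    then have "x \<in> half_tree T (r n) (r (Suc n))" using half_not[OF rays_adj[OF r]] x half_disj half_Un rays_adj[OF r] by metis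
    then have "d (r 0) x = d (r 0) (r n) + 1 + d (r (Suc n)) x"
      using half_dist[OF rays_adj[OF r] ray_in_half'[OF r, of 0 n]] by simp
    then show False using ray_dist[OF r, of 0 n] that by simp
  qed
  then show ?thesis unfolding eventually_sequentially by blast
qed

text \<open>A ray does not return after it has crossed an edge, so it crosses an edge at most once.\<close>

lemma ray_side:
  assumes uv: "adj T u v" and r: "r \<in> rays T"
  shows "(\<forall>\<^sub>F n in sequentially. r n \<in> half_tree T u v) \<or> (\<forall>\<^sub>F n in sequentially. r n \<in> half_tree T v u)"
proof -
  have cross: "\<forall>\<^sub>F n in sequentially. r n \<in> half_tree T a b"
    if ab: "adj T a b" and "r n \<in> half_tree T b a" "r (Suc n) \<in> half_tree T a b" for a b n
  proof -
    have "r n = a" "r (Suc n) = b" using half_cross[OF ab rays_adj[OF r] that(2,3)] by auto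
    then have "\<forall>m\<ge>Suc n. r m \<in> half_tree T a b" using ray_in_half[OF r, of n] by auto
    then show ?thesis unfolding eventually_sequentially by blast
  qed
  show ?thesis
  proof (cases "\<exists>n. (r n \<in> half_tree T v u \<and> r (Suc n) \<in> half_tree T u v) \<or> (r n \<in> half_tree T u v \<and> r (Suc n) \<in> half_tree T v u)")
    case True
    then show ?thesis using cross[OF uv] cross[OF adj_sym[OF uv]] by blast
  next
    case False
    have "(r 0 \<in> half_tree T u v \<longrightarrow> r n \<in> half_tree T u v) \<and> (r 0 \<in> half_tree T v u \<longrightarrow> r n \<in> half_tree T v u)" for n
    proof (induction n)
      case (Suc n)
      have "r (Suc n) \<in> half_tree T u v \<or> r (Suc n) \<in> half_tree T v u" using half_Un[OF uv rays_V[OF r]] by blast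
      then show ?case using Suc False half_disj by blast
    qed simp
    then have "(\<forall>n. r n \<in> half_tree T u v) \<or> (\<forall>n. r n \<in> half_tree T v u)" using half_Un[OF uv rays_V[OF r, of 0]] by blast
    then show ?thesis by (auto intro: always_eventually)
  qed
qed

lemma cofinal_equiv: "equiv (rays T) (cofinal T)"
proof (rule equivI)
  show "cofinal T \<subseteq> rays T \<times> rays T" by (auto simp: cofinal_def)
  show "refl_on (rays T) (cofinal T)" by (auto simp: refl_on_def cofinal_def)
  show "sym (cofinal T)"
  proof (rule symI)
    fix r s assume "(r, s) \<in> cofinal T"
    then obtain m n where h: "r \<in> rays T" "s \<in> rays T" "\<forall>k. r (m + k) = s (n + k)"
      unfolding cofinal_def by auto
    then have "\<forall>k. s (n + k) = r (m + k)" by simp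
    then show "(s, r) \<in> cofinal T" using h(1,2) unfolding cofinal_def by blast
  qed
  show "trans (cofinal T)"
  proof (rule transI)
    fix r s t assume "(r, s) \<in> cofinal T" "(s, t) \<in> cofinal T"
    then obtain m n n' l where h: "r \<in> rays T" "t \<in> rays T" "\<And>k. r (m + k) = s (n + k)" "\<And>k. s (n' + k) = t (l + k)"
      unfolding cofinal_def by auto
    have "r ((m + n') + k) = t ((l + n) + k)" for k
      using h(3)[of "n' + k"] h(4)[of "n + k"] by (simp add: ac_simps)
    then show "(r, t) \<in> cofinal T" using h unfolding cofinal_def by blast
  qed
qed

lemma cofinal_eventually:
  assumes "(r, s) \<in> cofinal T" "\<forall>\<^sub>F n in sequentially. P (r n)" shows "\<forall>\<^sub>F n in sequentially. P (s n)"
proof -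
  obtain m n where h: "\<And>k. r (m + k) = s (n + k)" using assms unfolding cofinal_def by auto
  have "\<forall>\<^sub>F k in sequentially. P (r (k + m))" using assms(2) by (simp add: eventually_sequentially_seg[of "\<lambda>n. P (r n)"])
  then have "\<forall>\<^sub>F k in sequentially. P (s (k + n))" using h by (simp add: add.commute)
  then show ?thesis by (simp add: eventually_sequentially_seg[of "\<lambda>n. P (s n)"])
qed

lemma end_rays: "\<xi> \<in> ends T \<Longrightarrow> r \<in> \<xi> \<Longrightarrow> r \<in> rays T"
  unfolding ends_def using in_quotient_imp_subset[OF cofinal_equiv] by blast

lemma end_cofinal: "\<xi> \<in> ends T \<Longrightarrow> r \<in> \<xi> \<Longrightarrow> s \<in> \<xi> \<longleftrightarrow> (r, s) \<in> cofinal T"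
  unfolding ends_def using cofinal_equiv in_quotient_imp_closed[of "rays T" "cofinal T" \<xi> r s]
    quotient_eq_iff[of "rays T" "cofinal T" \<xi> \<xi> r s] by blast

lemma end_of_ray: "r \<in> rays T \<Longrightarrow> \<exists>\<xi>\<in>ends T. r \<in> \<xi>"
  unfolding ends_def by (metis cofinal_equiv equiv_class_self quotientI)

lemma end_eqI: "\<xi> \<in> ends T \<Longrightarrow> \<xi>' \<in> ends T \<Longrightarrow> r \<in> \<xi> \<Longrightarrow> r \<in> \<xi>' \<Longrightarrow> \<xi> = \<xi>'"
  unfolding ends_def using cofinal_equiv by (meson quotient_disj disjoint_iff)

lemma end_nonempty: "\<xi> \<in> ends T \<Longrightarrow> \<exists>r. r \<in> \<xi>"
  unfolding ends_def using cofinal_equiv by (metis in_quotient_imp_non_empty ex_in_conv)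

lemma half_ends_iff:
  assumes "\<xi> \<in> ends T" "r \<in> \<xi>" shows "\<xi> \<in> half_ends T u v \<longleftrightarrow> (\<forall>\<^sub>F n in sequentially. r n \<in> half_tree T u v)"
proof
  assume "\<xi> \<in> half_ends T u v"
  then obtain s where s: "s \<in> \<xi>" "\<forall>\<^sub>F n in sequentially. s n \<in> half_tree T u v" unfolding half_ends_def by blast
  have "(s, r) \<in> cofinal T" using end_cofinal[OF assms(1) s(1)] assms(2) by simp
  then show "\<forall>\<^sub>F n in sequentially. r n \<in> half_tree T u v" using cofinal_eventually s(2) by fast
next
  assume "\<forall>\<^sub>F n in sequentially. r n \<in> half_tree T u v"
  then show "\<xi> \<in> half_ends T u v" unfolding half_ends_def using assms by auto
qed

lemma half_ends_ends: "\<xi> \<in> half_ends T u v \<Longrightarrow> \<xi> \<in> ends T"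
  by (simp add: half_ends_def)

lemma half_ends_not: assumes "adj T u v" "\<xi> \<in> ends T" shows "\<xi> \<notin> half_ends T u v \<longleftrightarrow> \<xi> \<in> half_ends T v u"
proof -
  obtain r where r: "r \<in> \<xi>" "r \<in> rays T" using end_nonempty end_rays assms by blast
  have "\<not> ((\<forall>\<^sub>F n in sequentially. r n \<in> half_tree T u v) \<and> (\<forall>\<^sub>F n in sequentially. r n \<in> half_tree T v u))"
  proof
    assume "(\<forall>\<^sub>F n in sequentially. r n \<in> half_tree T u v) \<and> (\<forall>\<^sub>F n in sequentially. r n \<in> half_tree T v u)"
    then have "\<forall>\<^sub>F n in sequentially. r n \<in> half_tree T u v \<and> r n \<in> half_tree T v u" by (simp add: eventually_conj_iff)
    then show False using half_disj by (auto simp: eventually_sequentially)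
  qed
  then show ?thesis using ray_side[OF assms(1) r(2)] half_ends_iff[OF assms(2) r(1)] by blast
qed

lemma half_ends_mono: assumes sub: "half_tree T u v \<subseteq> half_tree T a c" shows "half_ends T u v \<subseteq> half_ends T a c"
proof
    fix \<xi> assume "\<xi> \<in> half_ends T u v"
    then obtain r where r: "\<xi> \<in> ends T" "r \<in> \<xi>" "\<forall>\<^sub>F n in sequentially. r n \<in> half_tree T u v"
      unfolding half_ends_def by blast
    have "\<forall>\<^sub>F n in sequentially. r n \<in> half_tree T a c"
      using r(3) by (rule eventually_mono) (use sub in blast)
    then show "\<xi> \<in> half_ends T a c" using half_ends_iff[OF r(1,2)] by simp
qed

lemma half_ends_Int: assumes "\<xi> \<in> half_ends T u v" "\<xi> \<in> half_ends T a c" shows "half_tree T u v \<inter> half_tree T a c \<noteq> {}"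
proof -
  have x: "\<xi> \<in> ends T" using assms half_ends_ends by blast
  obtain r where r: "r \<in> \<xi>" "r \<in> rays T" using end_nonempty end_rays x by blast
  have "\<forall>\<^sub>F n in sequentially. r n \<in> half_tree T u v \<and> r n \<in> half_tree T a c" 
    using assms half_ends_iff[OF x r(1)] by (simp add: eventually_conj_iff)
  then show ?thesis by (auto simp: eventually_sequentially)
qed

lemma half_branch_unique: "adj T u v \<Longrightarrow> adj T u w \<Longrightarrow> z \<in> half_tree T u v \<Longrightarrow> z \<in> half_tree T u w \<Longrightarrow> v = w"
  by (rule closer_unique[of u v w z]) (simp_all add: half_tree_def)

lemma half_ends_branch_unique: "adj T u v \<Longrightarrow> adj T u w \<Longrightarrow> \<xi> \<in> half_ends T u v \<Longrightarrow> \<xi> \<in> half_ends T u w \<Longrightarrow> v = w"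
  using half_ends_Int half_branch_unique by blast

lemma half_ends_ray: assumes "\<xi> \<in> ends T" "r \<in> \<xi>" shows "\<xi> \<in> half_ends T (r n) (r (Suc n))"
proof -
  have "\<forall>m\<ge>Suc n. r m \<in> half_tree T (r n) (r (Suc n))" using ray_in_half[OF end_rays[OF assms]] by simp
  then show ?thesis unfolding half_ends_iff[OF assms] eventually_sequentially by blast
qed

text \<open>Moving the initial vertex to a neighbour either deletes the first vertex of the ray or puts
  one more in front.\<close>

lemma ray_from_ex: assumes \<xi>: "\<xi> \<in> ends T" and x: "x \<in> V" shows "\<exists>r\<in>\<xi>. r 0 = x"
proof -
  obtain r where r: "r \<in> \<xi>" using end_nonempty \<xi> by blast
  have "r 0 \<in> V" using end_rays[OF \<xi> r] rays_V by blast
  then show ?thesis using x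
  proof (induction rule: V_induct)
    case start then show ?case using r by blast
  next
    case (step a b)
    then obtain s where s: "s \<in> \<xi>" "s 0 = a" by blast
    note sr = end_rays[OF \<xi> s(1)]
    show ?case
    proof (cases "s 1 = b")
      case True
      let ?t = "\<lambda>n. s (Suc n)"
      have "?t \<in> rays T" using sr by (simp add: rays_def)
      moreover have "(\<exists>m n. \<forall>k. s (m + k) = ?t (n + k))" by (rule exI[of _ 1], rule exI[of _ 0]) simp
      ultimately have "(s, ?t) \<in> cofinal T" using sr by (simp add: cofinal_def)
      then show ?thesis using end_cofinal[OF \<xi> s(1)] True by (metis One_nat_def)
    next
      case False
      let ?t = "\<lambda>n. case n of 0 \<Rightarrow> b | Suc m \<Rightarrow> s m"
      have "?t \<in> rays T"
        unfolding rays_def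
      proof (intro CollectI allI)
        fix n show "{?t n, ?t (Suc n)} \<in> edges T \<and> ?t (Suc (Suc n)) \<noteq> ?t n"
          using s(2) False adj_sym[OF step(1)] rays_adj[OF sr] rays_nb[OF sr] by (cases n) auto
      qed
      moreover have "(\<exists>m n. \<forall>k. s (m + k) = ?t (n + k))" by (rule exI[of _ 0], rule exI[of _ 1]) simp
      ultimately have "(s, ?t) \<in> cofinal T" using sr by (simp add: cofinal_def)
      then show ?thesis using end_cofinal[OF \<xi> s(1)] by (metis nat.case(1))
    qed
  qed
qed

lemma ray_from: assumes "\<xi> \<in> ends T" "x \<in> V" obtains r where "r \<in> \<xi>" "r 0 = x" "r \<in> rays T"
  using ray_from_ex[OF assms] end_rays[OF assms(1)] that by blast

lemma ray_unique: assumes \<xi>: "\<xi> \<in> ends T" and "r \<in> \<xi>" "s \<in> \<xi>" "r 0 = s 0" shows "r = s"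
proof
  fix n show "r n = s n"
  proof (induction n)
    case (Suc n)
    show ?case
      using half_ends_branch_unique[OF _ _ half_ends_ray[OF \<xi> assms(2)], of n "s (Suc n)"] half_ends_ray[OF \<xi> assms(3), of n]
        Suc rays_adj[OF end_rays[OF \<xi> assms(2)], of n] rays_adj[OF end_rays[OF \<xi> assms(3)], of n] by simp
  qed (use assms in simp)
qed

lemma half_ends_first: assumes "\<xi> \<in> half_ends T u v" "adj T u v" "r \<in> \<xi>" "r 0 = u" shows "r (Suc 0) = v"
proof -
  note x = half_ends_ends[OF assms(1)]
  show ?thesis using half_ends_ray[OF x assms(3), of 0] rays_adj[OF end_rays[OF x assms(3)], of 0] half_ends_branch_unique assms by metis
qed

lemma branch_ex1: assumes "\<xi> \<in> ends T" "x \<in> V" shows "\<exists>!w. adj T x w \<and> \<xi> \<in> half_ends T x w"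
proof -
  obtain r where r: "r \<in> \<xi>" "r 0 = x" "r \<in> rays T" using ray_from[OF assms] by blast
  have "adj T x (r 1) \<and> \<xi> \<in> half_ends T x (r 1)" using half_ends_ray[OF assms(1) r(1), of 0] rays_adj[OF r(3), of 0] r(2) by simp
  then show ?thesis using half_ends_branch_unique by blast
qed

lemma ends_sep: assumes "\<xi> \<in> ends T" "\<xi>' \<in> ends T" "\<xi> \<noteq> \<xi>'"
  obtains u v where "adj T u v" "\<xi> \<in> half_ends T u v" "\<xi>' \<in> half_ends T v u"
proof -
  obtain x where x: "x \<in> V" using V_nonempty by blast
  obtain r where r: "r \<in> \<xi>" "r 0 = x" "r \<in> rays T" using ray_from[OF assms(1) x] by blast
  obtain s where s: "s \<in> \<xi>'" "s 0 = x" "s \<in> rays T" using ray_from[OF assms(2) x] by blast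
  have "\<exists>n. \<xi>' \<notin> half_ends T (r n) (r (Suc n))"
  proof (rule ccontr)
    assume c: "\<not> ?thesis"
    have "r n = s n" for n
    proof (induction n)
      case (Suc n)
      have "\<xi>' \<in> half_ends T (s n) (r (Suc n))" using c Suc by metis
      then show ?case using half_ends_branch_unique[of "s n" "r (Suc n)" "s (Suc n)" \<xi>'] Suc rays_adj[OF r(3), of n] rays_adj[OF s(3), of n]
          half_ends_ray[OF assms(2) s(1), of n] by simp
    qed (simp add: r s)
    then have "r = s" by blast
    then show False using end_eqI assms r s by blast
  qed
  then obtain n where "\<xi>' \<notin> half_ends T (r n) (r (Suc n))" by blast
  then show ?thesis using that[OF rays_adj[OF r(3)] half_ends_ray[OF assms(1) r(1)]] half_ends_not[OF rays_adj[OF r(3)] assms(2)] by blast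
qed

lemma ray_half_ends_half_sub:
  assumes \<xi>: "\<xi> \<in> ends T" and r: "r \<in> \<xi>" and uv: "adj T u v" and b: "\<xi> \<in> half_ends T u v"
  shows "\<forall>\<^sub>F n in sequentially. half_tree T (r n) (r (Suc n)) \<subseteq> half_tree T u v"
proof -
  note rr = end_rays[OF \<xi> r]
  have 1: "\<forall>\<^sub>F n in sequentially. r n \<in> half_tree T u v" using half_ends_iff[OF \<xi> r] b by simp
  then have 2: "\<forall>\<^sub>F n in sequentially. r (Suc n) \<in> half_tree T u v"
    by (simp add: eventually_sequentially_Suc[of "\<lambda>n. r n \<in> half_tree T u v"])
  have "\<forall>\<^sub>F n in sequentially. u \<in> half_tree T (r (Suc n)) (r n)" by (rule ray_leave[OF rr adj_verts(1)[OF uv]])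
  with 2 show ?thesis
    by eventually_elim (rule half_sub[OF rays_adj[OF rr] uv])
qed

lemma half_ends_directed:
  assumes "adj T u v" "\<xi> \<in> half_ends T u v" "adj T a c" "\<xi> \<in> half_ends T a c"
  obtains s t where "adj T s t" "\<xi> \<in> half_ends T s t" "half_tree T s t \<subseteq> half_tree T u v" "half_tree T s t \<subseteq> half_tree T a c"
proof -
  have \<xi>: "\<xi> \<in> ends T" using assms half_ends_ends by blast
  obtain r where r: "r \<in> \<xi>" using end_nonempty[OF \<xi>] by blast
  have "\<forall>\<^sub>F n in sequentially. half_tree T (r n) (r (Suc n)) \<subseteq> half_tree T u v \<and> half_tree T (r n) (r (Suc n)) \<subseteq> half_tree T a c"
    using ray_half_ends_half_sub[OF \<xi> r assms(1,2)] ray_half_ends_half_sub[OF \<xi> r assms(3,4)] by (simp add: eventually_conj_iff)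
  then obtain n where "half_tree T (r n) (r (Suc n)) \<subseteq> half_tree T u v \<and> half_tree T (r n) (r (Suc n)) \<subseteq> half_tree T a c"
    by (auto simp: eventually_sequentially)
  then show ?thesis using that[OF rays_adj[OF end_rays[OF \<xi> r]] half_ends_ray[OF \<xi> r]] by blast
qed

section \<open>Convergence to an end\<close>

text \<open>The filter of an end is generated by the half-trees that contain the tails of its rays. All
  statements about convergence to an end are used in this form.\<close>

lemma to_end_half:
  assumes \<xi>: "\<xi> \<in> ends T"
  shows "to_end T \<xi> = (INF e\<in>{(u, v). adj T u v \<and> \<xi> \<in> half_ends T u v}. principal (half_tree T (fst e) (snd e)))"
    (is "_ = (INF e\<in>?S. ?F e)")
proof (rule antisym)
  show "to_end T \<xi> \<le> (INF e\<in>?S. ?F e)"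
  proof (rule INF_greatest)
    fix e assume "e \<in> ?S"
    then obtain u v where e: "e = (u, v)" "adj T u v" "\<xi> \<in> half_ends T u v" by auto
    obtain r where r: "r \<in> \<xi>" "r 0 = u" "r \<in> rays T" using ray_from[OF \<xi>] adj_verts[OF e(2)] by blast
    have r1: "r (Suc 0) = v" using half_ends_first[OF e(3,2) r(1,2)] .
    have "{z \<in> V. d (r 0) z = d (r 0) (r (Suc 0)) + d (r (Suc 0)) z} \<subseteq> half_tree T u v"
    proof
      fix z assume "z \<in> {z \<in> V. d (r 0) z = d (r 0) (r (Suc 0)) + d (r (Suc 0)) z}"
      then have "z \<in> V" "d u z = Suc (d v z)" using r(2) r1 adj_dist[OF e(2)] by auto
      then show "z \<in> half_tree T u v" by (simp add: half_tree_def dist_sym[of z])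
    qed
    then have "principal {z \<in> V. d (r 0) z = d (r 0) (r (Suc 0)) + d (r (Suc 0)) z} \<le> ?F e"
      using e by simp
    then have "(INF k. principal {z \<in> V. d (r 0) z = d (r 0) (r k) + d (r k) z}) \<le> ?F e"
      by (rule INF_lower2[of "Suc 0", OF UNIV_I])
    then show "to_end T \<xi> \<le> ?F e" unfolding to_end_def by (rule INF_lower2[OF r(1)])
  qed
  show "(INF e\<in>?S. ?F e) \<le> to_end T \<xi>"
    unfolding to_end_def
  proof (intro INF_greatest)
    fix r k assume r: "r \<in> \<xi>"
    note rr = end_rays[OF \<xi> r]
    have "(r k, r (Suc k)) \<in> ?S" using rays_adj[OF rr] half_ends_ray[OF \<xi> r] by simp
    moreover
    have "half_tree T (r k) (r (Suc k)) \<subseteq> {z \<in> V. d (r 0) z = d (r 0) (r k) + d (r k) z}"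
    proof
      fix z assume z: "z \<in> half_tree T (r k) (r (Suc k))"
      have "d (r 0) z = d (r 0) (r k) + 1 + d (r (Suc k)) z"
        using half_dist[OF rays_adj[OF rr] ray_in_half'[OF rr, of 0 k] z] by simp
      moreover have "d (r k) z = Suc (d (r (Suc k)) z)"
        using z by (simp add: half_tree_def dist_sym[of z])
      ultimately show "z \<in> {z \<in> V. d (r 0) z = d (r 0) (r k) + d (r k) z}"
        using half_V[OF z] by simp
    qed
    then have "?F (r k, r (Suc k)) \<le> principal {z \<in> V. d (r 0) z = d (r 0) (r k) + d (r k) z}" by simp
    ultimately show "(INF e\<in>?S. ?F e) \<le> principal {z \<in> V. d (r 0) z = d (r 0) (r k) + d (r k) z}"
      by (rule INF_lower2)
  qed
qed

lemma eventually_to_end: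
  assumes \<xi>: "\<xi> \<in> ends T"
  shows "eventually P (to_end T \<xi>) \<longleftrightarrow> (\<exists>u v. adj T u v \<and> \<xi> \<in> half_ends T u v \<and> (\<forall>z\<in>half_tree T u v. P z))"
proof -
  let ?S = "{(u, v). adj T u v \<and> \<xi> \<in> half_ends T u v}"
  have "eventually P (INF e\<in>?S. principal (half_tree T (fst e) (snd e))) \<longleftrightarrow>
      (\<exists>e\<in>?S. eventually P (principal (half_tree T (fst e) (snd e))))"
  proof (rule eventually_INF_base)
    obtain x where "x \<in> V" using V_nonempty by blast
    then show "?S \<noteq> {}" using branch_ex1[OF \<xi>] by blast
  next
    fix e f assume "e \<in> ?S" "f \<in> ?S"
    then obtain u v a c where e: "e = (u, v)" "adj T u v" "\<xi> \<in> half_ends T u v" and f: "f = (a, c)" "adj T a c" "\<xi> \<in> half_ends T a c"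
      by auto
    obtain s t where "adj T s t" "\<xi> \<in> half_ends T s t" "half_tree T s t \<subseteq> half_tree T u v" "half_tree T s t \<subseteq> half_tree T a c"
      using half_ends_directed[OF e(2,3) f(2,3)] by blast
    then show "\<exists>x\<in>?S. principal (half_tree T (fst x) (snd x)) \<le> inf (principal (half_tree T (fst e) (snd e))) (principal (half_tree T (fst f) (snd f)))"
      using e f by (intro bexI[of _ "(s, t)"]) auto
  qed
  then show ?thesis unfolding to_end_half[OF \<xi>] by (auto simp: eventually_principal)
qed

lemma filterlim_to_end:
  assumes \<xi>: "\<xi> \<in> ends T"
  shows "filterlim f (to_end T \<xi>) F \<longleftrightarrow> (\<forall>u v. adj T u v \<longrightarrow> \<xi> \<in> half_ends T u v \<longrightarrow> eventually (\<lambda>z. f z \<in> half_tree T u v) F)"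
proof
  assume L: "filterlim f (to_end T \<xi>) F"
  show "\<forall>u v. adj T u v \<longrightarrow> \<xi> \<in> half_ends T u v \<longrightarrow> eventually (\<lambda>z. f z \<in> half_tree T u v) F"
  proof (intro allI impI)
    fix u v assume "adj T u v" "\<xi> \<in> half_ends T u v"
    then have "eventually (\<lambda>z. z \<in> half_tree T u v) (to_end T \<xi>)" unfolding eventually_to_end[OF \<xi>] by blast
    then show "eventually (\<lambda>z. f z \<in> half_tree T u v) F" using L by (rule eventually_compose_filterlim)
  qed
next
  assume R: "\<forall>u v. adj T u v \<longrightarrow> \<xi> \<in> half_ends T u v \<longrightarrow> eventually (\<lambda>z. f z \<in> half_tree T u v) F"
  show "filterlim f (to_end T \<xi>) F"
    unfolding filterlim_iff
  proof (intro allI impI)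
    fix P assume "eventually P (to_end T \<xi>)"
    then obtain u v where "adj T u v" "\<xi> \<in> half_ends T u v" "\<forall>z\<in>half_tree T u v. P z" unfolding eventually_to_end[OF \<xi>] by blast
    then have e: "eventually (\<lambda>z. f z \<in> half_tree T u v) F" using R by blast
    show "eventually (\<lambda>x. P (f x)) F"
      by (rule eventually_mono[OF e]) (use \<open>\<forall>z\<in>half_tree T u v. P z\<close> in blast)
  qed
qed

lemma to_end_nontrivial: assumes "\<xi> \<in> ends T" shows "to_end T \<xi> \<noteq> bot"
  using eventually_to_end[OF assms, of "\<lambda>_. False"] half_self by (auto simp: trivial_limit_def)

lemma to_end_unique:
  assumes "\<xi> \<in> ends T" "\<xi>' \<in> ends T" "F \<noteq> bot" "filterlim f (to_end T \<xi>) F" "filterlim f (to_end T \<xi>') F"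
  shows "\<xi> = \<xi>'"
proof (rule ccontr)
  assume "\<xi> \<noteq> \<xi>'"
  then obtain u v where uv: "adj T u v" "\<xi> \<in> half_ends T u v" "\<xi>' \<in> half_ends T v u" using ends_sep assms by metis
  have "eventually (\<lambda>z. f z \<in> half_tree T u v) F" "eventually (\<lambda>z. f z \<in> half_tree T v u) F"
    using assms(4,5) uv adj_sym[OF uv(1)] unfolding filterlim_to_end[OF assms(1)] filterlim_to_end[OF assms(2)] by auto
  then have "eventually (\<lambda>z. False) F" by eventually_elim (use half_disj in blast)
  then show False using assms(3) by (simp add: trivial_limit_def)
qed

section \<open>The Busemann function\<close>

text \<open>Beyond an edge that separates \<open>z\<close> from \<open>x\<close> and \<open>y\<close> the difference of distances does not
  depend on \<open>z\<close>, so the limit is attained.\<close>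

lemma busemann_half:
  assumes uv: "adj T u v" and \<xi>: "\<xi> \<in> half_ends T u v" and x: "x \<in> half_tree T v u" and y: "y \<in> half_tree T v u"
  shows "busemann T \<xi> x y = real (d x u) - real (d y u)"
proof -
  have "eventually (\<lambda>z. real (d x z) - real (d y z) = real (d x u) - real (d y u)) (to_end T \<xi>)"
    unfolding eventually_to_end[OF half_ends_ends[OF \<xi>]]
  proof (rule exI[of _ u], rule exI[of _ v], intro conjI ballI uv \<xi>)
    fix z assume z: "z \<in> half_tree T u v"
    show "real (d x z) - real (d y z) = real (d x u) - real (d y u)"
      using half_dist[OF uv x z] half_dist[OF uv y z] by simp
  qed
  then have "((\<lambda>z. real (d x z) - real (d y z)) \<longlongrightarrow> real (d x u) - real (d y u)) (to_end T \<xi>)"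
    by (rule tendsto_eventually)
  then show ?thesis unfolding busemann_def
    by (rule tendsto_Lim[OF to_end_nontrivial[OF half_ends_ends[OF \<xi>]]])
qed

text \<open>With \<open>busemann_half\<close> this says that the Busemann function is locally constant in the end.\<close>

lemma busemann_nbhd:
  assumes \<xi>: "\<xi> \<in> ends T" and "x \<in> V" "y \<in> V"
  obtains u v where "adj T u v" "\<xi> \<in> half_ends T u v" "x \<in> half_tree T v u" "y \<in> half_tree T v u"
proof -
  obtain r where r: "r \<in> \<xi>" "r 0 = x" "r \<in> rays T" using ray_from[OF assms(1,2)] by blast
  have "\<forall>\<^sub>F n in sequentially. x \<in> half_tree T (r (Suc n)) (r n) \<and> y \<in> half_tree T (r (Suc n)) (r n)"
    using ray_leave[OF r(3)] assms by (simp add: eventually_conj_iff)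
  then obtain n where "x \<in> half_tree T (r (Suc n)) (r n) \<and> y \<in> half_tree T (r (Suc n)) (r n)"
    by (auto simp: eventually_sequentially)
  then show ?thesis using that[OF rays_adj[OF r(3)] half_ends_ray[OF \<xi> r(1)]] by blast
qed

lemma busemann_ray:
  assumes \<xi>: "\<xi> \<in> ends T" and r: "r \<in> \<xi>" and "x \<in> V" "y \<in> V"
  shows "\<forall>\<^sub>F n in sequentially. busemann T \<xi> x y = real (d x (r n)) - real (d y (r n))"
proof -
  note rr = end_rays[OF \<xi> r]
  have "\<forall>\<^sub>F n in sequentially. x \<in> half_tree T (r (Suc n)) (r n) \<and> y \<in> half_tree T (r (Suc n)) (r n)"
    using ray_leave[OF rr] assms by (simp add: eventually_conj_iff)
  then show ?thesis
    by eventually_elim (use busemann_half[OF rays_adj[OF rr] half_ends_ray[OF \<xi> r]] in blast)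
qed

lemma busemann_cocycle:
  assumes \<xi>: "\<xi> \<in> ends T" and V: "x \<in> V" "y \<in> V" "z \<in> V"
  shows "busemann T \<xi> x z = busemann T \<xi> x y + busemann T \<xi> y z"
proof -
  obtain r where r: "r \<in> \<xi>" using end_nonempty[OF \<xi>] by blast
  have "\<forall>\<^sub>F n in sequentially. busemann T \<xi> x z = busemann T \<xi> x y + busemann T \<xi> y z"
    using busemann_ray[OF \<xi> r V(1,3)] busemann_ray[OF \<xi> r V(1,2)] busemann_ray[OF \<xi> r V(2,3)]
    by eventually_elim simp
  then show ?thesis by simp
qed

lemma busemann_le:
  assumes \<xi>: "\<xi> \<in> ends T" and V: "x \<in> V" "y \<in> V"
  shows "\<bar>busemann T \<xi> x y\<bar> \<le> real (d x y)"
proof -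
  obtain r where r: "r \<in> \<xi>" using end_nonempty[OF \<xi>] by blast
  have "\<bar>real (d x (r n)) - real (d y (r n))\<bar> \<le> real (d x y)" for n
    using dist_triangle[of x y "r n"] dist_triangle[of y x "r n"] V rays_V[OF end_rays[OF \<xi> r]]
    by (simp add: dist_sym[of y x])
  note b = this
  have "\<forall>\<^sub>F n in sequentially. \<bar>busemann T \<xi> x y\<bar> \<le> real (d x y)"
    by (rule eventually_mono[OF busemann_ray[OF \<xi> r V]]) (simp only: b)
  then show ?thesis by simp
qed

lemma busemann_self: "\<xi> \<in> ends T \<Longrightarrow> x \<in> V \<Longrightarrow> busemann T \<xi> x x = 0"
  using busemann_cocycle[of \<xi> x x x] by simp

lemma busemann_anti: "\<xi> \<in> ends T \<Longrightarrow> x \<in> V \<Longrightarrow> y \<in> V \<Longrightarrow> busemann T \<xi> y x = - busemann T \<xi> x y"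
  using busemann_cocycle[of \<xi> x y x] busemann_self[of \<xi> x] by simp

lemma busemann_half_ends:
  assumes uv: "adj T u v" and \<xi>: "\<xi> \<in> half_ends T u v" and x: "x \<in> half_tree T v u"
  shows "busemann T \<xi> x u = real (d x u)"
  using busemann_half[OF uv \<xi> x half_self[OF adj_sym[OF uv]]] by simp

lemma busemann_adj:
  assumes uv: "adj T u v" and \<xi>: "\<xi> \<in> half_ends T u v" shows "busemann T \<xi> u v = 1"
proof -
  note x = half_ends_ends[OF \<xi>] and V = adj_verts[OF uv]
  obtain r where r: "r \<in> \<xi>" using end_nonempty[OF x] by blast
  have 1: "\<forall>\<^sub>F n in sequentially. r n \<in> half_tree T u v" using \<xi> half_ends_iff[OF x r] by simp
  have "\<forall>\<^sub>F n in sequentially. busemann T \<xi> u v = 1"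
    using busemann_ray[OF x r V(1,2)] 1 by eventually_elim (simp add: half_tree_def dist_sym[of "r _"])
  then show ?thesis by simp
qed

end

section \<open>Coarse maps and their extension to ends\<close>

context tree_graph
begin

lemma eventually_half: "adj T u v \<Longrightarrow> \<xi> \<in> half_ends T u v \<Longrightarrow> eventually (\<lambda>z. z \<in> half_tree T u v) (to_end T \<xi>)"
  using eventually_to_end[OF half_ends_ends] by blast

lemma eventually_V: assumes "\<xi> \<in> ends T" shows "eventually (\<lambda>z. z \<in> V) (to_end T \<xi>)"
proof -
  obtain x where "x \<in> V" using V_nonempty by blast
  then obtain w where "adj T x w" "\<xi> \<in> half_ends T x w" using branch_ex1[OF assms] by blast
  then have "eventually (\<lambda>z. z \<in> half_tree T x w) (to_end T \<xi>)" by (rule eventually_half)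
  then show ?thesis by (rule eventually_mono) (rule half_V)
qed

lemma eventually_finite_avoid: 
  assumes \<xi>: "\<xi> \<in> ends T" and "finite P" shows "eventually (\<lambda>z. z \<notin> P) (to_end T \<xi>)"
proof -
  have "eventually (\<lambda>z. z \<noteq> p) (to_end T \<xi>)" for p
  proof (cases "p \<in> V")
    case True
    obtain u v where uv: "adj T u v" "\<xi> \<in> half_ends T u v" "p \<in> half_tree T v u" using busemann_nbhd[OF \<xi> True True] by blast
    show ?thesis
      by (rule eventually_mono[OF eventually_half[OF uv(1,2)]]) (use uv(3) half_disj in blast)
  next
    case False
    show ?thesis by (rule eventually_mono[OF eventually_V[OF \<xi>]]) (use False in blast)
  qed
  then have "eventually (\<lambda>z. \<forall>p\<in>P. z \<noteq> p) (to_end T \<xi>)"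
    by (intro eventually_ball_finite assms) auto
  then show ?thesis by (rule eventually_mono) blast
qed

lemma eventually_ends_ex: "\<xi> \<in> ends T \<Longrightarrow> eventually P (to_end T \<xi>) \<Longrightarrow> \<exists>z\<in>V. P z"
  using eventually_conj[OF eventually_V, of \<xi> P] eventually_happens[of "\<lambda>z. z \<in> V \<and> P z" "to_end T \<xi>"]
    to_end_nontrivial[of \<xi>] by auto

end

locale locally_finite_tree = tree_graph +
  assumes fin_nbhd: "x \<in> verts T \<Longrightarrow> finite (nbhd T x)"
begin

lemma ball_finite: assumes x: "x \<in> V" shows "finite {z \<in> V. d x z \<le> n}"
proof (induction n)
  case 0
  have "{z \<in> V. d x z \<le> 0} \<subseteq> {x}" using dist_0 x by auto
  then show ?case by (rule finite_subset) simp
next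
  case (Suc n)
  have "{z \<in> V. d x z \<le> Suc n} \<subseteq> insert x (\<Union>y\<in>{z \<in> V. d x z \<le> n}. nbhd T y)"
  proof
    fix z assume z: "z \<in> {z \<in> V. d x z \<le> Suc n}"
    show "z \<in> insert x (\<Union>y\<in>{z \<in> V. d x z \<le> n}. nbhd T y)"
    proof (cases "z = x")
      case False
      have zV: "z \<in> V" using z by simp
      obtain y where y: "adj T z y" "d z x = Suc (d y x)" using closer_ex[OF zV x False] by blast
      have "y \<in> V" using adj_verts[OF y(1)] by simp
      moreover have "d x y \<le> n" using z y(2) by (simp add: dist_sym[of x])
      moreover have "z \<in> nbhd T y" using adj_sym[OF y(1)] by (simp add: nbhd_def)
      ultimately show ?thesis by blast
    qed simp
  qed
  then show ?case by (rule finite_subset) (use Suc fin_nbhd in auto)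
qed

lemma V_countable: "countable V"
proof -
  obtain x where x: "x \<in> V" using V_nonempty by blast
  have "countable (\<Union>n. {z \<in> V. d x z \<le> n})"
    by (rule countable_UN[OF countableI_type]) (rule countable_finite[OF ball_finite[OF x]])
  then show ?thesis by (rule countable_subset[rotated]) auto
qed

end

text \<open>Lipschitz along edges and metrically proper. This is weaker than being a quasi-isometry,
  but in trees it suffices for an extension to the ends.\<close>

definition coarse :: "'a graph \<Rightarrow> 'b graph \<Rightarrow> ('a \<Rightarrow> 'b) \<Rightarrow> bool" where
  "coarse T1 T2 f \<longleftrightarrow> f ` verts T1 \<subseteq> verts T2 \<and>
     (\<exists>L. \<forall>a b. adj T1 a b \<longrightarrow> graph_dist T2 (f a) (f b) \<le> L) \<and>
     (\<forall>y\<in>verts T2. \<forall>n. finite {a \<in> verts T1. graph_dist T2 (f a) y \<le> n})"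

definition end_extension :: "'a graph \<Rightarrow> 'b graph \<Rightarrow> ('a \<Rightarrow> 'b) \<Rightarrow> 'a tree_end \<Rightarrow> 'b tree_end" where
  "end_extension T1 T2 f \<xi> = (THE \<xi>'. \<xi>' \<in> ends T2 \<and> filterlim f (to_end T2 \<xi>') (to_end T1 \<xi>))"

locale two_trees = A: tree_graph T1 + B: locally_finite_tree T2 for T1 :: "'a graph" and T2 :: "'b graph"
begin

text \<open>A half-tree is connected and its image has jumps of length at most \<open>L\<close>, so the image cannot
  cross an edge from which it stays farther away than that.\<close>

lemma side_const:
  assumes f: "f ` A.V \<subseteq> B.V" and L: "\<And>a b. adj T1 a b \<Longrightarrow> B.d (f a) (f b) \<le> L"
    and ab: "adj T1 a b" and uv: "adj T2 u v"
    and far: "\<And>z. z \<in> half_tree T1 a b \<Longrightarrow> B.d (f z) u > L"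
  shows "f ` half_tree T1 a b \<subseteq> half_tree T2 u v \<or> f ` half_tree T1 a b \<subseteq> half_tree T2 v u"
proof -
  have fV: "f z \<in> B.V" if "z \<in> half_tree T1 a b" for z using f that A.half_V by blast
  have one: "f ` half_tree T1 a b \<subseteq> half_tree T2 s t" 
    if st: "(s = u \<and> t = v) \<or> (s = v \<and> t = u)" and b: "f b \<in> half_tree T2 s t" for s t
  proof
    have ts: "adj T2 s t" using st uv adj_sym[OF uv] by auto
    fix y assume "y \<in> f ` half_tree T1 a b"
    then obtain z where z: "z \<in> half_tree T1 a b" "y = f z" by blast
    have "f z \<in> half_tree T2 s t" using ab z(1)
    proof (induction rule: A.half_induct)
      case start then show ?case by (rule b)
    next
      case (step p q)
      show ?case
      proof (rule ccontr)
        assume "f q \<notin> half_tree T2 s t"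
        then have q: "f q \<in> half_tree T2 t s" using B.half_not[OF ts fV[OF step(3)]] by simp
        have "B.d (f q) (f p) = B.d (f q) s + 1 + B.d t (f p)"
          by (rule B.half_dist[OF ts q step(4)])
        moreover have "B.d (f q) (f p) \<le> L" using L[OF step(1)] B.dist_sym[of "f q"] by simp
        moreover have "B.d (f q) u > L" "B.d (f p) u > L" using far step by auto
        ultimately show False using st B.dist_sym[of u "f p"] by auto
      qed
    qed
    then show "y \<in> half_tree T2 s t" using z by simp
  qed
  have "f b \<in> half_tree T2 u v \<or> f b \<in> half_tree T2 v u"
    by (rule B.half_Un[OF uv]) (use fV A.half_self[OF ab] in blast)
  then show ?thesis using one[of u v] one[of v u] by blast
qed

lemma eventually_far:
  assumes f: "coarse T1 T2 f" and \<xi>: "\<xi> \<in> ends T1" and y: "y \<in> B.V"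
  shows "eventually (\<lambda>z. B.d (f z) y > n) (to_end T1 \<xi>)"
proof -
  have "finite {a \<in> A.V. B.d (f a) y \<le> n}" using f y unfolding coarse_def by blast
  then have e: "eventually (\<lambda>z. z \<notin> {a \<in> A.V. B.d (f a) y \<le> n}) (to_end T1 \<xi>)"
    by (rule A.eventually_finite_avoid[OF \<xi>])
  show ?thesis
    by (rule eventually_mono[OF eventually_conj[OF e A.eventually_V[OF \<xi>]]]) auto
qed

text \<open>For every edge of the target the images of the vertices close to \<open>\<xi>\<close> lie eventually on one
  of its sides; call this the positive side (\<open>Or\<close>). By local finiteness and properness exactly
  one edge at each vertex points to its positive side, and following these edges gives a ray to
  the limit.\<close>

lemma end_limit_ex:
  assumes f: "coarse T1 T2 f" and \<xi>: "\<xi> \<in> ends T1"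
  shows "\<exists>\<xi>'\<in>ends T2. filterlim f (to_end T2 \<xi>') (to_end T1 \<xi>)"
proof -
  let ?E = "\<lambda>P. eventually P (to_end T1 \<xi>)"
  define Or where "Or u v \<longleftrightarrow> ?E (\<lambda>z. f z \<in> half_tree T2 u v)" for u v
  obtain L where L: "\<And>a b. adj T1 a b \<Longrightarrow> B.d (f a) (f b) \<le> L" using f unfolding coarse_def by blast
  have fV: "f ` A.V \<subseteq> B.V" using f unfolding coarse_def by blast
  have efV: "?E (\<lambda>z. f z \<in> B.V)" by (rule eventually_mono[OF A.eventually_V[OF \<xi>]]) (use fV in blast)
  have dich: "Or u v \<or> Or v u" if uv: "adj T2 u v" for u v
  proof -
    have "?E (\<lambda>z. B.d (f z) u > L)" by (rule eventually_far[OF f \<xi>]) (rule B.adj_verts[OF uv])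
    then obtain a b where ab: "adj T1 a b" "\<xi> \<in> half_ends T1 a b" "\<forall>z\<in>half_tree T1 a b. B.d (f z) u > L"
      unfolding A.eventually_to_end[OF \<xi>] by blast
    have "f ` half_tree T1 a b \<subseteq> half_tree T2 u v \<or> f ` half_tree T1 a b \<subseteq> half_tree T2 v u"
      by (rule side_const[OF fV L ab(1) uv]) (use ab(3) in auto)
    then show ?thesis unfolding Or_def A.eventually_to_end[OF \<xi>] using ab by blast
  qed
  have both: False if "?E P" "?E Q" "\<And>z. P z \<Longrightarrow> Q z \<Longrightarrow> False" for P Q
    using A.eventually_ends_ex[OF \<xi> eventually_conj[OF that(1,2)]] that(3) by blast
  have excl: "\<not> Or v u" if "Or u v" for u v
    using both[of "\<lambda>z. f z \<in> half_tree T2 u v" "\<lambda>z. f z \<in> half_tree T2 v u"] that B.half_disj unfolding Or_def by blast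
  have uniq: "w = w'" if "adj T2 y w" "adj T2 y w'" "Or y w" "Or y w'" for y w w'
  proof (rule ccontr)
    assume "w \<noteq> w'"
    then show False using both[of "\<lambda>z. f z \<in> half_tree T2 y w" "\<lambda>z. f z \<in> half_tree T2 y w'"] that B.half_branch_unique
      unfolding Or_def by blast
  qed
  have ex: "\<exists>w. adj T2 y w \<and> Or y w" if y: "y \<in> B.V" for y
  proof (rule ccontr)
    assume c: "\<not> ?thesis"
    have "?E (\<lambda>z. f z \<in> half_tree T2 w y)" if "w \<in> nbhd T2 y" for w
      using c dich[of y w] that unfolding nbhd_def Or_def by blast
    then have 1: "?E (\<lambda>z. \<forall>w\<in>nbhd T2 y. f z \<in> half_tree T2 w y)"
      by (intro eventually_ball_finite B.fin_nbhd y) auto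
    have 2: "?E (\<lambda>z. B.d (f z) y > 0 \<and> f z \<in> B.V)" by (rule eventually_conj[OF eventually_far[OF f \<xi> y] efV])
    show False
    proof (rule both[OF 1 2])
      fix z assume z: "\<forall>w\<in>nbhd T2 y. f z \<in> half_tree T2 w y" "B.d (f z) y > 0 \<and> f z \<in> B.V"
      then have "y \<noteq> f z" by auto
      then obtain w where "adj T2 y w" "f z \<in> half_tree T2 y w" using B.half_towards[OF y] z by blast
      then show False using z B.half_disj unfolding nbhd_def by blast
    qed
  qed
  obtain nx where nx: "\<And>y. y \<in> B.V \<Longrightarrow> adj T2 y (nx y) \<and> Or y (nx y)" using ex by metis
  obtain x where x: "x \<in> B.V" using B.V_nonempty by blast
  define r where "r n = (nx ^^ n) x" for n
  have rS: "r (Suc n) = nx (r n)" for n by (simp add: r_def)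
  have rV: "r n \<in> B.V" for n
  proof (induction n)
    case 0 then show ?case using x by (simp add: r_def)
  next
    case (Suc n) then show ?case using nx[of "r n"] B.adj_verts[of "r n" "nx (r n)"] by (simp add: rS)
  qed
  have rO: "adj T2 (r n) (r (Suc n))" "Or (r n) (r (Suc n))" for n using nx[OF rV] by (auto simp: rS)
  have "r (Suc (Suc n)) \<noteq> r n" for n using rO(2)[of n] rO(2)[of "Suc n"] excl[of "r n" "r (Suc n)"] by metis
  then have rr: "r \<in> rays T2" using rO(1) by (simp add: rays_def)
  obtain \<xi>' where \<xi>': "\<xi>' \<in> ends T2" "r \<in> \<xi>'" using B.end_of_ray[OF rr] by blast
  have "Or u v" if uv: "adj T2 u v" and b: "\<xi>' \<in> half_ends T2 u v" for u v
  proof (rule ccontr)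
    assume "\<not> Or u v"
    then have vu: "Or v u" using dich[OF uv] by blast
    have "\<forall>\<^sub>F n in sequentially. half_tree T2 (r n) (r (Suc n)) \<subseteq> half_tree T2 u v"
      by (rule B.ray_half_ends_half_sub[OF \<xi>' uv b])
    then obtain n where n: "half_tree T2 (r n) (r (Suc n)) \<subseteq> half_tree T2 u v" by (auto simp: eventually_sequentially)
    show False using both[of "\<lambda>z. f z \<in> half_tree T2 (r n) (r (Suc n))" "\<lambda>z. f z \<in> half_tree T2 v u"] vu rO(2)[of n] n B.half_disj
      unfolding Or_def by blast
  qed
  then have "filterlim f (to_end T2 \<xi>') (to_end T1 \<xi>)"
    unfolding B.filterlim_to_end[OF \<xi>'(1)] Or_def by blast
  then show ?thesis using \<xi>' by blast
qed

lemma ext_eqI: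
  assumes "\<xi> \<in> ends T1" "\<xi>' \<in> ends T2" "filterlim f (to_end T2 \<xi>') (to_end T1 \<xi>)"
  shows "end_extension T1 T2 f \<xi> = \<xi>'"
  unfolding end_extension_def
  by (rule the_equality) (use assms B.to_end_unique[OF _ assms(2) A.to_end_nontrivial[OF assms(1)]] in blast)+

lemma ext_lim:
  assumes "coarse T1 T2 f" "\<xi> \<in> ends T1"
  shows "end_extension T1 T2 f \<xi> \<in> ends T2" "filterlim f (to_end T2 (end_extension T1 T2 f \<xi>)) (to_end T1 \<xi>)"
proof -
  obtain \<xi>' where h: "\<xi>' \<in> ends T2" "filterlim f (to_end T2 \<xi>') (to_end T1 \<xi>)" using end_limit_ex[OF assms] by blast
  show "end_extension T1 T2 f \<xi> \<in> ends T2" "filterlim f (to_end T2 (end_extension T1 T2 f \<xi>)) (to_end T1 \<xi>)"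
    using ext_eqI[OF assms(2) h] h by auto
qed

text \<open>A displacement by at most \<open>D\<close> does not lead across an edge at distance more than \<open>D\<close>.\<close>

lemma ext_close_lim:
  assumes f: "coarse T1 T2 f" and \<xi>: "\<xi> \<in> ends T1"
    and g: "\<And>z. z \<in> A.V \<Longrightarrow> g z \<in> B.V" "\<And>z. z \<in> A.V \<Longrightarrow> B.d (f z) (g z) \<le> D"
  shows "filterlim g (to_end T2 (end_extension T1 T2 f \<xi>)) (to_end T1 \<xi>)"
  unfolding B.filterlim_to_end[OF ext_lim(1)[OF f \<xi>]]
proof (intro allI impI)
  fix u v assume uv: "adj T2 u v" and b: "end_extension T1 T2 f \<xi> \<in> half_ends T2 u v"
  have 1: "eventually (\<lambda>z. f z \<in> half_tree T2 u v) (to_end T1 \<xi>)"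
    using ext_lim(2)[OF f \<xi>] uv b unfolding B.filterlim_to_end[OF ext_lim(1)[OF f \<xi>]] by blast
  have 2: "eventually (\<lambda>z. B.d (f z) u > D) (to_end T1 \<xi>)"
    by (rule eventually_far[OF f \<xi>]) (rule B.adj_verts[OF uv])
  show "eventually (\<lambda>z. g z \<in> half_tree T2 u v) (to_end T1 \<xi>)"
  proof (rule eventually_mono[OF eventually_conj[OF 1 eventually_conj[OF 2 A.eventually_V[OF \<xi>]]]])
    fix z assume z: "f z \<in> half_tree T2 u v \<and> D < B.d (f z) u \<and> z \<in> A.V"
    show "g z \<in> half_tree T2 u v"
    proof (rule ccontr)
      assume "g z \<notin> half_tree T2 u v"
      then have "g z \<in> half_tree T2 v u" using B.half_not[OF uv g(1)] z by blast
      then have "B.d (g z) (f z) = B.d (g z) u + 1 + B.d v (f z)" using B.half_dist[OF uv] z by blast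
      moreover have "B.d (f z) u = Suc (B.d (f z) v)" using z by (simp add: half_tree_def)
      ultimately show False using g(2)[of z] z B.dist_sym[of v "f z"] B.dist_sym[of "f z" "g z"] by simp
    qed
  qed
qed

lemma ext_close:
  assumes f: "coarse T1 T2 f" and \<xi>: "\<xi> \<in> ends T1"
    and g: "\<And>z. z \<in> A.V \<Longrightarrow> g z \<in> B.V" "\<And>z. z \<in> A.V \<Longrightarrow> B.d (f z) (g z) \<le> D"
  shows "end_extension T1 T2 g \<xi> = end_extension T1 T2 f \<xi>"
  by (rule ext_eqI[OF \<xi> ext_lim(1)[OF f \<xi>] ext_close_lim[OF assms]])

lemma ext_side:
  assumes f: "coarse T1 T2 f" and ab: "adj T1 a b" and uv: "adj T2 u v"
    and sub: "f ` half_tree T1 a b \<subseteq> half_tree T2 u v" and \<xi>: "\<xi> \<in> half_ends T1 a b"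
  shows "end_extension T1 T2 f \<xi> \<in> half_ends T2 u v"
proof (rule ccontr)
  note x = A.half_ends_ends[OF \<xi>]
  assume "end_extension T1 T2 f \<xi> \<notin> half_ends T2 u v"
  then have "end_extension T1 T2 f \<xi> \<in> half_ends T2 v u" using B.half_ends_not[OF uv ext_lim(1)[OF f x]] by blast
  then have "eventually (\<lambda>z. f z \<in> half_tree T2 v u) (to_end T1 \<xi>)"
    using ext_lim(2)[OF f x] adj_sym[OF uv] unfolding B.filterlim_to_end[OF ext_lim(1)[OF f x]] by blast
  from A.eventually_ends_ex[OF x eventually_conj[OF this A.eventually_half[OF ab \<xi>]]]
  show False using sub B.half_disj by blast
qed

lemma ext_cont:
  assumes f: "coarse T1 T2 f" and \<xi>: "\<xi> \<in> ends T1" and uv: "adj T2 u v" and b: "end_extension T1 T2 f \<xi> \<in> half_ends T2 u v"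
  obtains a c where "adj T1 a c" "\<xi> \<in> half_ends T1 a c" "\<And>\<xi>'. \<xi>' \<in> half_ends T1 a c \<Longrightarrow> end_extension T1 T2 f \<xi>' \<in> half_ends T2 u v"
proof -
  have "eventually (\<lambda>z. f z \<in> half_tree T2 u v) (to_end T1 \<xi>)"
    using ext_lim(2)[OF f \<xi>] uv b unfolding B.filterlim_to_end[OF ext_lim(1)[OF f \<xi>]] by blast
  then obtain a c where ac: "adj T1 a c" "\<xi> \<in> half_ends T1 a c" "\<forall>z\<in>half_tree T1 a c. f z \<in> half_tree T2 u v"
    unfolding A.eventually_to_end[OF \<xi>] by blast
  then show ?thesis using that[OF ac(1,2)] ext_side[OF f ac(1) uv] by blast
qed

end

lemma ext_comp:
  assumes t: "two_trees T1 T2" "two_trees T2 T3" and f: "coarse T1 T2 f" and g: "coarse T2 T3 g" and \<xi>: "\<xi> \<in> ends T1"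
  shows "filterlim (\<lambda>z. g (f z)) (to_end T3 (end_extension T2 T3 g (end_extension T1 T2 f \<xi>))) (to_end T1 \<xi>)"
proof -
  interpret f: two_trees T1 T2 by fact
  interpret g: two_trees T2 T3 by fact
  show ?thesis
    using filterlim_compose[OF g.ext_lim(2)[OF g f.ext_lim(1)[OF f \<xi>]] f.ext_lim(2)[OF f \<xi>]] .
qed

lemma ext_inverse:
  assumes t: "locally_finite_tree T1" "locally_finite_tree T2" and f: "coarse T1 T2 f" and g: "coarse T2 T1 g" and \<xi>: "\<xi> \<in> ends T1"
    and D: "\<And>z. z \<in> verts T1 \<Longrightarrow> graph_dist T1 (g (f z)) z \<le> D"
  shows "end_extension T2 T1 g (end_extension T1 T2 f \<xi>) = \<xi>"
proof -
  interpret a: locally_finite_tree T1 by fact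
  interpret b: locally_finite_tree T2 by fact
  interpret f: two_trees T1 T2 by unfold_locales
  interpret g: two_trees T2 T1 by unfold_locales
  interpret i: two_trees T1 T1 by unfold_locales
  have id: "coarse T1 T1 id"
    unfolding coarse_def using a.ball_finite a.adj_dist
    by (auto simp: a.dist_sym intro!: exI[of _ 1])
  have l: "filterlim id (to_end T1 \<xi>) (to_end T1 \<xi>)" by (simp add: filterlim_iff)
  have e: "end_extension T1 T1 id \<xi> = \<xi>" by (rule i.ext_eqI[OF \<xi> \<xi> l])
  have fV: "f z \<in> verts T2" "g (f z) \<in> verts T1" if "z \<in> verts T1" for z
    using f g that unfolding coarse_def by blast+
  have "filterlim (\<lambda>z. g (f z)) (to_end T1 (end_extension T1 T1 id \<xi>)) (to_end T1 \<xi>)"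
    by (rule i.ext_close_lim[OF id \<xi> fV(2)]) (use D a.dist_sym in \<open>auto simp: id_def\<close>)
  then have "end_extension T1 T1 (\<lambda>z. g (f z)) \<xi> = \<xi>" using e i.ext_eqI[OF \<xi> \<xi>] by simp
  moreover have "end_extension T1 T1 (\<lambda>z. g (f z)) \<xi> = end_extension T2 T1 g (end_extension T1 T2 f \<xi>)"
    by (rule i.ext_eqI[OF \<xi> g.ext_lim(1)[OF g f.ext_lim(1)[OF f \<xi>]] ext_comp[OF _ _ f g \<xi>]]) unfold_locales
  ultimately show ?thesis by simp
qed

section \<open>Isomorphisms of trees\<close>

locale tree_iso = A: tree_graph T1 + B: tree_graph T2 for T1 :: "'a graph" and T2 :: "'b graph" +
  fixes F :: "'a \<Rightarrow> 'b"
  assumes iso: "graph_iso T1 T2 F"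
begin

lemma iso_V: "x \<in> A.V \<Longrightarrow> F x \<in> B.V"
  using iso unfolding graph_iso_def bij_betw_def by blast

lemma iso_inj: "inj_on F A.V" and iso_surj: "F ` A.V = B.V"
  using iso unfolding graph_iso_def bij_betw_def by auto

lemma iso_adj: "x \<in> A.V \<Longrightarrow> y \<in> A.V \<Longrightarrow> adj T2 (F x) (F y) \<longleftrightarrow> adj T1 x y"
  using iso unfolding graph_iso_def by blast

lemma iso_adj': "adj T1 x y \<Longrightarrow> adj T2 (F x) (F y)"
  using iso_adj A.adj_verts by blast

lemma iso_dist_le: assumes "x \<in> A.V" "y \<in> A.V" shows "B.d (F x) (F y) \<le> A.d x y"
proof -
  have "(x, z) \<in> adj_rel T1 ^^ n \<Longrightarrow> (F x, F z) \<in> adj_rel T2 ^^ n" for z n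
  proof (induction n arbitrary: z)
    case (Suc n)
    then obtain w where w: "(x, w) \<in> adj_rel T1 ^^ n" "(w, z) \<in> adj_rel T1" by auto
    then have "(F w, F z) \<in> adj_rel T2" using iso_adj'[of w z] by (simp add: adj_rel_def)
    with Suc.IH[OF w(1)] show ?case by auto
  qed simp
  then show ?thesis using A.dist_walk[OF assms] B.dist_le by blast
qed

abbreviation "inv_iso \<equiv> inv_into A.V F"

lemma inv_left: "x \<in> A.V \<Longrightarrow> inv_iso (F x) = x"
  using iso_inj by simp

lemma inv_right: "y \<in> B.V \<Longrightarrow> F (inv_iso y) = y"
  using iso_surj by (simp add: f_inv_into_f)

lemma inv_V: "y \<in> B.V \<Longrightarrow> inv_iso y \<in> A.V"
  using iso_surj by (simp add: inv_into_into)

lemma inv_graph_iso: "graph_iso T2 T1 inv_iso"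
  unfolding graph_iso_def
proof (intro conjI ballI)
  show "bij_betw inv_iso B.V A.V"
    using iso unfolding graph_iso_def by (blast intro: bij_betw_inv_into)
  show "adj T2 u v \<longleftrightarrow> adj T1 (inv_iso u) (inv_iso v)" if "u \<in> B.V" "v \<in> B.V" for u v
    using iso_adj[of "inv_iso u" "inv_iso v"] that by (simp add: inv_V inv_right)
qed

end

context tree_iso begin

lemma inv_tree_iso: "tree_iso T2 T1 inv_iso"
  by unfold_locales (rule inv_graph_iso)

lemma iso_dist: assumes "x \<in> A.V" "y \<in> A.V" shows "B.d (F x) (F y) = A.d x y"
proof -
  interpret i: tree_iso T2 T1 inv_iso by (rule inv_tree_iso)
  show ?thesis using i.iso_dist_le[of "F x" "F y"] iso_dist_le[OF assms] assms by (simp add: inv_left iso_V)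
qed

lemma iso_half: assumes "u \<in> A.V" "v \<in> A.V" shows "F ` half_tree T1 u v = half_tree T2 (F u) (F v)"
proof (intro equalityI subsetI)
  fix y assume "y \<in> F ` half_tree T1 u v"
  then show "y \<in> half_tree T2 (F u) (F v)" using assms iso_dist iso_V by (auto simp: half_tree_def)
next
  fix y assume y: "y \<in> half_tree T2 (F u) (F v)"
  then have yV: "y \<in> B.V" by (simp add: half_tree_def)
  then have "inv_iso y \<in> half_tree T1 u v"
    using y assms iso_dist[of "inv_iso y" u] iso_dist[of "inv_iso y" v]
    by (simp add: half_tree_def inv_V inv_right)
  then show "y \<in> F ` half_tree T1 u v" using inv_right[OF yV] by (metis imageI)
qed

lemma iso_rays: assumes "r \<in> rays T1" shows "F \<circ> r \<in> rays T2"
  unfolding rays_def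
proof (intro CollectI allI conjI)
  fix n
  show "{(F \<circ> r) n, (F \<circ> r) (Suc n)} \<in> edges T2" using iso_adj'[OF A.rays_adj[OF assms]] by simp
  show "(F \<circ> r) (Suc (Suc n)) \<noteq> (F \<circ> r) n"
    using A.rays_nb[OF assms, of n] A.rays_V[OF assms] iso_inj by (simp add: inj_on_eq_iff)
qed

lemma iso_cofinal: "(r, s) \<in> cofinal T1 \<Longrightarrow> (F \<circ> r, F \<circ> s) \<in> cofinal T2"
proof -
  assume rs: "(r, s) \<in> cofinal T1"
  then obtain m n where h: "r \<in> rays T1" "s \<in> rays T1" "\<forall>k. r (m + k) = s (n + k)" unfolding cofinal_def by auto
  then have "\<forall>k. (F \<circ> r) (m + k) = (F \<circ> s) (n + k)" by simp
  then show ?thesis unfolding cofinal_def using iso_rays[OF h(1)] iso_rays[OF h(2)] by blast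
qed

lemma inv_comp: "r \<in> rays T1 \<Longrightarrow> inv_iso \<circ> (F \<circ> r) = r"
  using A.rays_V inv_left by (auto simp: fun_eq_iff)

lemma inv_comp': "r \<in> rays T2 \<Longrightarrow> F \<circ> (inv_iso \<circ> r) = r"
  using B.rays_V inv_right by (auto simp: fun_eq_iff)

lemma iso_end: assumes \<xi>: "\<xi> \<in> ends T1" shows "end_map F \<xi> \<in> ends T2"
proof -
  interpret i: tree_iso T2 T1 inv_iso by (rule inv_tree_iso)
  obtain r where r: "r \<in> \<xi>" "r \<in> rays T1" using A.end_nonempty[OF \<xi>] A.end_rays[OF \<xi>] by blast
  obtain \<xi>' where \<xi>': "\<xi>' \<in> ends T2" "F \<circ> r \<in> \<xi>'" using B.end_of_ray[OF iso_rays[OF r(2)]] by blast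
  have "end_map F \<xi> = \<xi>'"
  proof (intro equalityI subsetI)
    fix s assume "s \<in> end_map F \<xi>"
    then obtain t where t: "t \<in> \<xi>" "s = F \<circ> t" unfolding end_map_def by blast
    then have "(r, t) \<in> cofinal T1" using A.end_cofinal[OF \<xi> r(1)] by blast
    then show "s \<in> \<xi>'" using iso_cofinal t(2) B.end_cofinal[OF \<xi>'] by blast
  next
    fix s assume s: "s \<in> \<xi>'"
    then have "(F \<circ> r, s) \<in> cofinal T2" using B.end_cofinal[OF \<xi>'] by blast
    then have "(inv_iso \<circ> (F \<circ> r), inv_iso \<circ> s) \<in> cofinal T1" by (rule i.iso_cofinal)
    then have "inv_iso \<circ> s \<in> \<xi>" using A.end_cofinal[OF \<xi> r(1)] inv_comp[OF r(2)] by simp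
    moreover have "s = F \<circ> (inv_iso \<circ> s)" using inv_comp'[OF B.end_rays[OF \<xi>'(1) s]] by simp
    ultimately show "s \<in> end_map F \<xi>" unfolding end_map_def by blast
  qed
  then show ?thesis using \<xi>' by simp
qed

lemma inv_end: assumes \<xi>: "\<xi> \<in> ends T1" shows "end_map inv_iso (end_map F \<xi>) = \<xi>"
proof -
  have "inv_iso \<circ> (F \<circ> r) = r" if "r \<in> \<xi>" for r using inv_comp[OF A.end_rays[OF \<xi> that]] .
  then show ?thesis unfolding end_map_def image_image by (simp add: image_def)
qed

lemma inv_end': assumes \<xi>: "\<xi> \<in> ends T2" shows "end_map F (end_map inv_iso \<xi>) = \<xi>"
proof -
  have "F \<circ> (inv_iso \<circ> r) = r" if "r \<in> \<xi>" for r using inv_comp'[OF B.end_rays[OF \<xi> that]] .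
  then show ?thesis unfolding end_map_def image_image by (simp add: image_def)
qed

lemma iso_half_ends: assumes \<xi>: "\<xi> \<in> ends T1" and uv: "u \<in> A.V" "v \<in> A.V"
  shows "end_map F \<xi> \<in> half_ends T2 (F u) (F v) \<longleftrightarrow> \<xi> \<in> half_ends T1 u v"
proof -
  obtain r where r: "r \<in> \<xi>" "r \<in> rays T1" using A.end_nonempty[OF \<xi>] A.end_rays[OF \<xi>] by blast
  have Fr: "F \<circ> r \<in> end_map F \<xi>" using r by (simp add: end_map_def)
  have "(F \<circ> r) n \<in> half_tree T2 (F u) (F v) \<longleftrightarrow> r n \<in> half_tree T1 u v" for n
    using A.rays_V[OF r(2)] iso_V iso_dist uv by (simp add: half_tree_def)
  then show ?thesis unfolding A.half_ends_iff[OF \<xi> r(1)] B.half_ends_iff[OF iso_end[OF \<xi>] Fr] by simp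
qed

lemma iso_half_ends_image: assumes uv: "u \<in> A.V" "v \<in> A.V"
  shows "end_map F ` half_ends T1 u v = half_ends T2 (F u) (F v)"
proof -
  interpret i: tree_iso T2 T1 inv_iso by (rule inv_tree_iso)
  show ?thesis
  proof (intro equalityI subsetI)
    fix y assume "y \<in> end_map F ` half_ends T1 u v"
    then show "y \<in> half_ends T2 (F u) (F v)" using iso_half_ends[OF _ uv] A.half_ends_ends by blast
  next
    fix y assume y: "y \<in> half_ends T2 (F u) (F v)"
    note yV = B.half_ends_ends[OF y]
    have "end_map inv_iso y \<in> half_ends T1 u v"
      using iso_half_ends[OF i.iso_end[OF yV] uv] y inv_end'[OF yV] by simp
    then show "y \<in> end_map F ` half_ends T1 u v" using inv_end'[OF yV] by (metis imageI)
  qed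
qed

lemma end_map_bij: "bij_betw (end_map F) (ends T1) (ends T2)"
proof -
  interpret i: tree_iso T2 T1 inv_iso by (rule inv_tree_iso)
  show ?thesis
    by (rule bij_betw_byWitness[where f' = "end_map inv_iso"])
      (use inv_end inv_end' iso_end i.iso_end in auto)
qed

lemma iso_filterlim: assumes \<xi>: "\<xi> \<in> ends T1"
  shows "filterlim F (to_end T2 (end_map F \<xi>)) (to_end T1 \<xi>)"
  unfolding B.filterlim_to_end[OF iso_end[OF \<xi>]]
proof (intro allI impI)
  fix u v assume uv: "adj T2 u v" "end_map F \<xi> \<in> half_ends T2 u v"
  define a c where "a = inv_iso u" and "c = inv_iso v"
  have ac: "a \<in> A.V" "c \<in> A.V" "F a = u" "F c = v"
    using B.adj_verts[OF uv(1)] unfolding a_def c_def by (simp_all add: inv_V inv_right)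
  have "adj T1 a c" using uv(1) iso_adj[OF ac(1,2)] ac(3,4) by simp
  moreover have "\<xi> \<in> half_ends T1 a c" using iso_half_ends[OF \<xi> ac(1,2)] uv(2) ac(3,4) by simp
  ultimately have "eventually (\<lambda>z. z \<in> half_tree T1 a c) (to_end T1 \<xi>)" by (rule A.eventually_half)
  then show "eventually (\<lambda>z. F z \<in> half_tree T2 u v) (to_end T1 \<xi>)"
    by (rule eventually_mono) (use iso_half[OF ac(1,2)] ac(3,4) in blast)
qed

end

section \<open>Universal coverings\<close>

locale tree_cover = tree_graph T for T :: "'t graph" +
  fixes G :: "'v graph" and p :: "'t \<Rightarrow> 'v"
  assumes cover: "covering T G p"
begin

lemma p_bij: "x \<in> V \<Longrightarrow> bij_betw p (nbhd T x) (nbhd G (p x))"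
  using cover by (simp add: covering_def)

lemma p_adj: assumes "adj T a b" shows "adj G (p a) (p b)"
  using p_bij[OF adj_verts(1)[OF assms]] assms unfolding bij_betw_def nbhd_def by blast

lemma p_inj: assumes "adj T x a" "adj T x b" "p a = p b" shows "a = b"
  using p_bij[OF adj_verts(1)[OF assms(1)]] assms unfolding bij_betw_def inj_on_def nbhd_def by blast

lemma p_lift: assumes "x \<in> V" "adj G (p x) w" obtains a where "adj T x a" "p a = w"
proof -
  have "w \<in> p ` nbhd T x" using p_bij[OF assms(1)] assms(2) unfolding bij_betw_def by (simp add: nbhd_def)
  then show ?thesis using that by (auto simp: nbhd_def)
qed

lemma p_V: "x \<in> V \<Longrightarrow> p x \<in> verts G"
  using cover unfolding covering_def by blast

lemma p_surj: "v \<in> verts G \<Longrightarrow> \<exists>x\<in>V. p x = v"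
proof -
  assume "v \<in> verts G"
  then have "v \<in> p ` V" using cover by (simp add: covering_def)
  then show ?thesis by blast
qed

end

text \<open>The isomorphism is built outwards from \<open>x\<close>: the image of a vertex is the neighbour, over
  the right vertex of \<open>G\<close>, of the image of its parent. The resulting map is a local isomorphism,
  so it maps non-backtracking walks to non-backtracking walks. Such walks never close up in a
  tree, which gives injectivity; connectedness gives surjectivity.\<close>

lemma lift_iso:
  assumes c: "tree_cover T G p" "tree_cover T' G p'" and x: "x \<in> verts T" and x': "x' \<in> verts T'" and px: "p x = p' x'"
  obtains F where "graph_iso T T' F" "F x = x'" "\<And>z. z \<in> verts T \<Longrightarrow> p' (F z) = p z"
proof -
  interpret A: tree_cover T G p by fact
  interpret B: tree_cover T' G p' by fact
  define pr where "pr z = (SOME w. adj T z w \<and> A.d z x = Suc (A.d w x))" for z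
  \<comment> \<open>\<open>fn n z\<close> is the image of \<open>z\<close> when \<open>z\<close> has distance \<open>n\<close> from \<open>x\<close>, with \<open>pr z\<close> the parent of
    \<open>z\<close>\<close>
  define fn where "fn = rec_nat (\<lambda>z. x') (\<lambda>n f z. SOME b'. adj T' (f (pr z)) b' \<and> p' b' = p z)"
  define F where "F z = fn (A.d x z) z" for z
  have F0: "F x = x'" by (simp add: F_def fn_def)
  have pr: "pr b = a" if ab: "adj T a b" "A.d x b = Suc (A.d x a)" for a b
  proof -
    have "adj T b a \<and> A.d b x = Suc (A.d a x)" using adj_sym[OF ab(1)] ab(2) by (simp add: A.dist_sym[of _ x])
    then have "adj T b (pr b) \<and> A.d b x = Suc (A.d (pr b) x)" unfolding pr_def by (rule someI)
    then show ?thesis using A.closer_unique[of b a "pr b" x] x adj_sym[OF ab(1)] ab(2)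
      by (simp add: A.dist_sym[of _ x])
  qed
  have FS: "F b = (SOME b'. adj T' (F a) b' \<and> p' b' = p b)" if "adj T a b" "A.d x b = Suc (A.d x a)" for a b
    using pr[OF that] that(2) by (simp add: F_def fn_def)
  have lstep: "adj T' (F a) (F b) \<and> p' (F b) = p b"
    if ab: "adj T a b" "A.d x b = Suc (A.d x a)" and Fa: "F a \<in> B.V" "p' (F a) = p a" for a b
  proof -
    have "adj G (p' (F a)) (p b)" using A.p_adj[OF ab(1)] Fa by simp
    then obtain b' where "adj T' (F a) b'" "p' b' = p b" using B.p_lift[OF Fa(1)] by blast
    then show ?thesis unfolding FS[OF ab] using someI[of "\<lambda>b'. adj T' (F a) b' \<and> p' b' = p b" b'] by blast
  qed
  have F: "F z \<in> B.V \<and> p' (F z) = p z" if "z \<in> A.V" for z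
    using x that
  proof (induction rule: A.V_induct)
    case start then show ?case using F0 x' px by simp
  next
    case (step a b) then show ?case using lstep[of a b] B.adj_verts[of "F a" "F b"] by blast
  qed
  have Fadj: "adj T' (F a) (F b)" if ab: "adj T a b" for a b
  proof -
    have V: "a \<in> A.V" "b \<in> A.V" using A.adj_verts[OF ab] by auto
    consider "A.d x b = Suc (A.d x a)" | "A.d x a = Suc (A.d x b)" using A.adj_dist_cases[OF ab x] by blast
    then show ?thesis
    proof cases
      case 1 then show ?thesis using lstep[OF ab] F V by blast
    next
      case 2 then show ?thesis using lstep[OF adj_sym[OF ab]] F V adj_iff[of "F a" "F b" T'] by simp
    qed
  qed
  have Finj: "a = b" if "adj T z a" "adj T z b" "F a = F b" for z a b
  proof -
    have "p a = p b" using F[of a] F[of b] A.adj_verts(2)[OF that(1)] A.adj_verts(2)[OF that(2)] that(3) by simp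
    then show ?thesis using A.p_inj that by blast
  qed
  have Fsurj: "\<exists>b. adj T z b \<and> F b = b'" if z: "z \<in> A.V" and b': "adj T' (F z) b'" for z b'
  proof -
    have "adj G (p z) (p' b')" using B.p_adj[OF b'] F[OF z] by simp
    then obtain b where b: "adj T z b" "p b = p' b'" using A.p_lift[OF z] by blast
    have "p' (F b) = p' b'" using F[OF A.adj_verts(2)[OF b(1)]] b(2) by simp
    then have "F b = b'" using B.p_inj[OF Fadj[OF b(1)] b'] by blast
    then show ?thesis using b by blast
  qed
  have inj: "inj_on F A.V"
  proof (rule inj_onI, rule ccontr)
    fix z w assume zw: "z \<in> A.V" "w \<in> A.V" "F z = F w" "z \<noteq> w"
    obtain f where f: "f 0 = z" "f (A.d z w) = w" "\<And>i. i < A.d z w \<Longrightarrow> adj T (f i) (f (Suc i))"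
      "\<And>i. i \<le> A.d z w \<Longrightarrow> A.d z (f i) = i"
      using A.geodesic[OF zw(1,2)] by metis
    have "F (f 0) \<noteq> F (f (A.d z w))"
    proof (rule B.nb_walk_inj[of "A.d z w"])
      show "adj T' (F (f i)) (F (f (Suc i)))" if "i < A.d z w" for i using Fadj f(3) that by blast
      show "F (f (i + 2)) \<noteq> F (f i)" if i: "i + 2 \<le> A.d z w" for i
      proof
        assume e: "F (f (i + 2)) = F (f i)"
        have "adj T (f (Suc i)) (f (i + 2))" "adj T (f (Suc i)) (f i)"
          using f(3)[of "Suc i"] adj_sym[OF f(3)[of i]] i by auto
        then have "f (i + 2) = f i" using Finj e by blast
        then show False using f(4)[of "i+2"] f(4)[of i] i by simp
      qed
      show "0 < A.d z w" using A.dist_0 zw by blast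
    qed simp
    then show False using f zw(3) by simp
  qed
  have surj: "z' \<in> F ` A.V" if z': "z' \<in> B.V" for z'
    using x' z'
  proof (induction rule: B.V_induct)
    case start then show ?case using F0 x by blast
  next
    case (step a b)
    then obtain a0 where a0: "a = F a0" "a0 \<in> A.V" by blast
    then obtain b0 where "adj T a0 b0" "F b0 = b" using Fsurj step(1) by blast
    then show ?case using A.adj_verts by blast
  qed
  have "graph_iso T T' F"
    unfolding graph_iso_def
  proof (intro conjI ballI)
    show "bij_betw F A.V B.V" unfolding bij_betw_def using inj surj F by blast
    fix u v assume uv: "u \<in> A.V" "v \<in> A.V"
    show "adj T u v \<longleftrightarrow> adj T' (F u) (F v)"
    proof
      assume "adj T' (F u) (F v)"
      then obtain b where b: "adj T u b" "F b = F v" using Fsurj[OF uv(1)] by blast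
      then have "b = v" using inj uv A.adj_verts(2)[OF b(1)] by (simp add: inj_on_eq_iff)
      then show "adj T u v" using b by simp
    qed (rule Fadj)
  qed
  then show ?thesis using that[of F] F0 F by blast
qed

section \<open>Deck transformations\<close>

context tree_cover
begin

lemma deck_iff: "\<gamma> \<in> carrier (deck_group T p) \<longleftrightarrow> \<gamma> \<in> Bij V \<and> graph_iso T T \<gamma> \<and> (\<forall>x\<in>V. p (\<gamma> x) = p x)"
  by (simp add: deck_group_def)

lemma deck_iso: "\<gamma> \<in> carrier (deck_group T p) \<Longrightarrow> tree_iso T T \<gamma>"
  by unfold_locales (simp add: deck_iff)

lemma deck_p: "\<gamma> \<in> carrier (deck_group T p) \<Longrightarrow> x \<in> V \<Longrightarrow> p (\<gamma> x) = p x"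
  by (simp add: deck_iff)

lemma deck_mult: "\<gamma> \<in> carrier (deck_group T p) \<Longrightarrow> \<gamma>' \<in> carrier (deck_group T p) \<Longrightarrow>
    \<gamma> \<otimes>\<^bsub>deck_group T p\<^esub> \<gamma>' = compose V \<gamma> \<gamma>'"
  by (simp add: deck_group_def BijGroup_def)

text \<open>Coverings have unique lifts, so one value determines a deck transformation: the action of
  the fundamental group on the tree is free.\<close>

lemma deck_eqI: 
  assumes "\<gamma> \<in> carrier (deck_group T p)" "\<gamma>' \<in> carrier (deck_group T p)" "x \<in> V" "\<gamma> x = \<gamma>' x"
  shows "\<gamma> = \<gamma>'"
proof -
  interpret A: tree_iso T T \<gamma> by (rule deck_iso) fact
  interpret B: tree_iso T T \<gamma>' by (rule deck_iso) fact
  have "\<gamma> z = \<gamma>' z" if z: "z \<in> V" for z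
    using assms(3) z
  proof (induction rule: V_induct)
    case (step a b)
    have "p (\<gamma> b) = p (\<gamma>' b)" using deck_p assms(1,2) adj_verts(2)[OF step(1)] by simp
    then show ?case using p_inj[OF A.iso_adj'[OF step(1)], of "\<gamma>' b"] B.iso_adj'[OF step(1)] step(3) by simp
  qed (rule assms(4))
  moreover have "\<gamma> \<in> extensional V" "\<gamma>' \<in> extensional V" using assms(1,2) by (simp_all add: deck_iff Bij_def)
  ultimately show ?thesis by (blast intro: extensionalityI)
qed

lemma deckI:
  assumes "graph_iso T T F" "\<And>z. z \<in> V \<Longrightarrow> p (F z) = p z"
  shows "restrict F V \<in> carrier (deck_group T p)"
proof -
  have "bij_betw (restrict F V) V V"
    using assms(1) unfolding graph_iso_def by (simp cong: bij_betw_cong)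
  moreover from this have "graph_iso T T (restrict F V)" using assms(1) unfolding graph_iso_def by simp
  ultimately show ?thesis using assms(2) by (simp add: deck_iff Bij_def)
qed

lemma deck_transitive:
  assumes "x \<in> V" "y \<in> V" "p x = p y"
  obtains \<gamma> where "\<gamma> \<in> carrier (deck_group T p)" "\<gamma> x = y"
proof -
  obtain F where F: "graph_iso T T F" "F x = y" "\<And>z. z \<in> V \<Longrightarrow> p (F z) = p z"
    using lift_iso[of T G p T p x y] assms tree_cover_axioms by metis
  show ?thesis using that[OF deckI[OF F(1,3)]] F(2) assms(1) by simp
qed

end

section \<open>Irreducibility of the non-backtracking walk\<close>

text \<open>Closure under continuation without backtracking implies that at each vertex \<open>v\<close> at least as
  many edges of \<open>S\<close> leave as enter: if one enters, all but one of the at least three edges at \<open>v\<close>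
  leave in \<open>S\<close>, and if two enter, all do. Both numbers have sum \<open>card S\<close>, so they agree at each
  vertex. Hence at each vertex that is entered all edges belong to \<open>S\<close> in both directions, and
  connectedness spreads this.\<close>

lemma nonbacktracking_irreducible:
  assumes wf: "wf_graph G" and fin: "finite (verts G)" and con: "connected_graph G" and deg: "min_degree_ge 3 G"
    and S: "S \<subseteq> {(u, v). adj G u v}" and ne: "S \<noteq> {}"
    and closed: "\<And>u v w. (u, v) \<in> S \<Longrightarrow> adj G v w \<Longrightarrow> w \<noteq> u \<Longrightarrow> (v, w) \<in> S"
  shows "S = {(u, v). adj G u v}"
proof -
  note adjV = wf_graph_adj(1,2)[OF wf]
  define In where "In v = {u. (u, v) \<in> S}" for v
  define Out where "Out v = {w. (v, w) \<in> S}" for v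
  have InN: "In v \<subseteq> nbhd G v" for v using S unfolding In_def nbhd_def by (auto simp: insert_commute)
  have OutN: "Out v \<subseteq> nbhd G v" for v using S unfolding Out_def nbhd_def by blast
  have finN: "finite (nbhd G v)" for v
    by (rule finite_subset[OF _ fin]) (use adjV in \<open>auto simp: nbhd_def\<close>)
  have finS: "finite S"
    by (rule finite_subset[of _ "verts G \<times> verts G"]) (use S adjV fin in auto)
  have degv: "card (nbhd G v) \<ge> 3" if "v \<in> verts G" for v using deg that unfolding min_degree_ge_def by blast
  have key: "card (In v) \<le> card (Out v) \<and> (In v \<noteq> {} \<longrightarrow> card (In v) = card (Out v) \<longrightarrow> Out v = nbhd G v)"
    if v: "v \<in> verts G" for v
  proof (cases "In v = {}")
    case False
    then obtain u where u: "u \<in> In v" by blast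
    have sub: "nbhd G v - {u} \<subseteq> Out v" if "u \<in> In v" for u
      using closed[of u v] that unfolding In_def Out_def nbhd_def by blast
    show ?thesis
    proof (cases "In v = {u}")
      case True
      have "card (nbhd G v - {u}) \<ge> 2" using degv[OF v] finN InN u by (simp add: card_Diff_singleton subset_iff)
      moreover have "card (nbhd G v - {u}) \<le> card (Out v)" by (rule card_mono[OF finite_subset[OF OutN finN] sub[OF u]])
      ultimately show ?thesis using True by simp
    next
      case F2: False
      then obtain u' where u': "u' \<in> In v" "u' \<noteq> u" using u by blast
      then have "nbhd G v \<subseteq> Out v" using sub[OF u] sub[OF u'(1)] by blast
      then have "Out v = nbhd G v" using OutN by blast
      then show ?thesis using card_mono[OF finN InN] by simp
    qed
  qed simp
  have "card S = (\<Sum>v\<in>verts G. card (Out v))"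
  proof -
    have "S = Sigma (verts G) Out" using S adjV unfolding Out_def by auto
    then show ?thesis using fin finite_subset[OF OutN finN] by (metis card_SigmaI)
  qed
  moreover have "card S = (\<Sum>v\<in>verts G. card (In v))"
  proof -
    have "S = prod.swap ` Sigma (verts G) In" using S adjV unfolding In_def by (force simp: image_iff)
    then have "card S = card (Sigma (verts G) In)" by (simp add: card_image)
    then show ?thesis using fin finite_subset[OF InN finN] by (metis card_SigmaI)
  qed
  ultimately have eq: "card (In v) = card (Out v)" if "v \<in> verts G" for v
    using sum_mono_inv[of "\<lambda>v. card (In v)" "verts G" "\<lambda>v. card (Out v)" v] key that fin by simp
  have full: "In v = nbhd G v \<and> Out v = nbhd G v" if v: "v \<in> verts G" and i: "In v \<noteq> {}" for v
  proof -
    have o: "Out v = nbhd G v" using key[OF v] eq[OF v] i by blast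
    moreover have "In v = nbhd G v" by (rule card_subset_eq[OF finN InN]) (use eq[OF v] o in simp)
    ultimately show ?thesis by blast
  qed
  obtain u0 v0 where uv0: "(u0, v0) \<in> S" using ne by auto
  then have v0: "v0 \<in> verts G" "In v0 \<noteq> {}" using S adjV unfolding In_def by auto
  have "In v \<noteq> {}" if v: "v \<in> verts G" for v
  proof -
    have "(v0, v) \<in> (adj_rel G)\<^sup>*" using con v v0 unfolding connected_graph_def by blast
    then show ?thesis
    proof (induction rule: rtrancl_induct)
      case base then show ?case by (rule v0(2))
    next
      case (step y z)
      have yz: "adj G y z" using step(2) by (simp add: adj_rel_def)
      then have "z \<in> Out y" using full[of y] step(3) adjV unfolding nbhd_def by blast
      then show ?case unfolding In_def Out_def by blast
    qed
  qed
  then have "(u, v) \<in> S" if "adj G u v" for u v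
    using full[of u] adjV[OF that] that unfolding nbhd_def Out_def by blast
  then show ?thesis using S by blast
qed

section \<open>The universal covering of a finite graph\<close>

locale univ_cover =
  fixes G :: "'v graph" and T :: "'t graph" and p :: "'t \<Rightarrow> 'v"
  assumes wfG: "wf_graph G" and finG: "finite (verts G)" and conG: "connected_graph G"
    and degG: "min_degree_ge 3 G" and uc: "universal_covering T G p"

sublocale univ_cover \<subseteq> tree_cover T G p
  using uc by unfold_locales (simp_all add: universal_covering_def)

context univ_cover
begin

lemmas adjG_verts = wf_graph_adj(1,2)[OF wfG]

lemma finite_nbhdG: "finite (nbhd G v)"
  by (rule finite_subset[OF _ finG]) (use adjG_verts in \<open>auto simp: nbhd_def\<close>)

end

sublocale univ_cover \<subseteq> locally_finite_tree T
  by unfold_locales (use p_bij finite_nbhdG bij_betw_finite in blast)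

context univ_cover
begin

lemma deg: "x \<in> V \<Longrightarrow> card (nbhd T x) \<ge> 3"
  using bij_betw_same_card[OF p_bij] degG p_V unfolding min_degree_ge_def by metis

lemma nbr_avoid2: assumes "x \<in> V" obtains w where "adj T x w" "w \<noteq> a" "w \<noteq> c"
proof -
  have "\<not> nbhd T x \<subseteq> {a, c}"
  proof
    assume "nbhd T x \<subseteq> {a, c}"
    then have "card (nbhd T x) \<le> card {a, c}" by (rule card_mono[rotated]) simp
    also have "\<dots> \<le> 2" by (simp add: card_insert_if)
    finally show False using deg[OF assms] by simp
  qed
  then show ?thesis using that by (auto simp: nbhd_def)
qed

text \<open>Irreducibility for properties of the oriented edges of the tree that are invariant under
  the fundamental group.\<close>

lemma invariant_closed_all:
  assumes inv: "\<And>a b a' b'. adj T a b \<Longrightarrow> adj T a' b' \<Longrightarrow> p a = p a' \<Longrightarrow> p b = p b' \<Longrightarrow> Q a b \<Longrightarrow> Q a' b'"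
    and closed: "\<And>a b c. adj T a b \<Longrightarrow> adj T b c \<Longrightarrow> c \<noteq> a \<Longrightarrow> Q a b \<Longrightarrow> Q b c"
    and ex: "adj T a0 b0" "Q a0 b0" and uv: "adj T u v"
  shows "Q u v"
proof -
  define S where "S = {(p a, p b) | a b. adj T a b \<and> Q a b}"
  have "S = {(u, v). adj G u v}"
  proof (rule nonbacktracking_irreducible[OF wfG finG conG degG])
    show "S \<subseteq> {(u, v). adj G u v}" unfolding S_def using p_adj by blast
    show "S \<noteq> {}" unfolding S_def using ex by blast
    fix u v w assume h: "(u, v) \<in> S" "adj G v w" "w \<noteq> u"
    then obtain a b where ab: "u = p a" "v = p b" "adj T a b" "Q a b" unfolding S_def by blast
    obtain c where c: "adj T b c" "p c = w" using p_lift[of b w] adj_verts(2)[OF ab(3)] h(2) ab(2) by metis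
    then have "c \<noteq> a" using h(3) ab(1) by blast
    then have "Q b c" using closed[OF ab(3) c(1) _ ab(4)] by blast
    then show "(v, w) \<in> S" unfolding S_def using c ab by blast
  qed
  then have "(p u, p v) \<in> S" using p_adj[OF uv] by simp
  then obtain a b where "p a = p u" "p b = p v" "adj T a b" "Q a b" unfolding S_def by auto
  then show ?thesis using inv[OF _ uv] by blast
qed

lemma deck_edge:
  assumes "adj T a b" "adj T a' b'" "p a = p a'" "p b = p b'"
  obtains \<gamma> where "\<gamma> \<in> carrier (deck_group T p)" "\<gamma> a = a'" "\<gamma> b = b'"
proof -
  obtain \<gamma> where g: "\<gamma> \<in> carrier (deck_group T p)" "\<gamma> a = a'"
    using deck_transitive[OF adj_verts(1)[OF assms(1)] adj_verts(1)[OF assms(2)] assms(3)] by blast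
  interpret g: tree_iso T T \<gamma> by (rule deck_iso[OF g(1)])
  have "adj T a' (\<gamma> b)" using g.iso_adj'[OF assms(1)] g(2) by simp
  moreover have "p (\<gamma> b) = p b'" using deck_p[OF g(1) adj_verts(2)[OF assms(1)]] assms(4) by simp
  ultimately have "\<gamma> b = b'" using p_inj assms(2) by blast
  then show ?thesis using that g by blast
qed

text \<open>The edges that can be reached from a translate of the edge from \<open>a\<close> to \<open>b\<close> without
  backtracking are closed under continuation.\<close>

lemma deck_translate_before:
  assumes ab: "adj T a b" and uv: "adj T u v"
  obtains \<gamma> where "\<gamma> \<in> carrier (deck_group T p)" "half_tree T u v \<subseteq> half_tree T (\<gamma> a) (\<gamma> b)"
proof -
  define Q where "Q u v \<longleftrightarrow> (\<exists>\<gamma>\<in>carrier (deck_group T p). half_tree T u v \<subseteq> half_tree T (\<gamma> a) (\<gamma> b))" for u v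
  have "Q u v"
  proof (rule invariant_closed_all[OF _ _ ab _ uv])
    have "restrict id V \<in> carrier (deck_group T p)" by (rule deckI) (auto simp: graph_iso_def bij_betw_def)
    then show "Q a b" unfolding Q_def using adj_verts[OF ab] by (intro bexI[of _ "restrict id V"]) auto
  next
    fix s t w assume "adj T s t" "adj T t w" "w \<noteq> s" "Q s t"
    then show "Q t w" unfolding Q_def using half_succ(1) by blast
  next
    fix s t s' t' assume h: "adj T s t" "adj T s' t'" "p s = p s'" "p t = p t'" "Q s t"
    obtain \<gamma> where g: "\<gamma> \<in> carrier (deck_group T p)" "half_tree T s t \<subseteq> half_tree T (\<gamma> a) (\<gamma> b)"
      using h(5) unfolding Q_def by blast
    obtain \<gamma>' where g': "\<gamma>' \<in> carrier (deck_group T p)" "\<gamma>' s = s'" "\<gamma>' t = t'" using deck_edge[OF h(1-4)] by blast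
    interpret g: tree_iso T T \<gamma> by (rule deck_iso[OF g(1)])
    interpret g': tree_iso T T \<gamma>' by (rule deck_iso[OF g'(1)])
    have V: "s \<in> V" "t \<in> V" "a \<in> V" "b \<in> V" using adj_verts h ab by blast+
    have ab': "adj T (\<gamma> a) (\<gamma> b)" using g.iso_adj'[OF ab] .
    have gV: "\<gamma> a \<in> V" "\<gamma> b \<in> V" using adj_verts[OF ab'] by auto
    have sub: "half_tree T s' t' \<subseteq> half_tree T (\<gamma>' (\<gamma> a)) (\<gamma>' (\<gamma> b))"
      using g(2) g'.iso_half[OF V(1,2)] g'.iso_half[OF gV] g'(2,3) by blast
    have ab'': "adj T (\<gamma>' (\<gamma> a)) (\<gamma>' (\<gamma> b))" by (rule g'.iso_adj'[OF ab'])
    have "p (\<gamma>' (\<gamma> a)) = p a" "p (\<gamma>' (\<gamma> b)) = p b" using deck_p[OF g(1)] deck_p[OF g'(1)] V gV by simp_all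
    then obtain \<gamma>'' where g'': "\<gamma>'' \<in> carrier (deck_group T p)" "\<gamma>'' a = \<gamma>' (\<gamma> a)" "\<gamma>'' b = \<gamma>' (\<gamma> b)"
      using deck_edge[OF ab ab''] by metis
    then show "Q s' t'" unfolding Q_def using sub by metis
  qed
  then show ?thesis using that unfolding Q_def by blast
qed

section \<open>Ends and half-trees when all degrees are at least three\<close>

text \<open>Degrees above one allow a walk to continue for ever without backtracking.\<close>

lemma half_ends_nonempty: assumes uv: "adj T u v" shows "half_ends T u v \<noteq> {}"
proof -
  have "\<exists>w. adj T y w \<and> w \<noteq> x" if "y \<in> V" for x y using nbr_avoid2[OF that, of x x] by blast
  note ex = this
  define nx where "nx x y = (SOME w. adj T y w \<and> w \<noteq> x)" for x y
  have nx: "adj T y (nx x y) \<and> nx x y \<noteq> x" if "y \<in> V" for x y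
    unfolding nx_def by (rule someI_ex) (rule ex[OF that])
  define q where "q n = ((\<lambda>(x, y). (y, nx x y)) ^^ n) (u, v)" for n
  define r where "r n = fst (q n)" for n
  have qS: "q (Suc n) = (snd (q n), nx (fst (q n)) (snd (q n)))" for n by (simp add: q_def split_beta)
  have q: "q n = (r n, r (Suc n))" for n by (simp add: r_def qS prod_eq_iff)
  have r0: "r 0 = u" "r 1 = v" using q[of 0] by (simp_all add: q_def)
  have adj: "adj T (r n) (r (Suc n))" for n
  proof (induction n)
    case 0 then show ?case using uv r0 by simp
  next
    case (Suc n)
    have "r (Suc (Suc n)) = nx (r n) (r (Suc n))" using qS[of n] q by simp
    then show ?case using nx adj_verts(2)[OF Suc] by simp
  qed
  have "r (Suc (Suc n)) \<noteq> r n" for n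
    using qS[of n] q nx[OF adj_verts(2)[OF adj[of n]], of "r n"] by simp
  then have rr: "r \<in> rays T" using adj by (simp add: rays_def)
  obtain \<xi> where \<xi>: "\<xi> \<in> ends T" "r \<in> \<xi>" using end_of_ray[OF rr] by blast
  have "\<xi> \<in> half_ends T u v" using half_ends_ray[OF \<xi>, of 0] r0 by simp
  then show ?thesis by blast
qed

lemma half_away:
  assumes uv: "adj T u v" and z: "z \<in> half_tree T u v"
  obtains u1 where "\<And>w. adj T z w \<Longrightarrow> w \<noteq> u1 \<Longrightarrow> half_tree T z w \<subseteq> half_tree T u v"
proof -
  have zV: "z \<in> V" and uV: "u \<in> V" and zu: "z \<noteq> u" using z adj_verts[OF uv] half_self'[OF uv] by (auto simp: half_tree_def)
  obtain u1 where u1: "adj T z u1" "u \<in> half_tree T z u1" using half_towards[OF zV uV zu] by blast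
  have "half_tree T z w \<subseteq> half_tree T u v" if w: "adj T z w" "w \<noteq> u1" for w
  proof (rule half_sub[OF w(1) uv])
    show uw: "u \<in> half_tree T w z"
      using half_not[OF w(1) uV] half_branch_unique[OF w(1) u1(1) _ u1(2)] w(2) by blast
    show "w \<in> half_tree T u v"
    proof (rule ccontr)
      assume "w \<notin> half_tree T u v"
      then have "w \<in> half_tree T v u" using half_not[OF uv adj_verts(2)[OF w(1)]] by blast
      then have "w = u" using half_cross[OF adj_sym[OF uv] w(1) z] by blast
      then show False using uw half_self'[OF adj_sym[OF w(1)]] by simp
    qed
  qed
  then show ?thesis using that by blast
qed

text \<open>At a common vertex of two half-trees at most one branch leads out of each of them, so a
  third branch lies in both.\<close>

lemma half_Int_half_ends:
  assumes uv: "adj T u v" and ac: "adj T a c" and z: "z \<in> half_tree T u v" "z \<in> half_tree T a c"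
  shows "half_ends T u v \<inter> half_ends T a c \<noteq> {}"
proof -
  obtain u1 where u1: "\<And>w. adj T z w \<Longrightarrow> w \<noteq> u1 \<Longrightarrow> half_tree T z w \<subseteq> half_tree T u v" using half_away[OF uv z(1)] by blast
  obtain a1 where a1: "\<And>w. adj T z w \<Longrightarrow> w \<noteq> a1 \<Longrightarrow> half_tree T z w \<subseteq> half_tree T a c" using half_away[OF ac z(2)] by blast
  obtain w where w: "adj T z w" "w \<noteq> u1" "w \<noteq> a1" using nbr_avoid2[OF half_V[OF z(1)]] by blast
  have "half_ends T z w \<subseteq> half_ends T u v" "half_ends T z w \<subseteq> half_ends T a c" using half_ends_mono[OF u1[OF w(1,2)]] half_ends_mono[OF a1[OF w(1,3)]] by auto
  then show ?thesis using half_ends_nonempty[OF w(1)] by blast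
qed

lemma half_ends_sub_half:
  assumes uv: "adj T u v" and ac: "adj T a c" and sub: "half_ends T u v \<subseteq> half_ends T a c"
  shows "half_tree T u v \<subseteq> half_tree T a c"
proof (rule ccontr)
  assume "\<not> ?thesis"
  then obtain z where z: "z \<in> half_tree T u v" "z \<notin> half_tree T a c" by blast
  then have z: "z \<in> half_tree T u v" "z \<in> half_tree T c a" using half_not[OF ac half_V[OF z(1)]] by auto
  obtain \<xi> where "\<xi> \<in> half_ends T u v" "\<xi> \<in> half_ends T c a" using half_Int_half_ends[OF uv adj_sym[OF ac] z] by blast
  then show False using sub half_ends_not[OF ac half_ends_ends] by blast
qed

lemma half_eq: assumes uv: "adj T u v" and ac: "adj T a c" and eq: "half_tree T u v = half_tree T a c"
  shows "u = a" "v = c"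
proof -
  have "u \<in> half_tree T c a" using half_self'[OF uv] eq half_not[OF ac adj_verts(1)[OF uv]] by blast
  moreover have "v \<in> half_tree T a c" using half_self[OF uv] eq by simp
  ultimately show "u = a" "v = c" using half_cross[OF ac uv] by auto
qed

lemma half_ends_eq: assumes uv: "adj T u v" and ac: "adj T a c" and eq: "half_ends T u v = half_ends T a c"
  shows "u = a" "v = c"
proof -
  have "half_tree T u v = half_tree T a c"
    by (rule equalityI[OF half_ends_sub_half[OF uv ac] half_ends_sub_half[OF ac uv]]) (simp_all add: eq)
  then show "u = a" "v = c" by (rule half_eq[OF uv ac])+
qed

end

section \<open>Reduced words and the Cayley tree\<close>

abbreviation word_mult :: "letter list \<Rightarrow> letter list \<Rightarrow> letter list" where
  "word_mult u v \<equiv> foldr cons_reduce u v"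

lemma inv_inv_letter [simp]: "inv_letter (inv_letter a) = a"
  by (simp add: inv_letter_def prod_eq_iff)

lemma fg_iff: "w \<in> carrier (free_group b) \<longleftrightarrow> set w \<subseteq> letters b \<and> successively (\<lambda>a c. c \<noteq> inv_letter a) w"
  by (auto simp: free_group_def)

lemma fg_mult: "u \<otimes>\<^bsub>free_group b\<^esub> v = word_mult u v"
  by (simp add: free_group_def)

lemma fg_Nil: "[] \<in> carrier (free_group b)"
  by (simp add: fg_iff)

lemma fg_butlast: "w \<in> carrier (free_group b) \<Longrightarrow> butlast w \<in> carrier (free_group b)"
  by (cases w rule: rev_cases) (auto simp: fg_iff successively_append_iff)

lemma cons_reduce_closed: "a \<in> letters b \<Longrightarrow> w \<in> carrier (free_group b) \<Longrightarrow> cons_reduce a w \<in> carrier (free_group b)"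
  by (cases w) (auto simp: fg_iff successively_Cons)

lemma word_mult_closed: "u \<in> carrier (free_group b) \<Longrightarrow> v \<in> carrier (free_group b) \<Longrightarrow> word_mult u v \<in> carrier (free_group b)"
proof (induction u)
  case (Cons a u)
  then have "u \<in> carrier (free_group b)" "a \<in> letters b" by (auto simp: fg_iff successively_Cons)
  then show ?case using Cons cons_reduce_closed by simp
qed simp

lemma word_mult_letter:
  "w \<in> carrier (free_group b) \<Longrightarrow> word_mult w [a] = (if w \<noteq> [] \<and> last w = inv_letter a then butlast w else w @ [a])"
proof (induction w)
  case (Cons c w)
  then have w: "w \<in> carrier (free_group b)" by (auto simp: fg_iff successively_Cons)
  show ?case
  proof (cases w)
    case Nil
    have "a = inv_letter c \<longleftrightarrow> c = inv_letter a" by auto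
    then show ?thesis using Nil by simp
  next
    case (Cons e w')
    have e: "e \<noteq> inv_letter c" using \<open>c # w \<in> _\<close> Cons by (simp add: fg_iff)
    have "word_mult (c # w) [a] = cons_reduce c (word_mult w [a])" by simp
    also have "\<dots> = cons_reduce c (if last w = inv_letter a then butlast w else w @ [a])"
      using Cons.IH[OF w] Cons by simp
    also have "\<dots> = (if c # w \<noteq> [] \<and> last (c # w) = inv_letter a then butlast (c # w) else (c # w) @ [a])"
      using e Cons by (cases w') auto
    finally show ?thesis .
  qed
qed simp

lemma cayley_edges:
  "e \<in> edges (cayley_tree b) \<longleftrightarrow> (\<exists>g\<in>carrier (free_group b). \<exists>a\<in>letters b. e = {g, word_mult g [a]})"
  unfolding cayley_tree_def fg_mult graph.simps by blast

lemma cayley_edgeE: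
  assumes "e \<in> edges (cayley_tree b)"
  obtains g a where "e = {g, word_mult g [a]}" "g \<in> carrier (free_group b)" "a \<in> letters b"
  using assms unfolding cayley_edges by (elim bexE)

text \<open>Multiplication by a letter on the right appends this letter or cancels the last one. So the
  Cayley graph is the tree of reduced words in which \<open>butlast w\<close> is the parent of \<open>w\<close>.\<close>

lemma cayley_adj:
  "adj (cayley_tree b) u v \<longleftrightarrow> u \<in> carrier (free_group b) \<and> v \<in> carrier (free_group b) \<and>
     ((u \<noteq> [] \<and> v = butlast u) \<or> (v \<noteq> [] \<and> u = butlast v))" (is "_ \<longleftrightarrow> ?link u v")
proof
  have link: "?link g (word_mult g [a])" if g: "g \<in> carrier (free_group b)" and a: "a \<in> letters b" for g a
  proof -
    have "[a] \<in> carrier (free_group b)" using a by (simp add: fg_iff)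
    then have "word_mult g [a] \<in> carrier (free_group b)" using word_mult_closed[OF g] by blast
    then show ?thesis using word_mult_letter[OF g, of a] g by (auto split: if_splits)
  qed
  assume "adj (cayley_tree b) u v"
  then obtain g a where "{u, v} = {g, word_mult g [a]}" "g \<in> carrier (free_group b)" "a \<in> letters b"
    by (rule cayley_edgeE)
  then show "?link u v" using link[of g a] by (auto simp: doubleton_eq_iff)
next
  have E: "adj (cayley_tree b) u v" if h: "u \<in> carrier (free_group b)" "v \<in> carrier (free_group b)" "v \<noteq> []" "u = butlast v" for u v
  proof -
    have v: "v = u @ [last v]" using h by simp
    have a: "last v \<in> letters b" using h by (auto simp: fg_iff)
    have "u = [] \<or> last u \<noteq> inv_letter (last v)"
    proof -
      have "successively (\<lambda>a c. c \<noteq> inv_letter a) (u @ [last v])" using h(2) v by (simp add: fg_iff)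
      then show ?thesis by (auto simp: successively_append_iff)
    qed
    then have "word_mult u [last v] = v" using word_mult_letter[OF h(1), of "last v"] v by auto
    then have "{u, v} = {u, word_mult u [last v]}" by simp
    then show ?thesis unfolding cayley_edges using h(1) a by blast
  qed
  assume "?link u v"
  then show "adj (cayley_tree b) u v" using E[of u v] E[of v u] by (auto simp: insert_commute)
qed

lemma cayley_verts: "verts (cayley_tree b) = carrier (free_group b)"
  by (simp add: cayley_tree_def)

text \<open>On a cycle the two neighbours of a word of maximal length would both be its parent.\<close>

lemma cayley_locally_finite_tree: "locally_finite_tree (cayley_tree b)"
proof -
  let ?C = "cayley_tree b"
  have len: "u \<noteq> v \<and> u \<in> verts ?C \<and> v \<in> verts ?C" if "adj ?C u v" for u v
    using that unfolding cayley_adj cayley_verts by (metis append_butlast_last_id append_self_conv not_Cons_self2)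
  have "wf_graph ?C"
    unfolding wf_graph_def
  proof
    fix e assume e: "e \<in> edges ?C"
    then obtain g a where g: "e = {g, word_mult g [a]}" by (rule cayley_edgeE)
    then show "e \<in> {{u, v} |u v. u \<in> verts ?C \<and> v \<in> verts ?C \<and> u \<noteq> v}"
      using len[of g "word_mult g [a]"] e by blast
  qed
  moreover have "connected_graph ?C"
  proof -
    have r: "([], w) \<in> (adj_rel ?C)\<^sup>* \<and> (w, []) \<in> (adj_rel ?C)\<^sup>*" if "w \<in> carrier (free_group b)" for w
      using that
    proof (induction w rule: rev_induct)
      case (snoc a w)
      have w: "w \<in> carrier (free_group b)" using fg_butlast[OF snoc.prems] by simp
      have "adj ?C w (w @ [a])" unfolding cayley_adj using w snoc.prems by simp
      then have "(w, w @ [a]) \<in> adj_rel ?C" "(w @ [a], w) \<in> adj_rel ?C" by (auto simp: adj_rel_def insert_commute)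
      then show ?case using snoc.IH[OF w] rtrancl_into_rtrancl[of "[]" w "adj_rel ?C" "w @ [a]"]
          converse_rtrancl_into_rtrancl[of "w @ [a]" w "adj_rel ?C" "[]"] by blast
    qed simp
    show ?thesis unfolding connected_graph_def cayley_verts
    proof (intro conjI ballI)
      show "carrier (free_group b) \<noteq> {}" using fg_Nil by blast
      show "(u, v) \<in> (adj_rel ?C)\<^sup>*" if "u \<in> carrier (free_group b)" "v \<in> carrier (free_group b)" for u v
        using r[OF that(1)] r[OF that(2)] by (blast intro: rtrancl_trans)
    qed
  qed
  moreover have "\<not> is_cycle ?C c" for c
  proof
    assume c: "is_cycle ?C c"
    define n where "n = length c"
    have n: "3 \<le> n" "distinct c" and ad: "\<And>i. i < n \<Longrightarrow> adj ?C (c ! i) (c ! (Suc i mod n))"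
      using c unfolding is_cycle_def n_def by auto
    let ?L = "(\<lambda>i. length (c ! i)) ` {..<n}"
    have "0 \<in> {..<n}" using n by simp
    then have "Max ?L \<in> ?L" by (intro Max_in) blast+
    then obtain i where i: "i < n" "length (c ! i) = Max ?L" by auto
    have mx: "length (c ! j) \<le> length (c ! i)" if "j < n" for j
      unfolding i(2) by (rule Max_ge) (use that in auto)
    have nb: "c ! j = butlast (c ! i)" if j: "j < n" and a: "adj ?C (c ! i) (c ! j)" for j
    proof -
      have "\<not> (c ! j \<noteq> [] \<and> c ! i = butlast (c ! j))"
      proof
        assume h: "c ! j \<noteq> [] \<and> c ! i = butlast (c ! j)"
        then have "length (c ! i) < length (c ! j)" by (cases "c ! j" rule: rev_cases) auto
        then show False using mx[OF j] by simp
      qed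
      then show ?thesis using a unfolding cayley_adj by blast
    qed
    define k where "k = (if i = 0 then n - 1 else i - 1)"
    have k: "k < n" "Suc k mod n = i" using i n by (auto simp: k_def)
    have m: "Suc i mod n < n" using n by simp
    have "c ! (Suc i mod n) = butlast (c ! i)" by (rule nb[OF m ad[OF i(1)]])
    moreover have "c ! k = butlast (c ! i)" by (rule nb[OF k(1)]) (use ad[OF k(1)] k(2) in \<open>simp add: insert_commute\<close>)
    ultimately have "Suc i mod n = k" using n(2) m k(1) unfolding n_def by (metis nth_eq_iff_index_eq)
    then show False using i n(1) by (auto simp: k_def mod_Suc split: if_splits)
  qed
  ultimately have t: "tree ?C" by (simp add: tree_def)
  show ?thesis
  proof unfold_locales
    show "tree ?C" by (rule t)
    fix x assume "x \<in> verts ?C"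
    have "nbhd ?C x \<subseteq> insert (butlast x) ((\<lambda>a. x @ [a]) ` letters b)"
    proof
      fix y assume "y \<in> nbhd ?C x"
      then have a: "adj ?C x y" by (simp add: nbhd_def)
      then consider "y = butlast x" | "y \<noteq> []" "x = butlast y" "y \<in> carrier (free_group b)" unfolding cayley_adj by blast
      then show "y \<in> insert (butlast x) ((\<lambda>a. x @ [a]) ` letters b)"
      proof cases
        case 2
        then have "y = x @ [last y]" "last y \<in> letters b" by (auto simp: fg_iff)
        then show ?thesis by blast
      qed simp
    qed
    then show "finite (nbhd ?C x)" by (rule finite_subset) (simp add: letters_def)
  qed
qed

section \<open>The orbit map and its coarse inverse\<close>

locale marked_cover = univ_cover G T p for G :: "'v graph" and T :: "'t graph" and p :: "'t \<Rightarrow> 'v" +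
  fixes b :: nat and x\<^sub>0 :: 't and \<alpha> :: "letter list \<Rightarrow> 't \<Rightarrow> 't"
  assumes mk: "marking b T p x\<^sub>0 \<alpha>"
begin

abbreviation "W \<equiv> carrier (free_group b)"
abbreviation "C \<equiv> cayley_tree b"

sublocale C: locally_finite_tree "cayley_tree b" by (rule cayley_locally_finite_tree)

lemma x0: "x\<^sub>0 \<in> V"
  using mk by (simp add: marking_def)

lemma \<alpha>_bij: "bij_betw \<alpha> W (carrier (deck_group T p))" and \<alpha>_hom: "\<alpha> \<in> hom (free_group b) (deck_group T p)"
  using mk by (simp_all add: marking_def iso_def)

lemma \<alpha>_deck: "g \<in> W \<Longrightarrow> \<alpha> g \<in> carrier (deck_group T p)"
  using \<alpha>_bij unfolding bij_betw_def by blast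

lemma \<alpha>_iso: "g \<in> W \<Longrightarrow> tree_iso T T (\<alpha> g)"
  using \<alpha>_deck deck_iso by blast

lemma \<alpha>_V: "g \<in> W \<Longrightarrow> z \<in> V \<Longrightarrow> \<alpha> g z \<in> V"
  using tree_iso.iso_V[OF \<alpha>_iso] by blast

lemma \<alpha>_mult: "g \<in> W \<Longrightarrow> h \<in> W \<Longrightarrow> z \<in> V \<Longrightarrow> \<alpha> (word_mult g h) z = \<alpha> g (\<alpha> h z)"
  using hom_mult[OF \<alpha>_hom] deck_mult[OF \<alpha>_deck \<alpha>_deck] by (simp add: fg_mult compose_def)

lemma \<alpha>_eq: assumes "g \<in> W" "h \<in> W" "z \<in> V" "\<alpha> g z = \<alpha> h z" shows "g = h"
proof -
  have "\<alpha> g = \<alpha> h" by (rule deck_eqI[OF \<alpha>_deck \<alpha>_deck assms(3,4)]) fact+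
  then show ?thesis using \<alpha>_bij assms unfolding bij_betw_def inj_on_def by blast
qed

lemma \<alpha>_surj: assumes "\<gamma> \<in> carrier (deck_group T p)" obtains g where "g \<in> W" "\<alpha> g = \<gamma>"
proof -
  have "\<gamma> \<in> \<alpha> ` W" using \<alpha>_bij assms by (simp add: bij_betw_def)
  then show ?thesis using that by blast
qed

lemma \<alpha>_Nil: assumes z: "z \<in> V" shows "\<alpha> [] z = z"
proof -
  interpret i: tree_iso T T "\<alpha> []" by (rule \<alpha>_iso[OF fg_Nil])
  have "\<alpha> [] (\<alpha> [] z) = \<alpha> [] z" using \<alpha>_mult[OF fg_Nil fg_Nil z] by simp
  then show ?thesis using i.iso_inj \<alpha>_V[OF fg_Nil z] z by (simp add: inj_on_eq_iff)
qed

lemma W_inv: assumes g: "g \<in> W"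
  obtains h where "h \<in> W" "\<And>z. z \<in> V \<Longrightarrow> \<alpha> h (\<alpha> g z) = z" "\<And>z. z \<in> V \<Longrightarrow> \<alpha> g (\<alpha> h z) = z"
proof -
  interpret i: tree_iso T T "\<alpha> g" by (rule \<alpha>_iso[OF g])
  have "p (i.inv_iso z) = p z" if "z \<in> V" for z
    using deck_p[OF \<alpha>_deck[OF g] i.inv_V[OF that]] i.inv_right[OF that] by simp
  then have "restrict i.inv_iso V \<in> carrier (deck_group T p)" by (rule deckI[OF i.inv_graph_iso])
  then obtain h where h: "h \<in> W" "\<alpha> h = restrict i.inv_iso V" by (rule \<alpha>_surj)
  show ?thesis
    by (rule that[OF h(1)]) (use h(2) i.inv_left i.inv_right i.iso_V in auto)
qed

text \<open>Associativity of the multiplication of reduced words is inherited from the composition of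
  deck transformations, because \<open>\<alpha>\<close> is injective.\<close>

lemma word_mult_assoc: assumes "g \<in> W" "h \<in> W" "k \<in> W" shows "word_mult (word_mult g h) k = word_mult g (word_mult h k)"
  by (rule \<alpha>_eq[OF _ _ x0]) (simp_all only: assms word_mult_closed \<alpha>_mult x0 \<alpha>_V)

lemma word_mult_Nil: assumes "g \<in> W" shows "word_mult g [] = g"
  by (rule \<alpha>_eq[OF _ _ x0]) (use assms fg_Nil word_mult_closed \<alpha>_mult x0 \<alpha>_Nil in simp_all)

text \<open>One vertex above each vertex of \<open>G\<close>: a fundamental domain for the vertices of the tree.\<close>

definition \<sigma> :: "'v \<Rightarrow> 't" where "\<sigma> v = (SOME x. x \<in> V \<and> p x = v)"

lemma \<sigma>: "v \<in> verts G \<Longrightarrow> \<sigma> v \<in> V \<and> p (\<sigma> v) = v"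
  unfolding \<sigma>_def by (rule someI_ex) (use p_surj in blast)

text \<open>The group element that moves the chosen vertex of the fibre of \<open>y\<close> to \<open>y\<close>. As a map to the
  Cayley tree it is equivariant and a coarse inverse of the orbit map.\<close>

definition word_of :: "'t \<Rightarrow> letter list" where "word_of y = (THE g. g \<in> W \<and> \<alpha> g (\<sigma> (p y)) = y)"

lemma word_of_eq: assumes "g \<in> W" "y \<in> V" "\<alpha> g (\<sigma> (p y)) = y" shows "word_of y = g"
  unfolding word_of_def by (rule the_equality) (use assms \<alpha>_eq \<sigma>[OF p_V[OF assms(2)]] in metis)+

lemma word_of: assumes y: "y \<in> V" shows "word_of y \<in> W" "\<alpha> (word_of y) (\<sigma> (p y)) = y"
proof -
  note s = \<sigma>[OF p_V[OF y]]
  obtain \<gamma> where \<gamma>: "\<gamma> \<in> carrier (deck_group T p)" "\<gamma> (\<sigma> (p y)) = y" using deck_transitive[of "\<sigma> (p y)" y] s y by metis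
  obtain g where "g \<in> W" "\<alpha> g = \<gamma>" using \<alpha>_surj[OF \<gamma>(1)] .
  then show "word_of y \<in> W" "\<alpha> (word_of y) (\<sigma> (p y)) = y" using word_of_eq[OF _ y] \<gamma> by auto
qed

lemma word_of_equiv: assumes "g \<in> W" "y \<in> V" shows "word_of (\<alpha> g y) = word_mult g (word_of y)"
proof (rule word_of_eq)
  have "p (\<alpha> g y) = p y" using deck_p[OF \<alpha>_deck] assms by simp
  then show "\<alpha> (word_mult g (word_of y)) (\<sigma> (p (\<alpha> g y))) = \<alpha> g y"
    using \<alpha>_mult word_of assms \<sigma>[OF p_V] by simp
qed (use assms word_mult_closed word_of \<alpha>_V in auto)

abbreviation "orbit_map \<equiv> \<lambda>g. \<alpha> g x\<^sub>0"

lemma \<alpha>_dist: "g \<in> W \<Longrightarrow> y \<in> V \<Longrightarrow> z \<in> V \<Longrightarrow> d (\<alpha> g y) (\<alpha> g z) = d y z"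
  using tree_iso.iso_dist[OF \<alpha>_iso] by blast

lemma left_dist: assumes g: "g \<in> W" and "u \<in> W" "v \<in> W" shows "C.d (word_mult g u) (word_mult g v) \<le> C.d u v"
proof -
  have adj: "adj C (word_mult g u) (word_mult g v)" if uv: "adj C u v" for u v
  proof -
    obtain h a where h: "{u, v} = {h, word_mult h [a]}" "h \<in> W" "a \<in> letters b"
      using uv by (rule cayley_edgeE)
    have a: "[a] \<in> W" using h(3) by (simp add: fg_iff)
    have "{word_mult g u, word_mult g v} = word_mult g ` {u, v}" by simp
    also have "\<dots> = {word_mult g h, word_mult (word_mult g h) [a]}"
      unfolding h(1) using word_mult_assoc[OF g h(2) a] by simp
    finally show ?thesis unfolding cayley_edges using word_mult_closed[OF g h(2)] h(3) by (intro bexI[of _ "word_mult g h"] bexI[of _ a])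
  qed
  have "(u, z) \<in> adj_rel C ^^ n \<Longrightarrow> (word_mult g u, word_mult g z) \<in> adj_rel C ^^ n" for z n
  proof (induction n arbitrary: z)
    case (Suc n)
    then obtain w where w: "(u, w) \<in> adj_rel C ^^ n" "(w, z) \<in> adj_rel C" by auto
    then have "(word_mult g w, word_mult g z) \<in> adj_rel C" using adj[of w z] by (simp add: adj_rel_def)
    with Suc.IH[OF w(1)] show ?case by auto
  qed simp
  then show ?thesis using C.dist_walk assms C.dist_le by (metis cayley_verts)
qed

text \<open>The Lipschitz constant is a maximum over the finitely many letters; properness holds
  because the action is free and balls are finite.\<close>

lemma orbit_map_coarse: "coarse C T orbit_map"
  unfolding coarse_def cayley_verts
proof (intro conjI ballI allI)
  show "orbit_map ` W \<subseteq> V" using \<alpha>_V x0 by blast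
  define L where "L = Max ((\<lambda>a. d x\<^sub>0 (\<alpha> [a] x\<^sub>0)) ` letters b)"
  have one: "d (orbit_map g) (orbit_map (word_mult g [a])) \<le> L" if g: "g \<in> W" and a: "a \<in> letters b" for g a
  proof -
    have aW: "[a] \<in> W" using a by (simp add: fg_iff)
    have "d (orbit_map g) (orbit_map (word_mult g [a])) = d x\<^sub>0 (\<alpha> [a] x\<^sub>0)"
      using \<alpha>_dist[OF g x0 \<alpha>_V[OF aW x0]] \<alpha>_mult[OF g aW x0] by simp
    also have "\<dots> \<le> L" unfolding L_def by (rule Max_ge) (use a in \<open>auto simp: letters_def\<close>)
    finally show ?thesis .
  qed
  show "\<exists>L. \<forall>g h. adj C g h \<longrightarrow> d (orbit_map g) (orbit_map h) \<le> L"
  proof (intro exI[of _ L] allI impI)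
    fix g h assume "adj C g h"
    then obtain k a where k: "{g, h} = {k, word_mult k [a]}" "k \<in> W" "a \<in> letters b"
      by (rule cayley_edgeE)
    then show "d (orbit_map g) (orbit_map h) \<le> L" using one[OF k(2,3)] dist_sym by (auto simp: doubleton_eq_iff)
  qed
  fix y n assume y: "y \<in> V"
  have "finite (orbit_map ` {g \<in> W. d (orbit_map g) y \<le> n})"
    by (rule finite_subset[OF _ ball_finite[OF y, of n]]) (use \<alpha>_V x0 dist_sym in auto)
  moreover have "inj_on orbit_map {g \<in> W. d (orbit_map g) y \<le> n}" using \<alpha>_eq x0 by (auto intro!: inj_onI)
  ultimately show "finite {g \<in> W. d (orbit_map g) y \<le> n}" by (rule finite_imageD)
qed

lemma orbit_map_word_of: obtains D where "\<And>y. y \<in> V \<Longrightarrow> d (orbit_map (word_of y)) y \<le> D"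
proof -
  have "d (orbit_map (word_of y)) y \<le> Max ((\<lambda>v. d x\<^sub>0 (\<sigma> v)) ` verts G)" if y: "y \<in> V" for y
  proof -
    have "d (orbit_map (word_of y)) y = d x\<^sub>0 (\<sigma> (p y))"
      using \<alpha>_dist[OF word_of(1)[OF y] x0, of "\<sigma> (p y)"] word_of(2)[OF y] \<sigma>[OF p_V[OF y]] by simp
    also have "\<dots> \<le> Max ((\<lambda>v. d x\<^sub>0 (\<sigma> v)) ` verts G)" by (rule Max_ge) (use finG p_V[OF y] in auto)
    finally show ?thesis .
  qed
  then show ?thesis using that by blast
qed

lemma word_of_orbit_map: assumes "g \<in> W" shows "C.d (word_of (orbit_map g)) g \<le> C.d (word_of x\<^sub>0) []"
  using left_dist[OF assms word_of(1)[OF x0] fg_Nil] word_of_equiv[OF assms x0] word_mult_Nil[OF assms] by simp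

text \<open>Neighbours in the tree have words that differ by an element of \<open>K\<close>, the finite set of group
  elements that move one chosen vertex next to another.\<close>

lemma word_of_coarse: "coarse T C word_of"
  unfolding coarse_def cayley_verts
proof (intro conjI ballI allI)
  show "word_of ` V \<subseteq> W" using word_of by blast
  define K where "K = {k \<in> W. \<exists>v\<in>verts G. \<exists>w\<in>verts G. adj T (\<sigma> v) (\<alpha> k (\<sigma> w))}"
  have finK: "finite K"
  proof -
    have "K \<subseteq> (\<Union>v\<in>verts G. \<Union>w\<in>verts G. {k \<in> W. \<alpha> k (\<sigma> w) \<in> nbhd T (\<sigma> v)})"
      unfolding K_def by (auto simp: nbhd_def)
    moreover have "finite {k \<in> W. \<alpha> k (\<sigma> w) \<in> nbhd T (\<sigma> v)}" if v: "v \<in> verts G" and w: "w \<in> verts G" for v w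
    proof (rule finite_imageD)
      show "finite ((\<lambda>k. \<alpha> k (\<sigma> w)) ` {k \<in> W. \<alpha> k (\<sigma> w) \<in> nbhd T (\<sigma> v)})"
        by (rule finite_subset[OF _ fin_nbhd]) (use \<sigma>[OF v] in auto)
      show "inj_on (\<lambda>k. \<alpha> k (\<sigma> w)) {k \<in> W. \<alpha> k (\<sigma> w) \<in> nbhd T (\<sigma> v)}"
        using \<alpha>_eq \<sigma>[OF w] by (auto intro!: inj_onI)
    qed
    ultimately show ?thesis using finG by (auto intro: finite_subset)
  qed
  define L where "L = Max ((\<lambda>k. C.d [] k) ` K)"
  show "\<exists>L. \<forall>y z. adj T y z \<longrightarrow> C.d (word_of y) (word_of z) \<le> L"
  proof (intro exI[of _ L] allI impI)
    fix y z assume yz: "adj T y z"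
    note V = adj_verts(1,2)[OF yz]
    obtain h where h: "h \<in> W" "\<And>z. z \<in> V \<Longrightarrow> \<alpha> h (\<alpha> (word_of y) z) = z" "\<And>z. z \<in> V \<Longrightarrow> \<alpha> (word_of y) (\<alpha> h z) = z"
      using W_inv[OF word_of(1)[OF V(1)]] by metis
    note sV = \<sigma>[OF p_V[OF V(1)]] \<sigma>[OF p_V[OF V(2)]]
    define k where "k = word_mult h (word_of z)"
    have kW: "k \<in> W" unfolding k_def using word_mult_closed h(1) word_of V by blast
    have az: "\<alpha> k (\<sigma> (p z)) = \<alpha> h z" unfolding k_def using \<alpha>_mult[OF h(1) word_of(1)[OF V(2)]] word_of(2)[OF V(2)] sV by simp
    have "\<alpha> h y = \<sigma> (p y)" using h(2)[of "\<sigma> (p y)"] word_of(2)[OF V(1)] sV by simp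
    then have "adj T (\<sigma> (p y)) (\<alpha> k (\<sigma> (p z)))"
      using tree_iso.iso_adj'[OF \<alpha>_iso[OF h(1)] yz] az by simp
    then have "k \<in> K" unfolding K_def using kW p_V V by blast
    then have kL: "C.d [] k \<le> L" unfolding L_def using finK by (intro Max_ge) auto
    have "word_mult (word_of y) k = word_of z"
    proof (rule \<alpha>_eq)
      show "\<alpha> (word_mult (word_of y) k) (\<sigma> (p z)) = \<alpha> (word_of z) (\<sigma> (p z))"
        using \<alpha>_mult[OF word_of(1)[OF V(1)] kW] sV az h(3)[OF V(2)] word_of(2)[OF V(2)] by simp
    qed (use word_mult_closed word_of V kW sV in auto)
    then have "C.d (word_of y) (word_of z) \<le> C.d [] k"
      using left_dist[OF word_of(1)[OF V(1)] fg_Nil kW] word_mult_Nil[OF word_of(1)[OF V(1)]] by simp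
    then show "C.d (word_of y) (word_of z) \<le> L" using kL by simp
  qed
  fix g n assume g: "g \<in> W"
  have "{y \<in> V. C.d (word_of y) g \<le> n} \<subseteq> (\<Union>h\<in>{h \<in> W. C.d g h \<le> n}. (\<lambda>v. \<alpha> h (\<sigma> v)) ` verts G)"
  proof
    fix y assume y: "y \<in> {y \<in> V. C.d (word_of y) g \<le> n}"
    then have "word_of y \<in> {h \<in> W. C.d g h \<le> n}" "y = \<alpha> (word_of y) (\<sigma> (p y))" "p y \<in> verts G"
      using word_of p_V C.dist_sym[of g] by auto
    then show "y \<in> (\<Union>h\<in>{h \<in> W. C.d g h \<le> n}. (\<lambda>v. \<alpha> h (\<sigma> v)) ` verts G)" by blast
  qed
  moreover have "finite {h \<in> W. C.d g h \<le> n}" using C.ball_finite[of g n] g by (simp add: cayley_verts)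
  ultimately show "finite {y \<in> V. C.d (word_of y) g \<le> n}" using finG by (auto intro: finite_subset)
qed

section \<open>The boundary map\<close>

lemma orbit_end_map_ext: "orbit_end_map b T x\<^sub>0 \<alpha> = end_extension C T orbit_map"
  by (simp add: fun_eq_iff orbit_end_map_def end_extension_def)

sublocale CT: two_trees "cayley_tree b" T by unfold_locales
sublocale TC: two_trees T "cayley_tree b" by unfold_locales

lemma ext_orb_word_of: "\<xi> \<in> ends T \<Longrightarrow> end_extension C T orbit_map (end_extension T C word_of \<xi>) = \<xi>"
  using orbit_map_word_of ext_inverse[OF locally_finite_tree_axioms C.locally_finite_tree_axioms word_of_coarse orbit_map_coarse] by metis

lemma ext_word_of_orbit_map: "\<eta> \<in> ends C \<Longrightarrow> end_extension T C word_of (end_extension C T orbit_map \<eta>) = \<eta>"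
  using word_of_orbit_map ext_inverse[OF C.locally_finite_tree_axioms locally_finite_tree_axioms orbit_map_coarse word_of_coarse] cayley_verts by metis

text \<open>The extensions of the orbit map and of its coarse inverse are inverse to each other.\<close>

lemma boundary_map_ext: assumes "\<xi> \<in> ends T" shows "boundary_map b T x\<^sub>0 \<alpha> \<xi> = end_extension T C word_of \<xi>"
  unfolding boundary_map_def orbit_end_map_ext
proof (rule inv_into_f_eq)
  show "inj_on (end_extension C T orbit_map) (ends C)" by (rule inj_on_inverseI) (rule ext_word_of_orbit_map)
  show "end_extension T C word_of \<xi> \<in> ends C" by (rule TC.ext_lim(1)[OF word_of_coarse assms])
  show "end_extension C T orbit_map (end_extension T C word_of \<xi>) = \<xi>" by (rule ext_orb_word_of[OF assms])
qed

end

section \<open>Approximation by an algebra\<close>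

text \<open>The sets that can be approximated form a sigma-algebra; for a countable union, a finite
  union of the first sets already has almost the full measure.\<close>

lemma measure_algebra_approx:
  assumes fin: "finite_measure M" and alg: "algebra \<Omega> \<A>" and sets: "sets M = sigma_sets \<Omega> \<A>"
    and E: "E \<in> sets M" and e: "(e::real) > 0"
  shows "\<exists>U\<in>\<A>. measure M ((E - U) \<union> (U - E)) < e"
proof -
  interpret finite_measure M by fact
  interpret a: algebra \<Omega> \<A> by fact
  have AM: "U \<in> sets M" if "U \<in> \<A>" for U using that sets by (simp add: sigma_sets.Basic)
  have "E \<in> sigma_sets \<Omega> \<A>" using E sets by simp
  then show ?thesis using e
  proof (induction arbitrary: e)
    case (Basic a)
    then show ?case by (intro bexI[of _ a]) simp_all
  next
    case Empty
    then show ?case by (intro bexI[of _ "{}"]) simp_all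
  next
    case (Compl a)
    then obtain U where U: "U \<in> \<A>" "measure M ((a - U) \<union> (U - a)) < e" by blast
    have "(\<Omega> - a - (\<Omega> - U)) \<union> (\<Omega> - U - (\<Omega> - a)) = (a - U) \<union> (U - a)"
      using a.sets_into_space[OF U(1)] sigma_sets_into_sp[OF a.space_closed Compl(1)] by blast
    then show ?case using U by (intro bexI[of _ "\<Omega> - U"]) auto
  next
    case (Union a)
    have aM: "a i \<in> sets M" for i using Union(1) sets by simp
    define F where "F n = (\<Union>i<n. a i)" for n
    have FM: "F n \<in> sets M" for n unfolding F_def using aM by blast
    have "incseq F" unfolding F_def incseq_def by (auto intro: less_le_trans)
    then have "(\<lambda>n. measure M (F n)) \<longlonglongrightarrow> measure M (\<Union>n. F n)"
      using FM by (intro finite_Lim_measure_incseq) auto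
    moreover have UF: "(\<Union>n. F n) = (\<Union>i. a i)" unfolding F_def by auto
    ultimately obtain n where n: "\<bar>measure M (F n) - measure M (\<Union>i. a i)\<bar> < e / 2"
      using LIMSEQ_D[of _ _ "e/2"] Union.prems by (metis half_gt_zero order_refl real_norm_def)
    have UM: "(\<Union>i. a i) \<in> sets M" using aM by blast
    have "F n \<subseteq> (\<Union>i. a i)" unfolding F_def by blast
    then have d1: "measure M ((\<Union>i. a i) - F n) < e / 2"
      using n finite_measure_Diff[OF UM FM, of n] abs_less_iff[of "measure M (F n) - measure M (\<Union>i. a i)" "e / 2"] by simp
    have "\<exists>U\<in>\<A>. measure M ((a i - U) \<union> (U - a i)) < e / (2 * (real n + 1))" for i
      using Union.IH[of "e / (2 * (real n + 1))" i] Union.prems by simp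
    then obtain U where U: "\<And>i. U i \<in> \<A>" "\<And>i. measure M ((a i - U i) \<union> (U i - a i)) < e / (2 * (real n + 1))"
      by metis
    let ?D = "\<lambda>i. (a i - U i) \<union> (U i - a i)"
    have DM: "?D i \<in> sets M" for i using aM AM[OF U(1)] by blast
    have V: "(\<Union>i<n. U i) \<in> \<A>" using U(1) by (intro a.finite_UN) auto
    have "measure M (((\<Union>i. a i) - (\<Union>i<n. U i)) \<union> ((\<Union>i<n. U i) - (\<Union>i. a i)))
        \<le> measure M (((\<Union>i. a i) - F n) \<union> (\<Union>i<n. ?D i))"
    proof (rule finite_measure_mono)
      show "((\<Union>i. a i) - (\<Union>i<n. U i)) \<union> ((\<Union>i<n. U i) - (\<Union>i. a i)) \<subseteq> ((\<Union>i. a i) - F n) \<union> (\<Union>i<n. ?D i)"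
        unfolding F_def by blast
      show "((\<Union>i. a i) - F n) \<union> (\<Union>i<n. ?D i) \<in> sets M" using UM FM DM by blast
    qed
    also have "\<dots> \<le> measure M ((\<Union>i. a i) - F n) + measure M (\<Union>i<n. ?D i)"
      using UM FM DM by (intro measure_Un_le) auto
    also have "measure M (\<Union>i<n. ?D i) \<le> (\<Sum>i<n. measure M (?D i))"
      using DM by (intro finite_measure_subadditive_finite) auto
    also have "\<dots> \<le> (\<Sum>i<n. e / (2 * (real n + 1)))"
      by (rule sum_mono) (use U(2) less_imp_le in blast)
    also have "\<dots> \<le> e / 2" using Union.prems by (simp add: field_simps)
    finally have "measure M (((\<Union>i. a i) - (\<Union>i<n. U i)) \<union> ((\<Union>i<n. U i) - (\<Union>i. a i))) < e"
      using d1 by simp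
    then show ?case using V by blast
  qed
qed

section \<open>The Borel sigma-algebra of the end space\<close>

context tree_graph
begin

lemma half_ends_on_ray:
  assumes uv: "adj T u v" and x: "x \<in> half_tree T v u" and b: "\<xi> \<in> half_ends T u v" and r: "r \<in> \<xi>" "r 0 = x"
  obtains n where "r n = u" "r (Suc n) = v"
proof -
  note \<xi> = half_ends_ends[OF b] and rr = end_rays[OF half_ends_ends[OF b] r(1)]
  obtain N where N: "r N \<in> half_tree T u v" using b unfolding half_ends_iff[OF \<xi> r(1)] by (auto simp: eventually_sequentially)
  define m where "m = (LEAST m. r m \<in> half_tree T u v)"
  have m: "r m \<in> half_tree T u v" unfolding m_def by (rule LeastI[of _ N]) (rule N)
  have "m \<noteq> 0" using m x r(2) half_disj by metis
  then obtain k where k: "m = Suc k" by (cases m) auto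
  have "r k \<notin> half_tree T u v" unfolding m_def by (rule not_less_Least) (use k m_def in simp)
  then have "r k \<in> half_tree T v u" using half_not[OF uv rays_V[OF rr]] by blast
  then show ?thesis using that[of k] half_cross[OF uv rays_adj[OF rr], of k] m k by simp
qed

lemma Cyl_half_ends: assumes uv: "adj T u v" and x: "x \<in> half_tree T v u" shows "Cyl T x {u, v} = half_ends T u v"
proof (intro equalityI subsetI)
  fix \<xi> assume "\<xi> \<in> Cyl T x {u, v}"
  then obtain r n where h: "\<xi> \<in> ends T" "r \<in> \<xi>" "r 0 = x" "{r n, r (Suc n)} = {u, v}" unfolding Cyl_def by blast
  note rr = end_rays[OF h(1,2)]
  have "\<not> (r n = v \<and> r (Suc n) = u)" using ray_in_half'[OF rr, of 0 n] h(3) x half_disj by auto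
  then have "r n = u \<and> r (Suc n) = v" using h(4) by (auto simp: doubleton_eq_iff)
  then show "\<xi> \<in> half_ends T u v" using half_ends_ray[OF h(1,2), of n] by simp
next
  fix \<xi> assume b: "\<xi> \<in> half_ends T u v"
  obtain r where r: "r \<in> \<xi>" "r 0 = x" using ray_from_ex[OF half_ends_ends[OF b] half_V[OF x]] by blast
  obtain n where n: "r n = u" "r (Suc n) = v" using half_ends_on_ray[OF uv x b r] .
  then have "{r n, r (Suc n)} = {u, v}" by simp
  then show "\<xi> \<in> Cyl T x {u, v}" unfolding Cyl_def using r half_ends_ends[OF b] by blast
qed

lemma Cyl_set: "{Cyl T x f | x f. x \<in> V \<and> f \<in> edges T} = {half_ends T u v | u v. adj T u v}" (is "?L = ?R")
proof (intro equalityI subsetI)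
  fix A assume "A \<in> ?L"
  then obtain x f where h: "A = Cyl T x f" "x \<in> V" "f \<in> edges T" by blast
  have "f \<in> {{u, v} | u v. u \<in> V \<and> v \<in> V \<and> u \<noteq> v}" using tree h(3) unfolding tree_def wf_graph_def by blast
  then obtain u v where f: "f = {u, v}" by blast
  then have uv: "adj T u v" using h by simp
  consider "x \<in> half_tree T v u" | "x \<in> half_tree T u v" using half_Un[OF uv h(2)] by blast
  then show "A \<in> ?R"
  proof cases
    case 1 then show ?thesis using Cyl_half_ends[OF uv] h f uv by blast
  next
    case 2
    have "A = half_ends T v u" using Cyl_half_ends[OF adj_sym[OF uv] 2] h f by (simp add: insert_commute)
    then show ?thesis using adj_sym[OF uv] by blast
  qed
next
  fix A assume "A \<in> ?R"
  then obtain u v where h: "A = half_ends T u v" "adj T u v" by blast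
  then have "A = Cyl T u {u, v}" using Cyl_half_ends[OF h(2) half_self[OF adj_sym[OF h(2)]]] by simp
  then show "A \<in> ?L" using h(2) adj_verts[OF h(2)] by blast
qed

lemma half_ends_Pow: "{half_ends T u v | u v. adj T u v} \<subseteq> Pow (ends T)"
  using half_ends_ends by blast

lemma sets_end_borel: "sets (end_borel T) = sigma_sets (ends T) {half_ends T u v | u v. adj T u v}"
  unfolding end_borel_def Cyl_set using half_ends_Pow by (rule sets_measure_of)

lemma space_end_borel: "space (end_borel T) = ends T"
  unfolding end_borel_def Cyl_set using half_ends_Pow by (rule space_measure_of)

lemma half_ends_sets: "adj T u v \<Longrightarrow> half_ends T u v \<in> sets (end_borel T)"
  unfolding sets_end_borel by (rule sigma_sets.Basic) blast

lemma end_borel_sub: "A \<in> sets (end_borel T) \<Longrightarrow> A \<subseteq> ends T"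
  using sets.sets_into_space[of A "end_borel T"] space_end_borel by simp

lemma measurable_to_ends:
  assumes "f \<in> space M \<rightarrow> ends T" "\<And>u v. adj T u v \<Longrightarrow> f -` half_ends T u v \<inter> space M \<in> sets M"
  shows "f \<in> measurable M (end_borel T)"
  by (rule measurable_sigma_sets[OF sets_end_borel half_ends_Pow assms(1)]) (use assms(2) in blast)

lemma half_ends_nested:
  assumes uv: "adj T u v" "x \<in> half_tree T v u" and ac: "adj T a c" "x \<in> half_tree T c a" and ne: "half_ends T u v \<inter> half_ends T a c \<noteq> {}"
  shows "half_ends T u v \<subseteq> half_ends T a c \<or> half_ends T a c \<subseteq> half_ends T u v"
proof -
  obtain \<xi> where \<xi>: "\<xi> \<in> half_ends T u v" "\<xi> \<in> half_ends T a c" using ne by blast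
  obtain r where r: "r \<in> \<xi>" "r 0 = x" using ray_from_ex[OF half_ends_ends[OF \<xi>(1)] half_V[OF uv(2)]] by blast
  note rr = end_rays[OF half_ends_ends[OF \<xi>(1)] r(1)]
  obtain n where n: "r n = u" "r (Suc n) = v" using half_ends_on_ray[OF uv \<xi>(1) r] .
  obtain m where m: "r m = a" "r (Suc m) = c" using half_ends_on_ray[OF ac \<xi>(2) r] .
  have "half_tree T u v \<subseteq> half_tree T a c \<or> half_tree T a c \<subseteq> half_tree T u v"
    using ray_half_mono[OF rr, of m n] ray_half_mono[OF rr, of n m] n m nat_le_linear by metis
  then show ?thesis using half_ends_mono[of u v a c] half_ends_mono[of a c u v] by auto
qed

definition cyl_from :: "'t \<Rightarrow> 't tree_end set set" where
  "cyl_from x = {half_ends T u v | u v. adj T u v \<and> x \<in> half_tree T v u}"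

text \<open>The cylinder of an edge that points towards \<open>x\<close> is the complement of the cylinder of the
  reversed edge. The cylinders of edges that point away from \<open>x\<close> are pairwise nested or disjoint,
  so they form a generator that is stable under intersections.\<close>

lemma sets_end_borel_from: assumes x: "x \<in> V"
  shows "sets (end_borel T) = sigma_sets (ends T) (insert (ends T) (insert {} (cyl_from x)))"
  unfolding sets_end_borel
proof (rule sigma_sets_eqI)
  fix A assume "A \<in> {half_ends T u v | u v. adj T u v}"
  then obtain u v where A: "A = half_ends T u v" "adj T u v" by blast
  show "A \<in> sigma_sets (ends T) (insert (ends T) (insert {} (cyl_from x)))"
  proof (cases "x \<in> half_tree T v u")
    case True then show ?thesis using A unfolding cyl_from_def by blast
  next
    case False
    then have "x \<in> half_tree T u v" using half_not[OF adj_sym[OF A(2)] x] by blast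
    then have "half_ends T v u \<in> cyl_from x" unfolding cyl_from_def using adj_sym[OF A(2)] by blast
    moreover have "A = ends T - half_ends T v u" using A half_ends_not[OF A(2)] half_ends_ends by blast
    ultimately show ?thesis by (simp add: sigma_sets.Compl sigma_sets.Basic)
  qed
next
  fix A assume "A \<in> insert (ends T) (insert {} (cyl_from x))"
  then show "A \<in> sigma_sets (ends T) {half_ends T u v | u v. adj T u v}"
    unfolding cyl_from_def by (auto intro: sigma_sets_top sigma_sets.Empty sigma_sets.Basic)
qed

lemma ends_split: assumes x: "x \<in> V" shows "ends T = (\<Union>w\<in>nbhd T x. half_ends T x w)"
proof (intro equalityI subsetI)
  fix \<xi> assume "\<xi> \<in> ends T"
  then obtain w where "adj T x w" "\<xi> \<in> half_ends T x w" using branch_ex1[OF _ x] by blast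
  then show "\<xi> \<in> (\<Union>w\<in>nbhd T x. half_ends T x w)" by (auto simp: nbhd_def)
qed (use half_ends_ends in blast)

lemma half_ends_split: assumes uv: "adj T u v" shows "half_ends T u v = (\<Union>w\<in>nbhd T v - {u}. half_ends T v w)"
proof (intro equalityI subsetI)
  fix \<xi> assume \<xi>: "\<xi> \<in> half_ends T u v"
  obtain w where w: "adj T v w" "\<xi> \<in> half_ends T v w" using branch_ex1[OF half_ends_ends[OF \<xi>] adj_verts(2)[OF uv]] by blast
  have "w \<noteq> u" using w(2) \<xi> half_ends_not[OF uv half_ends_ends[OF \<xi>]] by blast
  then show "\<xi> \<in> (\<Union>w\<in>nbhd T v - {u}. half_ends T v w)" using w by (auto simp: nbhd_def)
next
  fix \<xi> assume "\<xi> \<in> (\<Union>w\<in>nbhd T v - {u}. half_ends T v w)"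
  then obtain w where w: "adj T v w" "w \<noteq> u" "\<xi> \<in> half_ends T v w" by (auto simp: nbhd_def)
  then show "\<xi> \<in> half_ends T u v" using half_ends_mono[OF half_succ(1)[OF uv w(1,2)]] by blast
qed

lemma half_ends_disjoint: "disjoint_family_on (half_ends T x) (nbhd T x)"
  unfolding disjoint_family_on_def nbhd_def using half_ends_branch_unique by blast

definition ray_vertex :: "'t \<Rightarrow> nat \<Rightarrow> 't tree_end \<Rightarrow> 't" where
  "ray_vertex x n \<xi> = (THE r. r \<in> \<xi> \<and> r 0 = x) n"

lemma ray_vertex_eq: assumes "\<xi> \<in> ends T" "r \<in> \<xi>" "r 0 = x" shows "ray_vertex x n \<xi> = r n"
proof -
  have "(THE r. r \<in> \<xi> \<and> r 0 = x) = r" by (rule the_equality) (use assms ray_unique[OF assms(1)] in auto)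
  then show ?thesis by (simp add: ray_vertex_def)
qed

text \<open>Prescribing the vertex number \<open>n + 1\<close> of the ray from \<open>x\<close> prescribes the cylinder of the
  edge through which the ray enters that vertex.\<close>

lemma ray_vertex_fiber:
  assumes x: "x \<in> V" and \<xi>: "\<xi> \<in> ends T"
  obtains u where "adj T u (ray_vertex x (Suc n) \<xi>)" "x \<in> half_tree T (ray_vertex x (Suc n) \<xi>) u"
    "{\<eta> \<in> ends T. ray_vertex x (Suc n) \<eta> = ray_vertex x (Suc n) \<xi>} = half_ends T u (ray_vertex x (Suc n) \<xi>)"
    "d x (ray_vertex x (Suc n) \<xi>) = Suc n"
proof -
  obtain r where r: "r \<in> \<xi>" "r 0 = x" "r \<in> rays T" using ray_from[OF \<xi> x] by blast
  have v: "ray_vertex x (Suc n) \<xi> = r (Suc n)" by (rule ray_vertex_eq[OF \<xi> r(1,2)])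
  have a: "adj T (r n) (r (Suc n))" "x \<in> half_tree T (r (Suc n)) (r n)" using rays_adj[OF r(3)] ray_in_half'[OF r(3), of 0 n] r(2) by auto
  have "{\<eta> \<in> ends T. ray_vertex x (Suc n) \<eta> = r (Suc n)} = half_ends T (r n) (r (Suc n))"
  proof (intro equalityI subsetI)
    fix \<eta> assume "\<eta> \<in> {\<eta> \<in> ends T. ray_vertex x (Suc n) \<eta> = r (Suc n)}"
    then have \<eta>: "\<eta> \<in> ends T" "ray_vertex x (Suc n) \<eta> = r (Suc n)" by auto
    obtain s where s: "s \<in> \<eta>" "s 0 = x" "s \<in> rays T" using ray_from[OF \<eta>(1) x] by blast
    have sn: "s (Suc n) = r (Suc n)" using ray_vertex_eq[OF \<eta>(1) s(1,2)] \<eta>(2) by simp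
    have "s 0 \<in> half_tree T (s (Suc n)) (s n)" using ray_in_half'[OF s(3), of 0 n] by simp
    then have "s n = r n" using half_branch_unique[of "r (Suc n)" "s n" "r n" x]
        adj_sym[OF rays_adj[OF s(3), of n]] adj_sym[OF a(1)] a(2) s(2) sn by simp
    then show "\<eta> \<in> half_ends T (r n) (r (Suc n))" using half_ends_ray[OF \<eta>(1) s(1), of n] sn by simp
  next
    fix \<eta> assume \<eta>: "\<eta> \<in> half_ends T (r n) (r (Suc n))"
    note \<eta>e = half_ends_ends[OF \<eta>]
    obtain s where s: "s \<in> \<eta>" "s 0 = x" "s \<in> rays T" using ray_from[OF \<eta>e x] by blast
    obtain m where m: "s m = r n" "s (Suc m) = r (Suc n)" using half_ends_on_ray[OF a \<eta> s(1,2)] .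
    have "m = n" using ray_dist[OF s(3), of 0 m] ray_dist[OF r(3), of 0 n] m(1) s(2) r(2) by simp
    then have "ray_vertex x (Suc n) \<eta> = r (Suc n)" using ray_vertex_eq[OF \<eta>e s(1,2)] m by simp
    then show "\<eta> \<in> {\<eta> \<in> ends T. ray_vertex x (Suc n) \<eta> = r (Suc n)}" using \<eta>e by simp
  qed
  then show ?thesis using that[of "r n"] a v ray_dist[OF r(3), of 0 "Suc n"] r(2) by simp
qed

lemma ray_vertex_determines:
  assumes x: "x \<in> V" and \<xi>: "\<xi> \<in> ends T" "\<eta> \<in> ends T" and "ray_vertex x n \<xi> = ray_vertex x n \<eta>" "m \<le> n"
  shows "ray_vertex x m \<xi> = ray_vertex x m \<eta>"
  using assms(5,4)
proof (induction n rule: dec_induct)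
  case (step n)
  obtain r where r: "r \<in> \<xi>" "r 0 = x" "r \<in> rays T" using ray_from[OF \<xi>(1) x] by blast
  obtain s where s: "s \<in> \<eta>" "s 0 = x" "s \<in> rays T" using ray_from[OF \<xi>(2) x] by blast
  have e: "r (Suc n) = s (Suc n)" using step(4) ray_vertex_eq[OF \<xi>(1) r(1,2)] ray_vertex_eq[OF \<xi>(2) s(1,2)] by simp
  have "s n = r n" using half_branch_unique[of "r (Suc n)" "s n" "r n" x]
      adj_sym[OF rays_adj[OF s(3), of n]] adj_sym[OF rays_adj[OF r(3), of n]] ray_in_half'[OF s(3), of 0 n]
      ray_in_half'[OF r(3), of 0 n] r(2) s(2) e by simp
  then show ?case using step.IH ray_vertex_eq[OF \<xi>(1) r(1,2)] ray_vertex_eq[OF \<xi>(2) s(1,2)] by simp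
qed

end

context locally_finite_tree
begin

text \<open>The tree has countably many edges.\<close>

lemma open_sets:
  assumes "U \<subseteq> ends T" "\<And>\<xi>. \<xi> \<in> U \<Longrightarrow> \<exists>u v. adj T u v \<and> \<xi> \<in> half_ends T u v \<and> half_ends T u v \<subseteq> U"
  shows "U \<in> sets (end_borel T)"
proof -
  let ?S = "{(u, v) \<in> V \<times> V. adj T u v \<and> half_ends T u v \<subseteq> U}"
  have "countable (V \<times> V)" using V_countable by simp
  then have c: "countable ?S" by (rule countable_subset[rotated]) blast
  have "U = (\<Union>e\<in>?S. half_ends T (fst e) (snd e))"
  proof (intro equalityI subsetI)
    fix \<xi> assume "\<xi> \<in> U"
    then obtain u v where "adj T u v" "\<xi> \<in> half_ends T u v" "half_ends T u v \<subseteq> U" using assms(2) by blast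
    then show "\<xi> \<in> (\<Union>e\<in>?S. half_ends T (fst e) (snd e))" using adj_verts(1,2)[of u v] by (intro UN_I[of "(u, v)"]) auto
  qed auto
  moreover have "(\<Union>e\<in>?S. half_ends T (fst e) (snd e)) \<in> sets (end_borel T)"
    by (rule sets.countable_UN'[OF c]) (use half_ends_sets in auto)
  ultimately show ?thesis by simp
qed

lemma measure_eq_from:
  assumes x: "x \<in> V" and M: "finite_measure M" "sets M = sets (end_borel T)" and N: "finite_measure N" "sets N = sets (end_borel T)"
    and eq: "\<And>u v. adj T u v \<Longrightarrow> x \<in> half_tree T v u \<Longrightarrow> measure M (half_ends T u v) = measure N (half_ends T u v)"
  shows "M = N"
proof -
  interpret M: finite_measure M by fact
  interpret N: finite_measure N by fact
  have s: "half_ends T x w \<in> sets (end_borel T)" if "w \<in> nbhd T x" for w using that half_ends_sets by (simp add: nbhd_def)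
  have "measure M (ends T) = (\<Sum>w\<in>nbhd T x. measure M (half_ends T x w))"
    unfolding ends_split[OF x] by (rule M.finite_measure_finite_Union[OF fin_nbhd[OF x] _ half_ends_disjoint]) (use s M in auto)
  also have "\<dots> = (\<Sum>w\<in>nbhd T x. measure N (half_ends T x w))"
  proof (rule sum.cong[OF refl])
    fix w assume "w \<in> nbhd T x"
    then have w: "adj T x w" by (simp add: nbhd_def)
    show "measure M (half_ends T x w) = measure N (half_ends T x w)" by (rule eq[OF w half_self[OF adj_sym[OF w]]])
  qed
  also have "\<dots> = measure N (ends T)"
    unfolding ends_split[OF x] by (rule N.finite_measure_finite_Union[OF fin_nbhd[OF x] _ half_ends_disjoint, symmetric]) (use s N in auto)
  finally have top: "measure M (ends T) = measure N (ends T)" .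
  let ?E = "insert (ends T) (insert {} (cyl_from x))"
  show ?thesis
  proof (rule measure_eqI_generator_eq[of ?E "ends T" M N "\<lambda>_. ends T"])
    have sub: "A \<subseteq> ends T" if "A \<in> ?E" for A using that half_ends_ends unfolding cyl_from_def by auto
    show "Int_stable ?E"
    proof (rule Int_stableI)
      fix A B assume A: "A \<in> ?E" and B: "B \<in> ?E"
      show "A \<inter> B \<in> ?E"
      proof (cases "A \<inter> B = {} \<or> A = ends T \<or> B = ends T")
        case True
        then show ?thesis using A B sub[OF A] sub[OF B] by (metis Int_absorb1 Int_absorb2 insertCI)
      next
        case False
        then have "A \<in> cyl_from x" "B \<in> cyl_from x" using A B by auto
        then obtain u v a c where "A = half_ends T u v" "adj T u v" "x \<in> half_tree T v u" "B = half_ends T a c" "adj T a c" "x \<in> half_tree T c a"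
          unfolding cyl_from_def by blast
        then have "A \<subseteq> B \<or> B \<subseteq> A" using half_ends_nested[of u v x a c] False by simp
        then show ?thesis using A B by (metis Int_absorb1 Int_absorb2)
      qed
    qed
    show "?E \<subseteq> Pow (ends T)" using sub by blast
    show "sets M = sigma_sets (ends T) ?E" "sets N = sigma_sets (ends T) ?E" using M N sets_end_borel_from[OF x] by auto
    show "emeasure M A = emeasure N A" if "A \<in> ?E" for A
      using that top eq unfolding cyl_from_def M.emeasure_eq_measure N.emeasure_eq_measure by auto
  qed (auto simp: M.emeasure_eq_measure)
qed

text \<open>A substitute for a density theorem. The set \<open>E\<close> is approximated by a finite disjoint union
  of cylinders of equal depth; if \<open>E\<close> missed at least the proportion \<open>k\<close> of every cylinder, it
  would miss as much of the union.\<close>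

lemma cylinder_density:
  assumes x: "x \<in> V" and M: "finite_measure M" "sets M = sets (end_borel T)"
    and E: "E \<in> sets M" "measure M E > 0" and k: "(k::real) > 0"
  obtains u v where "adj T u v" "x \<in> half_tree T v u" "measure M (half_ends T u v - E) < k * measure M (half_ends T u v)"
proof (rule ccontr)
  note thesisI = that
  assume "\<not> thesis"
  then have c: "measure M (half_ends T u v - E) \<ge> k * measure M (half_ends T u v)" if "adj T u v" "x \<in> half_tree T v u" for u v
    using thesisI[OF that] by linarith
  interpret finite_measure M by fact
  define \<A> where "\<A> = {{\<xi> \<in> ends T. ray_vertex x n \<xi> \<in> S} | n S. True}"
  have level: "\<exists>S'. {\<xi> \<in> ends T. ray_vertex x n \<xi> \<in> S} = {\<xi> \<in> ends T. ray_vertex x m \<xi> \<in> S'}" if "n \<le> m" for n m S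
  proof (intro exI equalityI subsetI)
    fix \<xi> assume "\<xi> \<in> {\<xi> \<in> ends T. ray_vertex x m \<xi> \<in> {ray_vertex x m \<xi> | \<xi>. \<xi> \<in> ends T \<and> ray_vertex x n \<xi> \<in> S}}"
    then obtain \<eta> where "\<xi> \<in> ends T" "\<eta> \<in> ends T" "ray_vertex x m \<xi> = ray_vertex x m \<eta>" "ray_vertex x n \<eta> \<in> S" by blast
    then show "\<xi> \<in> {\<xi> \<in> ends T. ray_vertex x n \<xi> \<in> S}" using ray_vertex_determines[OF x, of \<xi> \<eta> m n] that by simp
  qed blast
  have alg: "algebra (ends T) \<A>"
    unfolding algebra_iff_Un
  proof (intro conjI ballI)
    show "\<A> \<subseteq> Pow (ends T)" unfolding \<A>_def by blast
    show "{} \<in> \<A>" unfolding \<A>_def by (rule CollectI, rule exI[of _ 0], rule exI[of _ "{}"]) simp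
    fix A assume "A \<in> \<A>"
    then obtain n S where A: "A = {\<xi> \<in> ends T. ray_vertex x n \<xi> \<in> S}" unfolding \<A>_def by blast
    have "ends T - A = {\<xi> \<in> ends T. ray_vertex x n \<xi> \<in> - S}" unfolding A by blast
    then show "ends T - A \<in> \<A>" unfolding \<A>_def by blast
    fix B assume "B \<in> \<A>"
    then obtain m S' where B: "B = {\<xi> \<in> ends T. ray_vertex x m \<xi> \<in> S'}" unfolding \<A>_def by blast
    obtain P where P: "A = {\<xi> \<in> ends T. ray_vertex x (max n m) \<xi> \<in> P}" using level[of n "max n m" S] A by auto
    obtain Q where Q: "B = {\<xi> \<in> ends T. ray_vertex x (max n m) \<xi> \<in> Q}" using level[of m "max n m" S'] B by auto
    have "A \<union> B = {\<xi> \<in> ends T. ray_vertex x (max n m) \<xi> \<in> P \<union> Q}" unfolding P Q by blast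
    then show "A \<union> B \<in> \<A>" unfolding \<A>_def by blast
  qed
  have decomp: "\<exists>F. finite F \<and> F \<subseteq> {(u, v). adj T u v \<and> x \<in> half_tree T v u} \<and>
      A = (\<Union>e\<in>F. half_ends T (fst e) (snd e)) \<and> disjoint_family_on (\<lambda>e. half_ends T (fst e) (snd e)) F" if "A \<in> \<A>" for A
  proof -
    obtain n S0 where "A = {\<xi> \<in> ends T. ray_vertex x n \<xi> \<in> S0}" using \<open>A \<in> \<A>\<close> unfolding \<A>_def by blast
    then obtain S where A: "A = {\<xi> \<in> ends T. ray_vertex x (Suc n) \<xi> \<in> S}" using level[of n "Suc n" S0] by auto
    define R where "R v u \<longleftrightarrow> adj T u v \<and> x \<in> half_tree T v u \<and> {\<eta> \<in> ends T. ray_vertex x (Suc n) \<eta> = v} = half_ends T u v \<and> d x v = Suc n" for v u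
    have Rex: "\<exists>u. R v u" if "v \<in> ray_vertex x (Suc n) ` A" for v
    proof -
      from that obtain \<xi> where \<xi>: "\<xi> \<in> ends T" "v = ray_vertex x (Suc n) \<xi>" unfolding A by blast
      obtain u where u: "adj T u v" "x \<in> half_tree T v u" "{\<eta> \<in> ends T. ray_vertex x (Suc n) \<eta> = v} = half_ends T u v" "d x v = Suc n"
        unfolding \<xi>(2) by (rule ray_vertex_fiber[OF x \<xi>(1), of n])
      show ?thesis unfolding R_def by (intro exI[of _ u] conjI u)
    qed
    define q where "q v = (SOME u. R v u)" for v
    have q: "\<And>v. v \<in> ray_vertex x (Suc n) ` A \<Longrightarrow> adj T (q v) v \<and> x \<in> half_tree T v (q v) \<and>
        {\<eta> \<in> ends T. ray_vertex x (Suc n) \<eta> = v} = half_ends T (q v) v \<and> d x v = Suc n"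
      unfolding q_def R_def[symmetric] by (rule someI_ex[OF Rex])
    define F where "F = (\<lambda>v. (q v, v)) ` (ray_vertex x (Suc n) ` A)"
    have "ray_vertex x (Suc n) ` A \<subseteq> {z \<in> V. d x z \<le> Suc n}"
    proof
      fix v assume "v \<in> ray_vertex x (Suc n) ` A"
      then have "adj T (q v) v" "d x v = Suc n" using q by blast+
      then show "v \<in> {z \<in> V. d x z \<le> Suc n}" using adj_verts(2) by simp
    qed
    then have "finite (ray_vertex x (Suc n) ` A)" by (rule finite_subset) (rule ball_finite[OF x])
    then have "finite F" unfolding F_def by (rule finite_imageI)
    moreover have "F \<subseteq> {(u, v). adj T u v \<and> x \<in> half_tree T v u}" unfolding F_def using q by auto
    moreover have "A = (\<Union>e\<in>F. half_ends T (fst e) (snd e))"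
    proof (intro equalityI subsetI)
      fix \<xi> assume \<xi>: "\<xi> \<in> A"
      then have "\<xi> \<in> half_ends T (q (ray_vertex x (Suc n) \<xi>)) (ray_vertex x (Suc n) \<xi>)" using q[of "ray_vertex x (Suc n) \<xi>"] A by blast
      then show "\<xi> \<in> (\<Union>e\<in>F. half_ends T (fst e) (snd e))" unfolding F_def using \<xi> by auto
    next
      fix \<xi> assume "\<xi> \<in> (\<Union>e\<in>F. half_ends T (fst e) (snd e))"
      then obtain v where v: "v \<in> ray_vertex x (Suc n) ` A" "\<xi> \<in> half_ends T (q v) v" unfolding F_def by auto
      then have "\<xi> \<in> ends T" "ray_vertex x (Suc n) \<xi> = v" using q[OF v(1)] by blast+
      then show "\<xi> \<in> A" using v(1) unfolding A by auto
    qed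
    moreover have "disjoint_family_on (\<lambda>e. half_ends T (fst e) (snd e)) F"
      unfolding disjoint_family_on_def
    proof (intro ballI impI)
      fix e f assume "e \<in> F" "f \<in> F" "e \<noteq> f"
      obtain v where v: "v \<in> ray_vertex x (Suc n) ` A" "e = (q v, v)" using \<open>e \<in> F\<close> unfolding F_def by (rule imageE)
      obtain w where w: "w \<in> ray_vertex x (Suc n) ` A" "f = (q w, w)" using \<open>f \<in> F\<close> unfolding F_def by (rule imageE)
      have h: "v \<in> ray_vertex x (Suc n) ` A" "w \<in> ray_vertex x (Suc n) ` A" "e = (q v, v)" "f = (q w, w)" "v \<noteq> w"
        using v w \<open>e \<noteq> f\<close> by auto
      show "half_ends T (fst e) (snd e) \<inter> half_ends T (fst f) (snd f) = {}"
        using q[OF h(1)] q[OF h(2)] h(3-5) by auto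
    qed
    ultimately show ?thesis by blast
  qed
  have sets: "sets M = sigma_sets (ends T) \<A>"
    unfolding M(2) sets_end_borel_from[OF x]
  proof (rule sigma_sets_eqI)
    fix A assume A: "A \<in> insert (ends T) (insert {} (cyl_from x))"
    show "A \<in> sigma_sets (ends T) \<A>"
    proof (cases "A \<in> cyl_from x")
      case False then show ?thesis using A by (auto intro: sigma_sets_top sigma_sets.Empty)
    next
      case True
      then obtain u v where uv: "A = half_ends T u v" "adj T u v" "x \<in> half_tree T v u" unfolding cyl_from_def by blast
      have "A = {\<xi> \<in> ends T. ray_vertex x (Suc (d x u)) \<xi> = v}"
      proof (intro equalityI subsetI)
        fix \<xi> assume b: "\<xi> \<in> A"
        then have b': "\<xi> \<in> half_ends T u v" using uv by simp
        obtain r where r: "r \<in> \<xi>" "r 0 = x" "r \<in> rays T" using ray_from[OF half_ends_ends[OF b'] x] by blast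
        obtain n where n: "r n = u" "r (Suc n) = v" using half_ends_on_ray[OF uv(2,3) b' r(1,2)] .
        have "d x u = n" using ray_dist[OF r(3), of 0 n] n r(2) by simp
        then show "\<xi> \<in> {\<xi> \<in> ends T. ray_vertex x (Suc (d x u)) \<xi> = v}"
          using n ray_vertex_eq[OF half_ends_ends[OF b'] r(1,2)] half_ends_ends[OF b'] by simp
      next
        fix \<xi> assume b: "\<xi> \<in> {\<xi> \<in> ends T. ray_vertex x (Suc (d x u)) \<xi> = v}"
        then have \<xi>: "\<xi> \<in> ends T" "ray_vertex x (Suc (d x u)) \<xi> = v" by auto
        obtain a where a: "adj T a v" "x \<in> half_tree T v a" "{\<eta> \<in> ends T. ray_vertex x (Suc (d x u)) \<eta> = v} = half_ends T a v"
          unfolding \<xi>(2)[symmetric] by (rule ray_vertex_fiber[OF x \<xi>(1), of "d x u"])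
        have "a = u" using half_branch_unique[OF adj_sym[OF a(1)] adj_sym[OF uv(2)] a(2) uv(3)] .
        then show "\<xi> \<in> A" using a(3) b uv(1) by blast
      qed
      then have "A = {\<xi> \<in> ends T. ray_vertex x (Suc (d x u)) \<xi> \<in> {v}}" by simp
      then show ?thesis unfolding \<A>_def by (intro sigma_sets.Basic) blast
    qed
  next
    fix A assume "A \<in> \<A>"
    then obtain F where F: "finite F" "F \<subseteq> {(u, v). adj T u v \<and> x \<in> half_tree T v u}" "A = (\<Union>e\<in>F. half_ends T (fst e) (snd e))"
      using decomp by blast
    have "A \<in> sets (end_borel T)" unfolding F(3) by (rule sets.finite_UN[OF F(1)]) (use F(2) half_ends_sets in auto)
    then show "A \<in> sigma_sets (ends T) (insert (ends T) (insert {} (cyl_from x)))" using sets_end_borel_from[OF x] by simp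
  qed
  \<comment> \<open>the solution of \<open>k * (measure M E - e) = e\<close>\<close>
  define e where "e = k * measure M E / (1 + k)"
  have "e > 0" unfolding e_def using E k by simp
  then obtain U where U: "U \<in> \<A>" "measure M ((E - U) \<union> (U - E)) < e"
    using measure_algebra_approx[OF M(1) alg sets E(1)] by blast
  have UM: "U \<in> sets M" using U(1) sets by (simp add: sigma_sets.Basic)
  obtain F where F: "finite F" "F \<subseteq> {(u, v). adj T u v \<and> x \<in> half_tree T v u}" "U = (\<Union>e\<in>F. half_ends T (fst e) (snd e))"
    "disjoint_family_on (\<lambda>e. half_ends T (fst e) (snd e)) F" using decomp[OF U(1)] by blast
  have bM: "half_ends T (fst e) (snd e) \<in> sets M" if "e \<in> F" for e using F(2) that half_ends_sets M(2) by auto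
  have "k * measure M U = (\<Sum>e\<in>F. k * measure M (half_ends T (fst e) (snd e)))"
    unfolding F(3) sum_distrib_left[symmetric]
    by (subst finite_measure_finite_Union[OF F(1) _ F(4)]) (use bM in auto)
  also have "\<dots> \<le> (\<Sum>e\<in>F. measure M (half_ends T (fst e) (snd e) - E))"
    by (rule sum_mono) (use c F(2) in auto)
  also have "\<dots> = measure M (\<Union>e\<in>F. half_ends T (fst e) (snd e) - E)"
  proof (rule finite_measure_finite_Union[symmetric, OF F(1)])
    show "(\<lambda>e. half_ends T (fst e) (snd e) - E) ` F \<subseteq> sets M" using bM E by blast
    show "disjoint_family_on (\<lambda>e. half_ends T (fst e) (snd e) - E) F"
      using F(4) unfolding disjoint_family_on_def by blast
  qed
  also have "(\<Union>e\<in>F. half_ends T (fst e) (snd e) - E) = U - E" unfolding F(3) by blast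
  also have "measure M (U - E) \<le> measure M ((E - U) \<union> (U - E))" by (rule finite_measure_mono) (use UM E in auto)
  finally have 1: "k * measure M U < e" using U(2) by simp
  have "measure M E \<le> measure M (U \<union> ((E - U) \<union> (U - E)))" by (rule finite_measure_mono) (use UM E in auto)
  also have "\<dots> \<le> measure M U + measure M ((E - U) \<union> (U - E))" by (rule measure_Un_le) (use UM E in auto)
  finally have "measure M E < measure M U + e" using U(2) by simp
  then have "k * measure M E < k * measure M U + k * e" using k by (simp flip: distrib_left)
  then have "k * measure M E < e + k * e" using 1 by simp
  also have "e + k * e = e * (1 + k)" by (simp add: algebra_simps)
  also have "\<dots> = k * measure M E" unfolding e_def using k by simp
  finally show False by simp
qed

end

section \<open>Measurability of end maps\<close>

context tree_iso
begin

lemma end_map_measurable: "end_map F \<in> measurable (end_borel T1) (end_borel T2)"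
proof (rule B.measurable_to_ends)
  show "end_map F \<in> space (end_borel T1) \<rightarrow> ends T2" using iso_end by (simp add: A.space_end_borel)
  fix u v assume uv: "adj T2 u v"
  define a c where "a = inv_iso u" and "c = inv_iso v"
  have ac: "a \<in> A.V" "c \<in> A.V" "F a = u" "F c = v"
    using B.adj_verts[OF uv] unfolding a_def c_def by (simp_all add: inv_V inv_right)
  have "adj T1 a c" using uv iso_adj[OF ac(1,2)] ac(3,4) by simp
  then have "half_ends T1 a c \<in> sets (end_borel T1)" by (rule A.half_ends_sets)
  moreover have "end_map F -` half_ends T2 u v \<inter> space (end_borel T1) = half_ends T1 a c"
    using iso_half_ends[OF _ ac(1,2)] ac(3,4) A.half_ends_ends by (auto simp: A.space_end_borel)
  ultimately show "end_map F -` half_ends T2 u v \<inter> space (end_borel T1) \<in> sets (end_borel T1)" by simp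
qed

lemma end_map_vimage: assumes "A \<subseteq> ends T1" shows "end_map F -` (end_map F ` A) \<inter> ends T1 = A"
proof -
  have inj: "inj_on (end_map F) (ends T1)" using end_map_bij by (rule bij_betw_imp_inj_on)
  have "\<eta> \<in> A" if "\<eta> \<in> ends T1" "end_map F \<eta> = end_map F \<xi>" "\<xi> \<in> A" for \<eta> \<xi>
    using inj_onD[OF inj that(2,1)] that(3) assms by blast
  then show ?thesis using assms by blast
qed

end

context tree_iso
begin

lemma end_map_image_inv: assumes "A \<subseteq> ends T1" shows "end_map F ` A = end_map inv_iso -` A \<inter> ends T2"
proof (intro equalityI subsetI)
  fix \<eta> assume "\<eta> \<in> end_map F ` A"
  then show "\<eta> \<in> end_map inv_iso -` A \<inter> ends T2" using assms inv_end iso_end by auto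
next
  fix \<eta> assume "\<eta> \<in> end_map inv_iso -` A \<inter> ends T2"
  then show "\<eta> \<in> end_map F ` A" using inv_end'[of \<eta>] by (metis IntD1 IntD2 imageI vimageD)
qed

lemma end_map_sets: assumes "A \<in> sets (end_borel T1)" shows "end_map F ` A \<in> sets (end_borel T2)"
proof -
  interpret i: tree_iso T2 T1 inv_iso by (rule inv_tree_iso)
  show ?thesis
    using measurable_sets[OF i.end_map_measurable assms] end_map_image_inv[OF A.end_borel_sub[OF assms]]
    by (simp add: B.space_end_borel)
qed

lemma iso_nbhd: assumes v: "v \<in> A.V" and u: "u \<in> A.V"
  shows "bij_betw F (nbhd T1 v - {u}) (nbhd T2 (F v) - F ` {u})"
proof (rule bij_betw_imageI)
  have sub: "nbhd T1 v \<subseteq> A.V" using A.adj_verts by (auto simp: nbhd_def)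
  then show "inj_on F (nbhd T1 v - {u})" using iso_inj by (meson Diff_subset inj_on_subset subset_trans)
  have "F ` nbhd T1 v = nbhd T2 (F v)"
  proof (intro equalityI subsetI)
    fix w assume "w \<in> nbhd T2 (F v)"
    then have w: "adj T2 (F v) w" by (simp add: nbhd_def)
    then have wV: "w \<in> B.V" using B.adj_verts by blast
    have "adj T1 v (inv_iso w)" using iso_adj[OF v inv_V[OF wV]] w inv_right[OF wV] by simp
    then show "w \<in> F ` nbhd T1 v" using inv_right[OF wV] by (metis imageI nbhd_def mem_Collect_eq)
  qed (use iso_adj' in \<open>auto simp: nbhd_def\<close>)
  then show "F ` (nbhd T1 v - {u}) = nbhd T2 (F v) - F ` {u}"
    using inj_on_image_set_diff[OF iso_inj, of "nbhd T1 v" "{u}"] sub u by (auto simp: subset_iff)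
qed

end

section \<open>Perron--Frobenius uniqueness for edge weights\<close>

context univ_cover
begin

text \<open>There are only finitely many orbits of oriented edges.\<close>

lemma finite_values:
  fixes h :: "'t \<Rightarrow> 't \<Rightarrow> 'c"
  assumes inv: "\<And>a b a' b'. adj T a b \<Longrightarrow> adj T a' b' \<Longrightarrow> p a = p a' \<Longrightarrow> p b = p b' \<Longrightarrow> h a b = h a' b'"
  shows "finite {h a b | a b. adj T a b}"
proof -
  define k where "k = (\<lambda>(v, w). SOME t. \<exists>a b. adj T a b \<and> p a = v \<and> p b = w \<and> h a b = t)"
  have "{h a b | a b. adj T a b} \<subseteq> k ` (verts G \<times> verts G)"
  proof
    fix t assume "t \<in> {h a b | a b. adj T a b}"
    then obtain a b where ab: "t = h a b" "adj T a b" by blast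
    have "\<exists>a' b'. adj T a' b' \<and> p a' = p a \<and> p b' = p b \<and> h a' b' = k (p a, p b)"
      unfolding k_def prod.case by (rule someI_ex) (use ab in blast)
    then have "k (p a, p b) = t" using inv ab by metis
    then show "t \<in> k ` (verts G \<times> verts G)" using p_V adj_verts[OF ab(2)] by (metis SigmaI imageI)
  qed
  then show ?thesis by (rule finite_subset) (use finG in simp)
qed

lemma edge_ex: obtains u v where "adj T u v"
proof -
  obtain x where "x \<in> V" using V_nonempty by blast
  then show ?thesis using nbr_avoid2 that by blast
qed

text \<open>Take for \<open>k\<close> the least value of the ratio of \<open>h\<close> and \<open>h'\<close>. The two eigenvalue equations at
  an edge where it is attained compare the eigenvalues.\<close>

lemma perron_frobenius_compare:
  fixes h h' :: "'t \<Rightarrow> 't \<Rightarrow> real"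
  assumes inv: "\<And>a b a' b'. adj T a b \<Longrightarrow> adj T a' b' \<Longrightarrow> p a = p a' \<Longrightarrow> p b = p b' \<Longrightarrow> h a b = h a' b'"
    and inv': "\<And>a b a' b'. adj T a b \<Longrightarrow> adj T a' b' \<Longrightarrow> p a = p a' \<Longrightarrow> p b = p b' \<Longrightarrow> h' a b = h' a' b'"
    and pos: "\<And>a b. adj T a b \<Longrightarrow> h a b > 0" "\<And>a b. adj T a b \<Longrightarrow> h' a b > 0"
    and eig: "\<And>a b. adj T a b \<Longrightarrow> c * h a b = (\<Sum>w\<in>nbhd T b - {a}. h b w)"
      "\<And>a b. adj T a b \<Longrightarrow> c' * h' a b = (\<Sum>w\<in>nbhd T b - {a}. h' b w)"
  obtains k a b where "k > 0" "\<And>a b. adj T a b \<Longrightarrow> k * h' a b \<le> h a b" "adj T a b" "h a b = k * h' a b" "c' \<le> c"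
proof -
  let ?S = "{h a b / h' a b | a b. adj T a b}"
  define k where "k = Min ?S"
  have fin: "finite ?S" by (rule finite_values) (use inv inv' in metis)
  obtain u v where "adj T u v" by (rule edge_ex)
  then have "?S \<noteq> {}" by blast
  then have "k \<in> ?S" unfolding k_def by (rule Min_in[OF fin])
  then obtain a b where ab: "adj T a b" "k = h a b / h' a b" by blast
  have le: "k * h' s t \<le> h s t" if "adj T s t" for s t
  proof -
    have "k \<le> h s t / h' s t" unfolding k_def by (rule Min_le[OF fin]) (use that in blast)
    then show ?thesis using pos(2)[OF that] by (simp add: pos_le_divide_eq)
  qed
  have eq: "h a b = k * h' a b" using ab pos(2)[OF ab(1)] by simp
  have kpos: "k > 0" using ab pos by simp
  have "c' * h a b = k * (c' * h' a b)" using eq by simp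
  also have "\<dots> = (\<Sum>w\<in>nbhd T b - {a}. k * h' b w)" using eig(2)[OF ab(1)] by (simp add: sum_distrib_left)
  also have "\<dots> \<le> (\<Sum>w\<in>nbhd T b - {a}. h b w)" by (rule sum_mono) (use le in \<open>auto simp: nbhd_def\<close>)
  also have "\<dots> = c * h a b" using eig(1)[OF ab(1)] by simp
  finally have "c' \<le> c" using pos(1)[OF ab(1)] by simp
  then show ?thesis using that[of k a b] kpos le ab(1) eq by blast
qed

text \<open>Equal eigenvalues turn the comparison at an edge of least ratio into an equality of sums,
  so every continuation of the edge has least ratio as well; irreducibility spreads this to all
  edges.\<close>

lemma perron_frobenius_unique:
  fixes h h' :: "'t \<Rightarrow> 't \<Rightarrow> real"
  assumes inv: "\<And>a b a' b'. adj T a b \<Longrightarrow> adj T a' b' \<Longrightarrow> p a = p a' \<Longrightarrow> p b = p b' \<Longrightarrow> h a b = h a' b'"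
    and inv': "\<And>a b a' b'. adj T a b \<Longrightarrow> adj T a' b' \<Longrightarrow> p a = p a' \<Longrightarrow> p b = p b' \<Longrightarrow> h' a b = h' a' b'"
    and pos: "\<And>a b. adj T a b \<Longrightarrow> h a b > 0" "\<And>a b. adj T a b \<Longrightarrow> h' a b > 0"
    and eig: "\<And>a b. adj T a b \<Longrightarrow> c * h a b = (\<Sum>w\<in>nbhd T b - {a}. h b w)"
      "\<And>a b. adj T a b \<Longrightarrow> c' * h' a b = (\<Sum>w\<in>nbhd T b - {a}. h' b w)"
  obtains k where "c = c'" "k > 0" "\<And>a b. adj T a b \<Longrightarrow> h a b = k * h' a b"
proof -
  obtain k a b where k: "k > 0" "\<And>a b. adj T a b \<Longrightarrow> k * h' a b \<le> h a b" "adj T a b" "h a b = k * h' a b" "c' \<le> c"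
    by (rule perron_frobenius_compare[OF inv inv' pos eig]) blast+
  have "c \<le> c'"
    by (rule perron_frobenius_compare[OF inv' inv pos(2,1) eig(2,1)]) blast+
  then have c: "c = c'" using k(5) by simp
  have "h u v = k * h' u v" if uv: "adj T u v" for u v
  proof (rule invariant_closed_all[of "\<lambda>u v. h u v = k * h' u v", OF _ _ k(3,4) uv])
    show "h a' b' = k * h' a' b'" if "adj T a b" "adj T a' b'" "p a = p a'" "p b = p b'" "h a b = k * h' a b" for a b a' b'
      using that inv[OF that(1-4)] inv'[OF that(1-4)] by simp
    fix s t w assume st: "adj T s t" "adj T t w" "w \<noteq> s" "h s t = k * h' s t"
    have fin: "finite (nbhd T t - {s})" using fin_nbhd adj_verts[OF st(1)] by simp
    have "(\<Sum>w\<in>nbhd T t - {s}. h t w) = c * h s t" using eig(1)[OF st(1)] by simp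
    also have "\<dots> = k * (c' * h' s t)" using c st(4) by simp
    also have "\<dots> = (\<Sum>w\<in>nbhd T t - {s}. k * h' t w)" using eig(2)[OF st(1)] by (simp add: sum_distrib_left)
    finally have eq: "(\<Sum>w\<in>nbhd T t - {s}. h t w) = (\<Sum>w\<in>nbhd T t - {s}. k * h' t w)" .
    show "h t w = k * h' t w"
      using sum_mono_inv[OF eq[symmetric], of w] k(2) st fin by (simp add: nbhd_def)
  qed
  then show ?thesis using that[OF c k(1)] by blast
qed

end

section \<open>Conformal families\<close>

locale conformal_cover = univ_cover G T p for G :: "'v graph" and T :: "'t graph" and p :: "'t \<Rightarrow> 'v" +
  fixes \<delta> :: real and \<mu> :: "'t \<Rightarrow> 't tree_end measure"
  assumes cf: "conformal_family T p \<delta> \<mu>"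
begin

lemma \<mu>_finite: "x \<in> V \<Longrightarrow> finite_measure (\<mu> x)"
  and \<mu>_sets: "x \<in> V \<Longrightarrow> sets (\<mu> x) = sets (end_borel T)"
  and \<mu>_pos: "x \<in> V \<Longrightarrow> emeasure (\<mu> x) (ends T) > 0"
  and \<mu>_equiv: "x \<in> V \<Longrightarrow> \<gamma> \<in> carrier (deck_group T p) \<Longrightarrow> \<mu> (\<gamma> x) = distr (\<mu> x) (end_borel T) (end_map \<gamma>)"
  and \<mu>_density: "x \<in> V \<Longrightarrow> y \<in> V \<Longrightarrow> \<mu> x = density (\<mu> y) (\<lambda>\<xi>. ennreal (exp (- \<delta> * busemann T \<xi> x y)))"
  using cf unfolding conformal_family_def by blast+

lemma \<mu>_space: "x \<in> V \<Longrightarrow> space (\<mu> x) = ends T"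
  using sets_eq_imp_space_eq[OF \<mu>_sets] space_end_borel by simp

lemma busemann_measurable: assumes "x \<in> V" "y \<in> V" shows "(\<lambda>\<xi>. busemann T \<xi> x y) \<in> borel_measurable (end_borel T)"
proof (rule measurableI)
  fix B :: "real set"
  show "(\<lambda>\<xi>. busemann T \<xi> x y) -` B \<inter> space (end_borel T) \<in> sets (end_borel T)"
  proof (rule open_sets)
    fix \<xi> assume "\<xi> \<in> (\<lambda>\<xi>. busemann T \<xi> x y) -` B \<inter> space (end_borel T)"
    then have \<xi>: "\<xi> \<in> ends T" "busemann T \<xi> x y \<in> B" by (auto simp: space_end_borel)
    obtain u v where uv: "adj T u v" "\<xi> \<in> half_ends T u v" "x \<in> half_tree T v u" "y \<in> half_tree T v u"
      using busemann_nbhd[OF \<xi>(1) assms] by blast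
    have "busemann T \<eta> x y = busemann T \<xi> x y" if "\<eta> \<in> half_ends T u v" for \<eta>
      using busemann_half[OF uv(1) that uv(3,4)] busemann_half[OF uv(1,2,3,4)] by simp
    then have "half_ends T u v \<subseteq> (\<lambda>\<xi>. busemann T \<xi> x y) -` B \<inter> space (end_borel T)"
      using \<xi>(2) half_ends_ends by (auto simp: space_end_borel)
    then show "\<exists>u v. adj T u v \<and> \<xi> \<in> half_ends T u v \<and> half_ends T u v \<subseteq> (\<lambda>\<xi>. busemann T \<xi> x y) -` B \<inter> space (end_borel T)"
      using uv by blast
  qed (simp add: space_end_borel)
qed simp

lemma density_measurable:
  assumes "x \<in> V" "y \<in> V" shows "(\<lambda>\<xi>. ennreal (exp (- \<delta> * busemann T \<xi> x y))) \<in> borel_measurable (\<mu> y)"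
  unfolding measurable_cong_sets[OF \<mu>_sets[OF assms(2)] refl]
  using busemann_measurable[OF assms] by measurable

text \<open>On a set on which the Busemann function is constant, the density is a factor. Apart from
  null sets, conformality is used in this form only.\<close>

lemma \<mu>_const:
  assumes V: "x \<in> V" "y \<in> V" and A: "A \<in> sets (end_borel T)" and c: "\<And>\<xi>. \<xi> \<in> A \<Longrightarrow> busemann T \<xi> x y = c"
  shows "measure (\<mu> x) A = exp (- \<delta> * c) * measure (\<mu> y) A"
proof -
  have A': "A \<in> sets (\<mu> y)" using A \<mu>_sets[OF V(2)] by simp
  have "emeasure (\<mu> x) A = (\<integral>\<^sup>+ \<xi>. ennreal (exp (- \<delta> * busemann T \<xi> x y)) * indicator A \<xi> \<partial>\<mu> y)"
    using emeasure_density[OF density_measurable[OF V] A'] \<mu>_density[OF V] by simp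
  also have "\<dots> = (\<integral>\<^sup>+ \<xi>. ennreal (exp (- \<delta> * c)) * indicator A \<xi> \<partial>\<mu> y)"
    by (rule nn_integral_cong) (use c in \<open>auto simp: indicator_def\<close>)
  also have "\<dots> = ennreal (exp (- \<delta> * c)) * emeasure (\<mu> y) A" by (rule nn_integral_cmult_indicator[OF A'])
  finally show ?thesis by (simp add: measure_def enn2real_mult)
qed

lemma \<mu>_null:
  assumes V: "x \<in> V" "y \<in> V" and A: "A \<in> sets (end_borel T)" and 0: "emeasure (\<mu> y) A = 0"
  shows "emeasure (\<mu> x) A = 0"
proof -
  have A': "A \<in> sets (\<mu> y)" using A \<mu>_sets[OF V(2)] by simp
  then have "A \<in> null_sets (\<mu> y)" using 0 by auto
  then show ?thesis
    using emeasure_density[OF density_measurable[OF V] A'] \<mu>_density[OF V] nn_integral_null_set by simp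
qed

lemma \<mu>_equiv_image:
  assumes x: "x \<in> V" and g: "\<gamma> \<in> carrier (deck_group T p)" and A: "A \<in> sets (end_borel T)"
  shows "measure (\<mu> (\<gamma> x)) (end_map \<gamma> ` A) = measure (\<mu> x) A"
proof -
  interpret g: tree_iso T T \<gamma> by (rule deck_iso[OF g])
  have m: "end_map \<gamma> \<in> measurable (\<mu> x) (end_borel T)"
    using g.end_map_measurable measurable_cong_sets[OF \<mu>_sets[OF x] refl] by blast
  have "measure (\<mu> (\<gamma> x)) (end_map \<gamma> ` A) = measure (\<mu> x) (end_map \<gamma> -` (end_map \<gamma> ` A) \<inter> space (\<mu> x))"
    unfolding \<mu>_equiv[OF x g] by (rule measure_distr[OF m g.end_map_sets[OF A]])
  then show ?thesis using g.end_map_vimage[OF end_borel_sub[OF A]] \<mu>_space[OF x] by simp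
qed

text \<open>An eigenvector of the non-backtracking operator with eigenvalue \<open>exp \<delta>\<close>
  (\<open>edge_weight_eigen\<close>).\<close>

definition edge_weight :: "'t \<Rightarrow> 't \<Rightarrow> real" where "edge_weight u v = measure (\<mu> u) (half_ends T u v)"

lemma edge_weight_inv: assumes "adj T a b" "adj T a' b'" "p a = p a'" "p b = p b'" shows "edge_weight a b = edge_weight a' b'"
proof -
  obtain \<gamma> where g: "\<gamma> \<in> carrier (deck_group T p)" "\<gamma> a = a'" "\<gamma> b = b'" using deck_edge[OF assms] .
  interpret g: tree_iso T T \<gamma> by (rule deck_iso[OF g(1)])
  have V: "a \<in> V" "b \<in> V" using adj_verts[OF assms(1)] by auto
  show ?thesis
    using \<mu>_equiv_image[OF V(1) g(1) half_ends_sets[OF assms(1)]] g.iso_half_ends_image[OF V] g(2,3) unfolding edge_weight_def by simp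
qed

lemma edge_weight_eigen: assumes uv: "adj T u v" shows "exp \<delta> * edge_weight u v = (\<Sum>w\<in>nbhd T v - {u}. edge_weight v w)"
proof -
  have V: "u \<in> V" "v \<in> V" using adj_verts[OF uv] by auto
  interpret finite_measure "\<mu> v" by (rule \<mu>_finite[OF V(2)])
  have "edge_weight u v = exp (- \<delta> * 1) * measure (\<mu> v) (half_ends T u v)"
    unfolding edge_weight_def by (rule \<mu>_const[OF V half_ends_sets[OF uv] busemann_adj[OF uv]])
  moreover have "measure (\<mu> v) (half_ends T u v) = (\<Sum>w\<in>nbhd T v - {u}. edge_weight v w)"
    unfolding half_ends_split[OF uv] edge_weight_def
  proof (rule finite_measure_finite_Union)
    show "half_ends T v ` (nbhd T v - {u}) \<subseteq> sets (\<mu> v)" using half_ends_sets \<mu>_sets[OF V(2)] by (auto simp: nbhd_def)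
    show "disjoint_family_on (half_ends T v) (nbhd T v - {u})"
      by (rule disjoint_family_on_mono[OF _ half_ends_disjoint]) blast
  qed (use fin_nbhd V in simp)
  ultimately show ?thesis by (simp add: exp_minus field_simps)
qed

text \<open>The edges of weight zero are closed under continuation; if there were any, the measure
  would vanish.\<close>

lemma edge_weight_pos: assumes uv: "adj T u v" shows "edge_weight u v > 0"
proof (rule ccontr)
  have nn: "edge_weight a b \<ge> 0" for a b unfolding edge_weight_def by simp
  assume "\<not> edge_weight u v > 0"
  then have 0: "edge_weight u v = 0" using nn[of u v] by simp
  have all: "edge_weight a b = 0" if ab: "adj T a b" for a b
  proof (rule invariant_closed_all[of "\<lambda>a b. edge_weight a b = 0", OF _ _ uv 0 ab])
    show "edge_weight a' b' = 0" if "adj T a b" "adj T a' b'" "p a = p a'" "p b = p b'" "edge_weight a b = 0" for a b a' b'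
      using edge_weight_inv[OF that(1-4)] that(5) by simp
    fix s t w assume st: "adj T s t" "adj T t w" "w \<noteq> s" "edge_weight s t = 0"
    have fin: "finite (nbhd T t - {s})" using fin_nbhd adj_verts[OF st(1)] by simp
    have "(\<Sum>w\<in>nbhd T t - {s}. edge_weight t w) = 0" using edge_weight_eigen[OF st(1)] st(4) by simp
    then show "edge_weight t w = 0" using sum_nonneg_eq_0_iff[OF fin, of "edge_weight t"] nn st by (simp add: nbhd_def)
  qed
  have V: "u \<in> V" using adj_verts[OF uv] by auto
  interpret finite_measure "\<mu> u" by (rule \<mu>_finite[OF V])
  have "measure (\<mu> u) (ends T) = (\<Sum>w\<in>nbhd T u. measure (\<mu> u) (half_ends T u w))"
    unfolding ends_split[OF V]
    by (rule finite_measure_finite_Union[OF fin_nbhd[OF V] _ half_ends_disjoint])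
      (use half_ends_sets \<mu>_sets[OF V] in \<open>auto simp: nbhd_def\<close>)
  also have "\<dots> = 0" by (rule sum.neutral) (use all in \<open>auto simp: nbhd_def edge_weight_def\<close>)
  finally show False using \<mu>_pos[OF V] by (simp add: emeasure_eq_measure)
qed

text \<open>An edge of least weight has at least two continuations, none of smaller weight, so \<open>exp \<delta>\<close>
  is at least two.\<close>

lemma \<delta>_pos: "\<delta> > 0"
proof -
  let ?S = "{edge_weight a b | a b. adj T a b}"
  have fin: "finite ?S" by (rule finite_values) (rule edge_weight_inv)
  obtain u v where "adj T u v" by (rule edge_ex)
  then have "?S \<noteq> {}" by blast
  then have "Min ?S \<in> ?S" by (rule Min_in[OF fin])
  then obtain a b where ab: "adj T a b" "edge_weight a b = Min ?S" by auto
  have le: "edge_weight a b \<le> edge_weight s t" if "adj T s t" for s t unfolding ab(2) by (rule Min_le[OF fin]) (use that in blast)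
  have bV: "b \<in> V" using adj_verts[OF ab(1)] by simp
  have "a \<in> nbhd T b" using adj_sym[OF ab(1)] by (simp add: nbhd_def)
  then have "card (nbhd T b - {a}) \<ge> 2" using deg[OF bV] by (simp add: card_Diff_singleton)
  then have "2 * edge_weight a b \<le> real (card (nbhd T b - {a})) * edge_weight a b" using edge_weight_pos[OF ab(1)] by (intro mult_right_mono) auto
  also have "\<dots> = (\<Sum>w\<in>nbhd T b - {a}. edge_weight a b)" by simp
  also have "\<dots> \<le> (\<Sum>w\<in>nbhd T b - {a}. edge_weight b w)" by (rule sum_mono) (use le in \<open>auto simp: nbhd_def\<close>)
  also have "\<dots> = exp \<delta> * edge_weight a b" using edge_weight_eigen[OF ab(1)] by simp
  finally have "2 \<le> exp \<delta>" using edge_weight_pos[OF ab(1)] by simp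
  then have "exp 0 < exp \<delta>" by (simp only: exp_zero)
  then show ?thesis by (simp only: exp_less_cancel_iff)
qed

lemma \<mu>_away:
  assumes uv: "adj T u v" and x: "x \<in> half_tree T v u" and A: "A \<in> sets (end_borel T)" "A \<subseteq> half_ends T u v"
  shows "measure (\<mu> x) A = exp (- \<delta> * real (d x u)) * measure (\<mu> u) A"
  by (rule \<mu>_const[OF half_V[OF x] adj_verts(1)[OF uv] A(1)]) (use busemann_half_ends[OF uv _ x] A(2) in blast)

lemma \<mu>_half_ends_pos: assumes uv: "adj T u v" and x: "x \<in> V" shows "measure (\<mu> x) (half_ends T u v) > 0"
proof -
  have V: "u \<in> V" using adj_verts[OF uv] by auto
  interpret u: finite_measure "\<mu> u" by (rule \<mu>_finite[OF V])
  interpret x: finite_measure "\<mu> x" by (rule \<mu>_finite[OF x])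
  have "measure (\<mu> x) (half_ends T u v) \<noteq> 0"
    using \<mu>_null[OF V x half_ends_sets[OF uv]] edge_weight_pos[OF uv]
    unfolding edge_weight_def u.emeasure_eq_measure x.emeasure_eq_measure by auto
  then show ?thesis using measure_nonneg[of "\<mu> x" "half_ends T u v"] by linarith
qed

end

text \<open>The edge weights of both families are positive eigenvectors on the same tree, hence
  proportional. They determine the measures of all cylinders that point away from a given vertex,
  and these generate.\<close>

lemma conformal_unique:
  assumes c: "conformal_cover G T p \<delta> \<mu>" and c': "conformal_cover G' T' p' \<delta>' \<mu>'" and F: "graph_iso T T' F"
    and f: "\<And>x. x \<in> verts T \<Longrightarrow> p' (F x) = f (p x)"
  obtains k where "\<delta> = \<delta>'" "k > 0" "\<And>x A. x \<in> verts T \<Longrightarrow> A \<in> sets (end_borel T) \<Longrightarrow>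
      measure (\<mu>' (F x)) (end_map F ` A) = k * measure (\<mu> x) A"
proof -
  interpret A: conformal_cover G T p \<delta> \<mu> by fact
  interpret B: conformal_cover G' T' p' \<delta>' \<mu>' by fact
  interpret F: tree_iso T T' F by unfold_locales (rule F)
  define h where "h u v = B.edge_weight (F u) (F v)" for u v
  have h1: "h a b = h a' b'" if "adj T a b" "adj T a' b'" "p a = p a'" "p b = p b'" for a b a' b'
    unfolding h_def
  proof (rule B.edge_weight_inv)
    show "adj T' (F a) (F b)" "adj T' (F a') (F b')" using F.iso_adj' that by blast+
    show "p' (F a) = p' (F a')" "p' (F b) = p' (F b')"
      using f A.adj_verts[OF that(1)] A.adj_verts[OF that(2)] that(3,4) by simp_all
  qed
  have h2: "0 < h a b" if "adj T a b" for a b unfolding h_def by (rule B.edge_weight_pos) (rule F.iso_adj'[OF that])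
  have h3: "exp \<delta>' * h a b = (\<Sum>w\<in>nbhd T b - {a}. h b w)" if ab: "adj T a b" for a b
    proof -
      have V: "a \<in> A.V" "b \<in> A.V" using A.adj_verts[OF ab] by auto
      have "(\<Sum>w\<in>nbhd T b - {a}. B.edge_weight (F b) (F w)) = (\<Sum>w\<in>nbhd T' (F b) - F ` {a}. B.edge_weight (F b) w)"
        by (rule sum.reindex_bij_betw[OF F.iso_nbhd[OF V(2,1)]])
      then show ?thesis unfolding h_def using B.edge_weight_eigen[OF F.iso_adj'[OF ab]] by simp
    qed
  obtain k where k: "exp \<delta>' = exp \<delta>" "k > 0" "\<And>a b. adj T a b \<Longrightarrow> h a b = k * A.edge_weight a b"
  proof (rule A.perron_frobenius_unique[OF h1 A.edge_weight_inv h2 A.edge_weight_pos h3 A.edge_weight_eigen])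
    fix k assume h: "exp \<delta>' = exp \<delta>" "0 < k" "\<And>a b. adj T a b \<Longrightarrow> h a b = k * A.edge_weight a b"
    show thesis by (rule that[OF h])
  qed
  have d: "\<delta> = \<delta>'" using k(1) by simp
  have "measure (\<mu>' (F x)) (end_map F ` A) = k * measure (\<mu> x) A" if x: "x \<in> A.V" and A: "A \<in> sets (end_borel T)" for x A
  proof -
    interpret i: tree_iso T' T F.inv_iso by (rule F.inv_tree_iso)
    have Fx: "F x \<in> verts T'" by (rule F.iso_V[OF x])
    interpret m: finite_measure "\<mu> x" by (rule A.\<mu>_finite[OF x])
    interpret m': finite_measure "\<mu>' (F x)" by (rule B.\<mu>_finite[OF Fx])
    define N where "N = distr (\<mu>' (F x)) (end_borel T) (end_map F.inv_iso)"
    define M where "M = scale_measure (ennreal k) (\<mu> x)"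
    have meas: "end_map F.inv_iso \<in> measurable (\<mu>' (F x)) (end_borel T)"
      using i.end_map_measurable measurable_cong_sets[OF B.\<mu>_sets[OF Fx] refl] by blast
    have Nm: "measure N A = measure (\<mu>' (F x)) (end_map F ` A)" if "A \<in> sets (end_borel T)" for A
      unfolding N_def measure_distr[OF meas that] B.\<mu>_space[OF Fx] F.end_map_image_inv[OF A.end_borel_sub[OF that]] ..
    have Mm: "measure M A = k * measure (\<mu> x) A" for A
      unfolding M_def using k(2) by (simp add: measure_scale_measure)
    have "M = N"
    proof (rule A.measure_eq_from[OF x])
      show "finite_measure M" 
        unfolding M_def by (rule finite_measureI) (simp add: m.emeasure_eq_measure ennreal_mult_eq_top_iff)
      show "sets M = sets (end_borel T)" unfolding M_def using A.\<mu>_sets[OF x] by simp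
      show "finite_measure N" unfolding N_def by (rule m'.finite_measure_distr[OF meas])
      show "sets N = sets (end_borel T)" unfolding N_def by simp
      fix u v assume uv: "adj T u v" "x \<in> half_tree T v u"
      have V: "u \<in> A.V" "v \<in> A.V" using A.adj_verts[OF uv(1)] by auto
      have Fuv: "adj T' (F u) (F v)" "F x \<in> half_tree T' (F v) (F u)" using F.iso_adj'[OF uv(1)] F.iso_half[OF V(2,1)] uv(2) by auto
      have "measure N (half_ends T u v) = measure (\<mu>' (F x)) (half_ends T' (F u) (F v))"
        using Nm[OF A.half_ends_sets[OF uv(1)]] F.iso_half_ends_image[OF V] by simp
      also have "\<dots> = exp (- \<delta>' * real (B.d (F x) (F u))) * h u v"
        unfolding h_def B.edge_weight_def by (rule B.\<mu>_away[OF Fuv B.half_ends_sets[OF Fuv(1)] subset_refl])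
      also have "\<dots> = k * (exp (- \<delta> * real (A.d x u)) * A.edge_weight u v)"
        using k(3)[OF uv(1)] d F.iso_dist[OF x V(1)] by simp
      also have "\<dots> = k * measure (\<mu> x) (half_ends T u v)"
        unfolding A.edge_weight_def using A.\<mu>_away[OF uv A.half_ends_sets[OF uv(1)] subset_refl] by simp
      finally show "measure M (half_ends T u v) = measure N (half_ends T u v)" unfolding Mm by simp
    qed
    then show ?thesis using Nm[OF A] Mm[of A] by simp
  qed
  then show ?thesis using that[OF d k(2)] by blast
qed

section \<open>Compositions of coarse maps and measurability of their extensions\<close>

lemma coarse_lip:
  assumes t: "tree_graph T1" "tree_graph T2" and f: "coarse T1 T2 f"
  obtains L where "\<And>x y. x \<in> verts T1 \<Longrightarrow> y \<in> verts T1 \<Longrightarrow> graph_dist T2 (f x) (f y) \<le> L * graph_dist T1 x y"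
proof -
  interpret A: tree_graph T1 by fact
  interpret B: tree_graph T2 by fact
  obtain L where L: "\<And>a b. adj T1 a b \<Longrightarrow> B.d (f a) (f b) \<le> L" using f unfolding coarse_def by blast
  have fV: "f z \<in> B.V" if "z \<in> A.V" for z using f that unfolding coarse_def by blast
  have "B.d (f x) (f y) \<le> L * A.d x y" if x: "x \<in> A.V" and y: "y \<in> A.V" for x y
    using x y
  proof (induction rule: A.V_induct)
    case (step a b)
    have V: "a \<in> A.V" "b \<in> A.V" using A.adj_verts[OF step(1)] by auto
    have "B.d (f x) (f b) \<le> B.d (f x) (f a) + B.d (f a) (f b)" by (rule B.dist_triangle) (use fV x V in auto)
    then show ?case using step(2,3) L[OF step(1)] by simp
  qed simp
  then show ?thesis using that by blast
qed

lemma coarse_comp: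
  assumes t: "tree_graph T1" "tree_graph T2" "tree_graph T3" and f: "coarse T1 T2 f" and g: "coarse T2 T3 g"
  shows "coarse T1 T3 (\<lambda>x. g (f x))"
  unfolding coarse_def
proof (intro conjI ballI allI)
  interpret A: tree_graph T1 by fact
  interpret B: tree_graph T2 by fact
  interpret C: tree_graph T3 by fact
  have fV: "f z \<in> B.V" if "z \<in> A.V" for z using f that unfolding coarse_def by blast
  have gV: "g z \<in> C.V" if "z \<in> B.V" for z using g that unfolding coarse_def by blast
  show "(\<lambda>x. g (f x)) ` A.V \<subseteq> C.V" using fV gV by blast
  obtain L where L: "\<And>a b. adj T1 a b \<Longrightarrow> B.d (f a) (f b) \<le> L" using f unfolding coarse_def by blast
  obtain M where M: "\<And>x y. x \<in> B.V \<Longrightarrow> y \<in> B.V \<Longrightarrow> C.d (g x) (g y) \<le> M * B.d x y" using coarse_lip[OF t(2,3) g] by blast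
  show "\<exists>L. \<forall>a b. adj T1 a b \<longrightarrow> C.d (g (f a)) (g (f b)) \<le> L"
  proof (intro exI[of _ "M * L"] allI impI)
    fix a b assume ab: "adj T1 a b"
    have "C.d (g (f a)) (g (f b)) \<le> M * B.d (f a) (f b)" using M fV A.adj_verts[OF ab] by blast
    also have "\<dots> \<le> M * L" using L[OF ab] by simp
    finally show "C.d (g (f a)) (g (f b)) \<le> M * L" .
  qed
  fix y n assume y: "y \<in> C.V"
  have fin: "finite {z \<in> B.V. C.d (g z) y \<le> n}" using g y unfolding coarse_def by blast
  have "finite {a \<in> A.V. B.d (f a) z \<le> 0}" if "z \<in> B.V" for z using f that unfolding coarse_def by blast
  then have "finite (\<Union>z\<in>{z \<in> B.V. C.d (g z) y \<le> n}. {a \<in> A.V. B.d (f a) z \<le> 0})" using fin by blast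
  moreover have "{a \<in> A.V. C.d (g (f a)) y \<le> n} \<subseteq> (\<Union>z\<in>{z \<in> B.V. C.d (g z) y \<le> n}. {a \<in> A.V. B.d (f a) z \<le> 0})"
  proof
    fix a assume "a \<in> {a \<in> A.V. C.d (g (f a)) y \<le> n}"
    then show "a \<in> (\<Union>z\<in>{z \<in> B.V. C.d (g z) y \<le> n}. {a \<in> A.V. B.d (f a) z \<le> 0})"
      using fV[of a] by (intro UN_I[of "f a"]) auto
  qed
  ultimately show "finite {a \<in> A.V. C.d (g (f a)) y \<le> n}" by (rule finite_subset[rotated])
qed

context two_trees
begin

lemma ext_measurable:
  assumes f: "coarse T1 T2 f" and "locally_finite_tree T1" shows "end_extension T1 T2 f \<in> measurable (end_borel T1) (end_borel T2)"
proof (rule B.measurable_to_ends)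
  interpret A: locally_finite_tree T1 by fact
  show "end_extension T1 T2 f \<in> space (end_borel T1) \<rightarrow> ends T2" using ext_lim(1)[OF f] by (simp add: A.space_end_borel)
  fix u v assume uv: "adj T2 u v"
  show "end_extension T1 T2 f -` half_ends T2 u v \<inter> space (end_borel T1) \<in> sets (end_borel T1)"
  proof (rule A.open_sets)
    fix \<xi> assume "\<xi> \<in> end_extension T1 T2 f -` half_ends T2 u v \<inter> space (end_borel T1)"
    then have \<xi>: "\<xi> \<in> ends T1" "end_extension T1 T2 f \<xi> \<in> half_ends T2 u v" by (auto simp: A.space_end_borel)
    obtain a c where ac: "adj T1 a c" "\<xi> \<in> half_ends T1 a c" "\<And>\<xi>'. \<xi>' \<in> half_ends T1 a c \<Longrightarrow> end_extension T1 T2 f \<xi>' \<in> half_ends T2 u v"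
      using ext_cont[OF f \<xi>(1) uv \<xi>(2)] by blast
    then have "half_ends T1 a c \<subseteq> end_extension T1 T2 f -` half_ends T2 u v \<inter> space (end_borel T1)"
      using A.half_ends_ends by (auto simp: A.space_end_borel)
    then show "\<exists>a c. adj T1 a c \<and> \<xi> \<in> half_ends T1 a c \<and> half_ends T1 a c \<subseteq> end_extension T1 T2 f -` half_ends T2 u v \<inter> space (end_borel T1)"
      using ac by blast
  qed (simp add: A.space_end_borel)
qed

end

section \<open>Almost constant densities on cylinders\<close>

context locally_finite_tree
begin

text \<open>On a set \<open>E r\<close> where the density lies between \<open>r\<close> and \<open>(1 + e) * r\<close> the measures are
  proportional up to the factor \<open>1 + e\<close>. Such a set has positive measure for some rational \<open>r\<close>,
  and some cylinder is almost filled by it for the sum \<open>P\<close> of the two measures; there the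
  remainder is negligible for both.\<close>

lemma density_cylinder:
  assumes x: "x \<in> V" and M: "finite_measure M" "sets M = sets (end_borel T)"
    and N: "finite_measure N" "sets N = sets (end_borel T)" and ac: "absolutely_continuous M N"
    and pos: "measure N (ends T) > 0" and e: "0 < e" "e \<le> (1::real)"
  obtains u v r where "adj T u v" "x \<in> half_tree T v u" "r > 0"
    "\<And>A. A \<in> sets (end_borel T) \<Longrightarrow> A \<subseteq> half_ends T u v \<Longrightarrow>
       \<bar>measure N A - r * measure M A\<bar> \<le> 2 * e * r * measure M (half_ends T u v)"
proof -
  interpret M: finite_measure M by fact
  interpret N: finite_measure N by fact
  have MN: "sets N = sets M" using M N by simp
  have sp: "space M = ends T" "space N = ends T" using sets_eq_imp_space_eq[OF M(2)] sets_eq_imp_space_eq[OF N(2)] space_end_borel by auto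
  obtain D where D: "D \<in> borel_measurable M" "AE y in M. RN_deriv M N y = ennreal (D y)" "AE y in N. 0 < D y" "\<And>y. 0 \<le> D y"
    using M.real_RN_deriv[OF N(1) ac MN] by blast
  have dens: "N = density M (\<lambda>y. ennreal (D y))"
  proof -
    have "N = density M (RN_deriv M N)" using M.density_RN_deriv[OF ac MN] by simp
    also have "\<dots> = density M (\<lambda>y. ennreal (D y))" by (rule density_cong) (use D in auto)
    finally show ?thesis .
  qed
  have DM[measurable]: "D \<in> borel_measurable M" by (rule D(1))
  define E where "E r = {y \<in> space M. r \<le> D y \<and> D y < (1 + e) * r}" for r
  have EM: "E r \<in> sets M" for r unfolding E_def by measurable
  have NA: "emeasure N A = (\<integral>\<^sup>+ y. ennreal (D y) * indicator A y \<partial>M)" if "A \<in> sets M" for A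
    unfolding dens by (rule emeasure_density) (use that in auto)
  have "\<exists>r\<in>\<rat> \<inter> {0<..}. measure N (E r) > 0"
  proof (rule ccontr)
    assume c: "\<not> ?thesis"
    have z: "measure N (E r) = 0" if r: "r \<in> \<rat> \<inter> {0<..}" for r
    proof -
      have "\<not> measure N (E r) > 0" using c r by blast
      then show ?thesis using measure_nonneg[of N "E r"] by linarith
    qed
    have "{y \<in> space N. 0 < D y} \<subseteq> (\<Union>r\<in>\<rat> \<inter> {0<..}. E r)"
    proof
      fix y assume y: "y \<in> {y \<in> space N. 0 < D y}"
      then have "D y / (1 + e) < D y" using e by (simp add: field_simps)
      then obtain r where r: "r \<in> \<rat>" "D y / (1 + e) < r" "r < D y" using Rats_dense_in_real by blast
      have "0 < D y / (1 + e)" using y e by simp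
      then have "0 < r" using r by linarith
      moreover have "D y < (1 + e) * r" using r(2) e by (simp add: field_simps)
      ultimately have "y \<in> E r" using r y sp unfolding E_def by simp
      then show "y \<in> (\<Union>r\<in>\<rat> \<inter> {0<..}. E r)" using r(1) \<open>0 < r\<close> by blast
    qed
    moreover have "(\<Union>r\<in>\<rat> \<inter> {0<..}. E r) \<in> null_sets N"
    proof (rule null_sets_UN')
      show "countable (\<rat> \<inter> {0<..} :: real set)" using countable_rat by (rule countable_subset[rotated]) simp
      show "E r \<in> null_sets N" if "r \<in> \<rat> \<inter> {0<..}" for r
        using z[OF that] EM MN by (auto simp: N.emeasure_eq_measure)
    qed
    ultimately have "AE y in N. y \<notin> {y \<in> space N. 0 < D y}" by (intro AE_I'[of "(\<Union>r\<in>\<rat> \<inter> {0<..}. E r)"]) auto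
    then have "AE y in N. False" using D(3) AE_space by eventually_elim auto
    then have "space N \<in> null_sets N" using AE_iff_null[of N "\<lambda>_. False"] by simp
    then have "emeasure N (space N) = 0" by (rule null_setsD1)
    then show False using pos sp by (simp add: measure_def)
  qed
  then obtain r where r: "r > 0" "measure N (E r) > 0" by blast
  have bnd: "r * measure M A \<le> measure N A \<and> measure N A \<le> (1 + e) * r * measure M A" if A: "A \<in> sets M" "A \<subseteq> E r" for A
  proof -
    have "ennreal r * emeasure M A = (\<integral>\<^sup>+ y. ennreal r * indicator A y \<partial>M)" using A by (simp add: nn_integral_cmult_indicator)
    also have "\<dots> \<le> emeasure N A" unfolding NA[OF A(1)]
      by (rule nn_integral_mono) (use A(2) in \<open>auto simp: E_def indicator_def intro!: ennreal_leI\<close>)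
    finally have 1: "r * measure M A \<le> measure N A"
      using r by (simp add: M.emeasure_eq_measure N.emeasure_eq_measure flip: ennreal_mult)
    have "emeasure N A \<le> (\<integral>\<^sup>+ y. ennreal ((1 + e) * r) * indicator A y \<partial>M)" unfolding NA[OF A(1)]
      by (rule nn_integral_mono) (use A(2) in \<open>auto simp: E_def indicator_def intro!: ennreal_leI\<close>)
    also have "\<dots> = ennreal ((1 + e) * r) * emeasure M A" using A by (simp add: nn_integral_cmult_indicator)
    finally have "measure N A \<le> (1 + e) * r * measure M A"
      using r e by (simp add: M.emeasure_eq_measure N.emeasure_eq_measure flip: ennreal_mult)
    then show ?thesis using 1 by simp
  qed
  define P where "P = density M (\<lambda>y. 1 + ennreal (D y))"
  have PA': "emeasure P A = emeasure M A + emeasure N A" if "A \<in> sets M" for A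
  proof -
    have "emeasure P A = (\<integral>\<^sup>+ y. (1 + ennreal (D y)) * indicator A y \<partial>M)"
      unfolding P_def by (rule emeasure_density) (use that in auto)
    also have "\<dots> = (\<integral>\<^sup>+ y. indicator A y + ennreal (D y) * indicator A y \<partial>M)" by (simp add: distrib_right)
    also have "\<dots> = (\<integral>\<^sup>+ y. indicator A y \<partial>M) + (\<integral>\<^sup>+ y. ennreal (D y) * indicator A y \<partial>M)"
      by (rule nn_integral_add) (use that in auto)
    finally show ?thesis using that NA by simp
  qed
  have PM: "sets P = sets M" "space P = space M" unfolding P_def by simp_all
  have PA: "measure P A = measure M A + measure N A" if "A \<in> sets M" for A
    by (rule measure_eq_emeasure_eq_ennreal)
      (simp_all add: PA'[OF that] M.emeasure_eq_measure N.emeasure_eq_measure)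
  have Pfin: "finite_measure P"
    by (rule finite_measureI) (use PA'[of "space M"] PM in \<open>simp add: M.emeasure_eq_measure N.emeasure_eq_measure\<close>)
  interpret P: finite_measure P by (rule Pfin)
  define c where "c = 2 * (1 + 2 * r)"
  \<comment> \<open>the first bound lets the part of a cylinder in \<open>E r\<close> control the whole, the second keeps the
    contribution of the rest to the error below \<open>e * r\<close>\<close>
  define k where "k = min (1/2) (e * r / ((1 + r) * c))"
  have cpos: "c > 0" unfolding c_def using r by simp
  have kpos: "k > 0" "k \<le> 1/2" using e r cpos by (simp add: k_def) (simp only: k_def min.cobounded1)
  have "k \<le> e * r / ((1 + r) * c)" unfolding k_def by simp
  then have kc: "k * ((1 + r) * c) \<le> e * r" using r cpos by (simp add: pos_le_divide_eq)
  have "measure P (E r) > 0" using PA[OF EM, of r] r(2) measure_nonneg[of M "E r"] by linarith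
  then obtain u v where uv: "adj T u v" "x \<in> half_tree T v u" "measure P (half_ends T u v - E r) < k * measure P (half_ends T u v)"
    using cylinder_density[OF x Pfin _ _ _ kpos(1), of "E r"] PM M EM by metis
  let ?b = "half_ends T u v"
  have bM: "?b \<in> sets M" using half_ends_sets[OF uv(1)] M by simp
  have split: "measure Q A = measure Q (A \<inter> E r) + measure Q (A - E r)"
    if "finite_measure Q" "sets Q = sets M" "A \<in> sets M" for Q A
  proof -
    interpret finite_measure Q by fact
    have "measure Q ((A \<inter> E r) \<union> (A - E r)) = measure Q (A \<inter> E r) + measure Q (A - E r)"
      by (rule finite_measure_Union) (use that EM in auto)
    moreover have "(A \<inter> E r) \<union> (A - E r) = A" by blast
    ultimately show ?thesis by simp
  qed
  have "measure P ?b = measure P (?b \<inter> E r) + measure P (?b - E r)" by (rule split[OF Pfin PM(1) bM])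
  also have "\<dots> \<le> (1 + 2 * r) * measure M ?b + 1/2 * measure P ?b"
  proof (rule add_mono)
    have "?b \<inter> E r \<in> sets M" using bM EM by blast
    then have "measure P (?b \<inter> E r) \<le> measure M (?b \<inter> E r) + (1 + e) * r * measure M (?b \<inter> E r)"
      using PA bnd by simp
    also have "\<dots> = (1 + (1 + e) * r) * measure M (?b \<inter> E r)" by (simp add: algebra_simps)
    also have "\<dots> \<le> (1 + 2 * r) * measure M ?b"
    proof (rule mult_mono)
      show "1 + (1 + e) * r \<le> 1 + 2 * r" using e r by simp
      show "measure M (?b \<inter> E r) \<le> measure M ?b" by (rule M.finite_measure_mono) (use bM in auto)
    qed (use r in auto)
    finally show "measure P (?b \<inter> E r) \<le> (1 + 2 * r) * measure M ?b" .
    have "k * measure P ?b \<le> 1/2 * measure P ?b" by (rule mult_right_mono[OF kpos(2)]) simp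
    then show "measure P (?b - E r) \<le> 1/2 * measure P ?b" using uv(3) by simp
  qed
  finally have Pb: "measure P ?b \<le> c * measure M ?b" unfolding c_def by (simp add: algebra_simps)
  have main: "\<bar>measure N A - r * measure M A\<bar> \<le> 2 * e * r * measure M ?b"
    if A': "A \<in> sets (end_borel T)" and sub: "A \<subseteq> ?b" for A
  proof -
    have A: "A \<in> sets M" using A' M by simp
    have AE: "A \<inter> E r \<in> sets M" "A - E r \<in> sets M" using A EM by auto
    have s: "measure N A = measure N (A \<inter> E r) + measure N (A - E r)" "measure M A = measure M (A \<inter> E r) + measure M (A - E r)"
      by (rule split[OF N(1) MN A], rule split[OF M(1) refl A])
    have b1: "r * measure M (A \<inter> E r) \<le> measure N (A \<inter> E r)" "measure N (A \<inter> E r) \<le> (1 + e) * r * measure M (A \<inter> E r)"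
      using bnd[OF AE(1)] by auto
    have "measure M (A \<inter> E r) \<le> measure M ?b" by (rule M.finite_measure_mono) (use sub bM in auto)
    then have "e * r * measure M (A \<inter> E r) \<le> e * r * measure M ?b" using e r by simp
    then have b2: "measure N (A \<inter> E r) - r * measure M (A \<inter> E r) \<le> e * r * measure M ?b"
      using b1(2) by (simp add: algebra_simps)
    have "measure P (A - E r) \<le> measure P (?b - E r)" by (rule P.finite_measure_mono) (use sub bM EM PM in auto)
    then have "measure P (A - E r) \<le> k * (c * measure M ?b)"
      using uv(3) Pb kpos(1) by (meson less_eq_real_def mult_left_mono order_trans)
    then have "(1 + r) * measure P (A - E r) \<le> (1 + r) * (k * (c * measure M ?b))" using r by simp
    also have "\<dots> = k * ((1 + r) * c) * measure M ?b" by simp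
    also have "\<dots> \<le> e * r * measure M ?b" by (rule mult_right_mono[OF kc]) simp
    finally have b3: "(1 + r) * measure P (A - E r) \<le> e * r * measure M ?b" .
    have "measure N (A - E r) \<le> measure P (A - E r)" "measure M (A - E r) \<le> measure P (A - E r)" using PA[OF AE(2)] by auto
    moreover have "0 \<le> r * measure P (A - E r)" using r by simp
    moreover have "0 \<le> measure P (A - E r)" by simp
    moreover have "r * measure M (A - E r) \<le> r * measure P (A - E r)" if "measure M (A - E r) \<le> measure P (A - E r)"
      using that r by simp
    ultimately have b4: "measure N (A - E r) \<le> (1 + r) * measure P (A - E r)" "r * measure M (A - E r) \<le> (1 + r) * measure P (A - E r)"
      unfolding distrib_right mult_1 by linarith+
    have nn: "measure N (A - E r) \<ge> 0" "r * measure M (A - E r) \<ge> 0" using r by simp_all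
    define Z where "Z = e * r * measure M ?b"
    have "Z \<ge> 0" unfolding Z_def using e r by simp
    moreover have "measure N (A - E r) \<le> Z" "r * measure M (A - E r) \<le> Z" using b3 b4 unfolding Z_def by linarith+
    moreover have "measure N A - r * measure M A = (measure N (A \<inter> E r) - r * measure M (A \<inter> E r)) +
        (measure N (A - E r) - r * measure M (A - E r))" using s by (simp add: distrib_left)
    ultimately have "\<bar>measure N A - r * measure M A\<bar> \<le> 2 * Z" using b1(1) b2 nn unfolding Z_def[symmetric] by linarith
    then show ?thesis unfolding Z_def by (simp add: mult.assoc)
  qed
  show ?thesis by (rule that[OF uv(1,2) r(1) main])
qed

end

section \<open>Two marked conformal families over the same free group\<close>

locale marked_conformal = marked_cover G T p b x\<^sub>0 \<alpha> + conformal_cover G T p \<delta> \<mu>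
  for G :: "'v graph" and T :: "'t graph" and p :: "'t \<Rightarrow> 'v" and b :: nat and x\<^sub>0 :: 't
    and \<alpha> :: "letter list \<Rightarrow> 't \<Rightarrow> 't" and \<delta> :: real and \<mu> :: "'t \<Rightarrow> 't tree_end measure"

text \<open>The map \<open>F\<close> below takes a vertex to the translate of \<open>x\<^sub>0'\<close> by the deck transformation that
  has, in the second marking, the word of the vertex in the first. Its extension \<open>\<Psi>\<close> is the
  homeomorphism between the spaces of ends that the boundary maps induce (\<open>boundary_\<Psi>\<close>); \<open>F'\<close> and
  \<open>\<Psi>'\<close> are the same with the roles of the trees exchanged.\<close>

locale conf_pair = A: marked_conformal G T p b x\<^sub>0 \<alpha> \<delta> \<mu> + B: marked_conformal G' T' p' b x\<^sub>0' \<alpha>' \<delta> \<mu>'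
  for G :: "'v graph" and T :: "'t graph" and p :: "'t \<Rightarrow> 'v" and b :: nat and x\<^sub>0 :: 't
    and \<alpha> :: "letter list \<Rightarrow> 't \<Rightarrow> 't" and \<delta> :: real and \<mu> :: "'t \<Rightarrow> 't tree_end measure"
    and G' :: "'w graph" and T' :: "'s graph" and p' :: "'s \<Rightarrow> 'w" and x\<^sub>0' :: 's
    and \<alpha>' :: "letter list \<Rightarrow> 's \<Rightarrow> 's" and \<mu>' :: "'s \<Rightarrow> 's tree_end measure"
begin

abbreviation "F \<equiv> \<lambda>y. \<alpha>' (A.word_of y) x\<^sub>0'"
abbreviation "F' \<equiv> \<lambda>y. \<alpha> (B.word_of y) x\<^sub>0"
abbreviation "\<Psi> \<equiv> end_extension T T' F"
abbreviation "\<Psi>' \<equiv> end_extension T' T F'"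

lemma AB: "two_trees T T'" and BA: "two_trees T' T" by unfold_locales

sublocale AB: two_trees T T' by (rule AB)
sublocale BA: two_trees T' T by (rule BA)

lemma pair_sym: "conf_pair G' T' p' b x\<^sub>0' \<alpha>' \<delta> \<mu>' G T p x\<^sub>0 \<alpha> \<mu>" by unfold_locales

lemma F_coarse: "coarse T T' F"
  by (rule coarse_comp[OF A.tree_graph_axioms A.C.tree_graph_axioms B.tree_graph_axioms A.word_of_coarse B.orbit_map_coarse])

lemma F_V: "y \<in> A.V \<Longrightarrow> F y \<in> B.V"
  using F_coarse unfolding coarse_def by blast

lemma F_equiv: assumes "g \<in> A.W" "y \<in> A.V" shows "F (\<alpha> g y) = \<alpha>' g (F y)"
  using A.word_of_equiv[OF assms] B.\<alpha>_mult[OF assms(1) A.word_of(1)[OF assms(2)] B.x0] by simp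

lemma F'F_close: obtains D where "\<And>y. y \<in> A.V \<Longrightarrow> A.d (F' (F y)) y \<le> D"
proof -
  let ?z = "\<alpha> (B.word_of x\<^sub>0') x\<^sub>0"
  note lW = B.word_of(1)[OF B.x0]
  have zV: "?z \<in> A.V" by (rule A.\<alpha>_V[OF lW A.x0])
  have "A.d (F' (F y)) y \<le> Max ((\<lambda>v. A.d ?z (A.\<sigma> v)) ` verts G)" if y: "y \<in> A.V" for y
  proof -
    note l = A.word_of[OF y]
    have sV: "A.\<sigma> (p y) \<in> A.V" using A.\<sigma>[OF A.p_V[OF y]] by simp
    have "F' (F y) = \<alpha> (A.word_of y) ?z" using B.word_of_equiv[OF l(1) B.x0] A.\<alpha>_mult[OF l(1) lW A.x0] by simp
    then have "A.d (F' (F y)) y = A.d ?z (A.\<sigma> (p y))" using A.\<alpha>_dist[OF l(1) zV sV] l(2) by simp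
    also have "\<dots> \<le> Max ((\<lambda>v. A.d ?z (A.\<sigma> v)) ` verts G)" by (rule Max_ge) (use A.finG A.p_V[OF y] in auto)
    finally show ?thesis .
  qed
  then show ?thesis using that by blast
qed

lemma \<Psi>_ends: "\<xi> \<in> ends T \<Longrightarrow> \<Psi> \<xi> \<in> ends T'"
  by (rule AB.ext_lim(1)[OF F_coarse])

end

context conf_pair
begin

lemma F'_coarse: "coarse T' T F'"
proof -
  interpret s: conf_pair G' T' p' b x\<^sub>0' \<alpha>' \<delta> \<mu>' G T p x\<^sub>0 \<alpha> \<mu> by (rule pair_sym)
  show ?thesis by (rule s.F_coarse)
qed

lemma \<Psi>'_\<Psi>: assumes "\<xi> \<in> ends T" shows "\<Psi>' (\<Psi> \<xi>) = \<xi>"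
proof -
  obtain D where D: "\<And>y. y \<in> A.V \<Longrightarrow> A.d (F' (F y)) y \<le> D" using F'F_close by blast
  show ?thesis by (rule ext_inverse[OF A.locally_finite_tree_axioms B.locally_finite_tree_axioms F_coarse F'_coarse assms D])
qed

end

context conf_pair
begin

lemma \<Psi>'_ends: "\<eta> \<in> ends T' \<Longrightarrow> \<Psi>' \<eta> \<in> ends T"
  by (rule BA.ext_lim(1)[OF F'_coarse])

lemma \<Psi>_\<Psi>': assumes "\<eta> \<in> ends T'" shows "\<Psi> (\<Psi>' \<eta>) = \<eta>"
proof -
  interpret s: conf_pair G' T' p' b x\<^sub>0' \<alpha>' \<delta> \<mu>' G T p x\<^sub>0 \<alpha> \<mu> by (rule pair_sym)
  show ?thesis by (rule s.\<Psi>'_\<Psi>[OF assms])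
qed

lemma FF'_close: obtains D where "\<And>y. y \<in> B.V \<Longrightarrow> B.d (F (F' y)) y \<le> D"
proof -
  interpret s: conf_pair G' T' p' b x\<^sub>0' \<alpha>' \<delta> \<mu>' G T p x\<^sub>0 \<alpha> \<mu> by (rule pair_sym)
  show ?thesis using that s.F'F_close by blast
qed

lemma \<Psi>_image: assumes "A \<subseteq> ends T" shows "\<Psi> ` A = \<Psi>' -` A \<inter> ends T'"
proof (intro equalityI subsetI)
  fix \<eta> assume "\<eta> \<in> \<Psi> ` A"
  then show "\<eta> \<in> \<Psi>' -` A \<inter> ends T'" using assms \<Psi>'_\<Psi> \<Psi>_ends by auto
next
  fix \<eta> assume "\<eta> \<in> \<Psi>' -` A \<inter> ends T'"
  then have "\<Psi>' \<eta> \<in> A" "\<eta> = \<Psi> (\<Psi>' \<eta>)" using \<Psi>_\<Psi>' by auto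
  then show "\<eta> \<in> \<Psi> ` A" by blast
qed

lemma \<Psi>'_measurable: "y \<in> B.V \<Longrightarrow> \<Psi>' \<in> measurable (\<mu>' y) (end_borel T)"
  using BA.ext_measurable[OF F'_coarse B.locally_finite_tree_axioms] measurable_cong_sets[OF B.\<mu>_sets refl] by blast

lemma \<Psi>_sets: assumes "A \<in> sets (end_borel T)" shows "\<Psi> ` A \<in> sets (end_borel T')"
  using measurable_sets[OF BA.ext_measurable[OF F'_coarse B.locally_finite_tree_axioms] assms] \<Psi>_image[OF A.end_borel_sub[OF assms]]
  by (simp add: B.space_end_borel)

lemma boundary_\<Psi>: assumes "\<xi> \<in> ends T"
  shows "boundary_map b T' x\<^sub>0' \<alpha>' (\<Psi> \<xi>) = boundary_map b T x\<^sub>0 \<alpha> \<xi>"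
proof -
  let ?\<eta> = "end_extension T A.C A.word_of \<xi>"
  have \<eta>: "?\<eta> \<in> ends A.C" by (rule A.TC.ext_lim(1)[OF A.word_of_coarse assms])
  have "filterlim F (to_end T' (end_extension A.C T' B.orbit_map ?\<eta>)) (to_end T \<xi>)"
    by (rule ext_comp[OF A.TC.two_trees_axioms B.CT.two_trees_axioms A.word_of_coarse B.orbit_map_coarse assms])
  then have "\<Psi> \<xi> = end_extension A.C T' B.orbit_map ?\<eta>"
    by (rule AB.ext_eqI[OF assms B.CT.ext_lim(1)[OF B.orbit_map_coarse \<eta>]])
  then show ?thesis
    using B.boundary_map_ext[OF \<Psi>_ends[OF assms]] A.boundary_map_ext[OF assms] B.ext_word_of_orbit_map[OF \<eta>] by simp
qed

text \<open>Both sides are limits of the same values of \<open>F\<close> along \<open>\<xi>\<close>, by equivariance of \<open>F\<close>.\<close>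

lemma \<Psi>_equiv: assumes g: "g \<in> A.W" and \<xi>: "\<xi> \<in> ends T"
  shows "\<Psi> (end_map (\<alpha> g) \<xi>) = end_map (\<alpha>' g) (\<Psi> \<xi>)"
proof -
  interpret a: tree_iso T T "\<alpha> g" by (rule A.\<alpha>_iso[OF g])
  interpret a': tree_iso T' T' "\<alpha>' g" by (rule B.\<alpha>_iso[OF g])
  have e: "end_map (\<alpha> g) \<xi> \<in> ends T" "end_map (\<alpha>' g) (\<Psi> \<xi>) \<in> ends T'"
    by (rule a.iso_end[OF \<xi>], rule a'.iso_end[OF \<Psi>_ends[OF \<xi>]])
  have 1: "filterlim (\<lambda>z. F (\<alpha> g z)) (to_end T' (\<Psi> (end_map (\<alpha> g) \<xi>))) (to_end T \<xi>)"
    by (rule filterlim_compose[OF AB.ext_lim(2)[OF F_coarse e(1)] a.iso_filterlim[OF \<xi>]])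
  have 2: "filterlim (\<lambda>z. \<alpha>' g (F z)) (to_end T' (end_map (\<alpha>' g) (\<Psi> \<xi>))) (to_end T \<xi>)"
    by (rule filterlim_compose[OF a'.iso_filterlim[OF \<Psi>_ends[OF \<xi>]] AB.ext_lim(2)[OF F_coarse \<xi>]])
  have "eventually (\<lambda>z. \<alpha>' g (F z) = F (\<alpha> g z)) (to_end T \<xi>)"
    by (rule eventually_mono[OF A.eventually_V[OF \<xi>]]) (rule F_equiv[OF g, symmetric])
  then have "filterlim (\<lambda>z. F (\<alpha> g z)) (to_end T' (end_map (\<alpha>' g) (\<Psi> \<xi>))) (to_end T \<xi>)"
    using filterlim_cong[OF refl refl, of "\<lambda>z. \<alpha>' g (F z)" "\<lambda>z. F (\<alpha> g z)"] 2 by blast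
  then show ?thesis
    by (rule B.to_end_unique[OF \<Psi>_ends[OF e(1)] e(2) A.to_end_nontrivial[OF \<xi>] 1])
qed

definition pulled_measure :: "'s \<Rightarrow> 't tree_end set \<Rightarrow> real" where
  "pulled_measure q A = measure (\<mu>' q) (\<Psi> ` A)"

lemma pulled_measure_equiv:
  assumes g: "g \<in> A.W" and q: "q \<in> B.V" and A: "A \<in> sets (end_borel T)"
  shows "pulled_measure (\<alpha>' g q) (end_map (\<alpha> g) ` A) = pulled_measure q A"
proof -
  have "\<Psi> ` (end_map (\<alpha> g) ` A) = end_map (\<alpha>' g) ` (\<Psi> ` A)"
    unfolding image_image by (rule image_cong) (use \<Psi>_equiv[OF g] A.end_borel_sub[OF A] in auto)
  then show ?thesis unfolding pulled_measure_def using B.\<mu>_equiv_image[OF q B.\<alpha>_deck[OF g] \<Psi>_sets[OF A]] by simp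
qed

lemma pulled_measure_const:
  assumes q: "q1 \<in> B.V" "q2 \<in> B.V" and A: "A \<in> sets (end_borel T)"
    and c: "\<And>\<xi>. \<xi> \<in> A \<Longrightarrow> busemann T' (\<Psi> \<xi>) q1 q2 = c"
  shows "pulled_measure q1 A = exp (- \<delta> * c) * pulled_measure q2 A"
  unfolding pulled_measure_def by (rule B.\<mu>_const[OF q \<Psi>_sets[OF A]]) (use c in blast)

text \<open>The set of ends beyond an edge is open, and so is its image, which therefore contains the
  ends beyond some edge of the second tree.\<close>

lemma pulled_measure_pos: assumes uv: "adj T u v" and q: "q \<in> B.V" shows "pulled_measure q (half_ends T u v) > 0"
proof -
  interpret finite_measure "\<mu>' q" by (rule B.\<mu>_finite[OF q])
  obtain \<xi> where \<xi>: "\<xi> \<in> half_ends T u v" using A.half_ends_nonempty[OF uv] by blast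
  note \<xi>e = A.half_ends_ends[OF \<xi>]
  obtain a c where ac: "adj T' a c" "\<Psi> \<xi> \<in> half_ends T' a c" "\<And>\<eta>. \<eta> \<in> half_ends T' a c \<Longrightarrow> \<Psi>' \<eta> \<in> half_ends T u v"
    using BA.ext_cont[OF F'_coarse \<Psi>_ends[OF \<xi>e] uv] \<Psi>'_\<Psi>[OF \<xi>e] \<xi> by metis
  have "half_ends T' a c \<subseteq> \<Psi> ` half_ends T u v"
    unfolding \<Psi>_image[OF A.end_borel_sub[OF A.half_ends_sets[OF uv]]] using ac(3) B.half_ends_ends by blast
  then have "measure (\<mu>' q) (half_ends T' a c) \<le> pulled_measure q (half_ends T u v)" unfolding pulled_measure_def
    by (rule finite_measure_mono) (use \<Psi>_sets[OF A.half_ends_sets[OF uv]] B.\<mu>_sets[OF q] in simp)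
  then show ?thesis using B.\<mu>_half_ends_pos[OF ac(1) q] by linarith
qed

section \<open>Distant base points are seen through a bounded set\<close>

text \<open>If \<open>F w\<close> is farther than \<open>R\<close> from \<open>F u\<close>, let \<open>{q, q1}\<close> be the edge through which the
  geodesic from \<open>F u\<close> to \<open>F w\<close> leaves the ball of radius \<open>R\<close>. The half-tree behind it stays away
  from \<open>F u\<close>, so \<open>F'\<close> maps it to one side of the edge \<open>{u, v}\<close>, namely the side of \<open>w\<close>. Ends
  beyond \<open>{u, v}\<close> are therefore not mapped behind \<open>{q, q1}\<close>, and rays from \<open>F w\<close> to their images
  pass through \<open>q1\<close>.\<close>

lemma shadow_point:
  obtains R where "\<And>u v w. adj T u v \<Longrightarrow> w \<in> half_tree T v u \<Longrightarrow>
     \<exists>q\<in>B.V. B.d q (F u) \<le> R \<and> (\<forall>\<eta>\<in>half_ends T u v. busemann T' (\<Psi> \<eta>) (F w) q = real (B.d (F w) q))"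
proof -
  obtain L1 where L1: "\<And>x y. x \<in> A.V \<Longrightarrow> y \<in> A.V \<Longrightarrow> B.d (F x) (F y) \<le> L1 * A.d x y"
    using coarse_lip[OF A.tree_graph_axioms B.tree_graph_axioms F_coarse] by blast
  obtain L2 where L2: "\<And>a c. adj T' a c \<Longrightarrow> A.d (F' a) (F' c) \<le> L2" using F'_coarse unfolding coarse_def by blast
  have F'V: "F' ` B.V \<subseteq> A.V" using F'_coarse unfolding coarse_def by blast
  obtain D1 where D1: "\<And>y. y \<in> A.V \<Longrightarrow> A.d (F' (F y)) y \<le> D1" using F'F_close by blast
  obtain D2 where D2: "\<And>y. y \<in> B.V \<Longrightarrow> B.d (F (F' y)) y \<le> D2" using FF'_close by blast
  \<comment> \<open>large enough for two steps below: \<open>F'\<close> moves the half-tree behind \<open>q\<close> away from \<open>u\<close>, and \<open>w\<close>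
    is not so close to \<open>u\<close> that \<open>F' (F w)\<close> could lie across the edge\<close>
  define R where "R = D2 + L1 * L2 + L1 * D1"
  have "\<exists>q\<in>B.V. B.d q (F u) \<le> Suc R \<and> (\<forall>\<eta>\<in>half_ends T u v. busemann T' (\<Psi> \<eta>) (F w) q = real (B.d (F w) q))"
    if uv: "adj T u v" and w: "w \<in> half_tree T v u" for u v w
  proof (cases "B.d (F u) (F w) \<le> R")
    case True
    have wV: "F w \<in> B.V" using F_V A.half_V[OF w] by blast
    have "busemann T' (\<Psi> \<eta>) (F w) (F w) = real (B.d (F w) (F w))" if "\<eta> \<in> half_ends T u v" for \<eta>
      using B.busemann_self[OF \<Psi>_ends[OF A.half_ends_ends[OF that]] wV] by simp
    then show ?thesis using wV True B.dist_sym by (intro bexI[of _ "F w"]) auto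
  next
    case False
    let ?n = "B.d (F u) (F w)"
    have V: "u \<in> A.V" "w \<in> A.V" "F u \<in> B.V" "F w \<in> B.V" using A.adj_verts[OF uv] A.half_V[OF w] F_V by auto
    obtain f where f: "f 0 = F u" "f ?n = F w" "\<And>i. i < ?n \<Longrightarrow> adj T' (f i) (f (Suc i))"
      "\<And>i. i \<le> ?n \<Longrightarrow> f i \<in> B.V" "\<And>i. i \<le> ?n \<Longrightarrow> B.d (F u) (f i) = i" "\<And>i. i \<le> ?n \<Longrightarrow> B.d (f i) (F w) = ?n - i"
      by (rule B.geodesic[OF V(3,4)]) blast
    define q q1 where "q = f R" and "q1 = f (Suc R)"
    have qq: "adj T' q q1" using f(3)[of R] False by (simp add: q_def q1_def)
    have dq: "B.d (F u) q = R" "B.d (F u) q1 = Suc R" "B.d q (F w) = ?n - R" "B.d q1 (F w) = ?n - Suc R"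
      using f(5,6) False by (simp_all add: q_def q1_def)
    have u1: "F u \<in> half_tree T' q1 q" using dq V by (simp add: half_tree_def)
    have w1: "F w \<in> half_tree T' q q1" using dq V False B.dist_sym[of "F w"] by (simp add: half_tree_def Suc_diff_Suc)
    have far: "A.d (F' t) u > L2" if t: "t \<in> half_tree T' q q1" for t
    proof (rule ccontr)
      assume "\<not> A.d (F' t) u > L2"
      have tV: "t \<in> B.V" "F' t \<in> A.V" using B.half_V[OF t] F'V by auto
      have "B.d (F u) t = B.d (F u) q + 1 + B.d q1 t" by (rule B.half_dist[OF qq u1 t])
      then have "B.d (F u) t > R" using dq by simp
      moreover have "B.d (F u) t \<le> B.d (F u) (F (F' t)) + B.d (F (F' t)) t"
        by (rule B.dist_triangle) (use V tV F_V in auto)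
      moreover have "B.d (F u) (F (F' t)) \<le> L1 * A.d u (F' t)" by (rule L1[OF V(1) tV(2)])
      moreover have "L1 * A.d u (F' t) \<le> L1 * L2" using \<open>\<not> A.d (F' t) u > L2\<close> A.dist_sym[of u] by simp
      moreover have "B.d (F (F' t)) t \<le> D2" by (rule D2[OF tV(1)])
      ultimately show False unfolding R_def by simp
    qed
    have side: "F' ` half_tree T' q q1 \<subseteq> half_tree T u v \<or> F' ` half_tree T' q q1 \<subseteq> half_tree T v u"
      by (rule BA.side_const[OF F'V L2 qq uv far])
    have "\<not> F' ` half_tree T' q q1 \<subseteq> half_tree T u v"
    proof
      assume "F' ` half_tree T' q q1 \<subseteq> half_tree T u v"
      then have "F' (F w) \<in> half_tree T u v" using w1 by blast
      then have "A.d w (F' (F w)) = A.d w u + 1 + A.d v (F' (F w))" by (rule A.half_dist[OF uv w])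
      then have "A.d u w \<le> D1" using D1[OF V(2)] A.dist_sym[of w] by simp
      then have "L1 * A.d u w \<le> L1 * D1" by (rule mult_le_mono2)
      then have "?n \<le> L1 * D1" using L1[OF V(1,2)] by (rule order_trans[rotated])
      then show False using False unfolding R_def by simp
    qed
    then have side': "F' ` half_tree T' q q1 \<subseteq> half_tree T v u" using side by blast
    have "busemann T' (\<Psi> \<eta>) (F w) q1 = real (B.d (F w) q1)" if \<eta>: "\<eta> \<in> half_ends T u v" for \<eta>
    proof -
      note \<eta>e = A.half_ends_ends[OF \<eta>]
      have "\<Psi> \<eta> \<notin> half_ends T' q q1"
      proof
        assume "\<Psi> \<eta> \<in> half_ends T' q q1"
        then have "\<Psi>' (\<Psi> \<eta>) \<in> half_ends T v u" by (rule BA.ext_side[OF F'_coarse qq adj_sym[OF uv] side'])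
        then show False using \<Psi>'_\<Psi>[OF \<eta>e] \<eta> A.half_ends_not[OF uv \<eta>e] by simp
      qed
      then have "\<Psi> \<eta> \<in> half_ends T' q1 q" using B.half_ends_not[OF qq \<Psi>_ends[OF \<eta>e]] by blast
      then show ?thesis by (rule B.busemann_half_ends[OF adj_sym[OF qq] _ w1])
    qed
    moreover have "q1 \<in> B.V" using B.adj_verts[OF qq] by simp
    ultimately show ?thesis using dq(2) B.dist_sym[of q1] by (intro bexI[of _ q1]) auto
  qed
  then show ?thesis using that by blast
qed

end

section \<open>Proportionality on cylinders\<close>

locale conf_pair_ac = conf_pair G T p b x\<^sub>0 \<alpha> \<delta> \<mu> G' T' p' x\<^sub>0' \<alpha>' \<mu>'
  for G :: "'v graph" and T :: "'t graph" and p :: "'t \<Rightarrow> 'v" and b :: nat and x\<^sub>0 :: 't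
    and \<alpha> :: "letter list \<Rightarrow> 't \<Rightarrow> 't" and \<delta> :: real and \<mu> :: "'t \<Rightarrow> 't tree_end measure"
    and G' :: "'w graph" and T' :: "'s graph" and p' :: "'s \<Rightarrow> 'w" and x\<^sub>0' :: 's
    and \<alpha>' :: "letter list \<Rightarrow> 's \<Rightarrow> 's" and \<mu>' :: "'s \<Rightarrow> 's tree_end measure" +
  assumes ac: "\<lbrakk>x \<in> verts T; y \<in> verts T'; A \<in> sets (end_borel T); measure (\<mu> x) A = 0\<rbrakk> \<Longrightarrow> measure (\<mu>' y) (\<Psi> ` A) = 0"
begin

text \<open>The cylinder of \<open>density_cylinder\<close> for a conformal measure on the first tree and one pulled
  back from the second.\<close>

lemma almost_proportional:
  assumes e: "0 < e" "e \<le> (1::real)"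
  obtains u v r where "adj T u v" "x\<^sub>0 \<in> half_tree T v u" "r > 0"
    "\<And>A. A \<in> sets (end_borel T) \<Longrightarrow> A \<subseteq> half_ends T u v \<Longrightarrow>
       \<bar>pulled_measure (F x\<^sub>0) A - r * measure (\<mu> x\<^sub>0) A\<bar> \<le> 2 * e * r * measure (\<mu> x\<^sub>0) (half_ends T u v)"
proof -
  have q: "F x\<^sub>0 \<in> B.V" by (rule F_V[OF A.x0])
  interpret m: finite_measure "\<mu> x\<^sub>0" by (rule A.\<mu>_finite[OF A.x0])
  interpret m': finite_measure "\<mu>' (F x\<^sub>0)" by (rule B.\<mu>_finite[OF q])
  define N where "N = distr (\<mu>' (F x\<^sub>0)) (end_borel T) \<Psi>'"
  have NA: "measure N A = pulled_measure (F x\<^sub>0) A" if "A \<in> sets (end_borel T)" for A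
    unfolding N_def pulled_measure_def measure_distr[OF \<Psi>'_measurable[OF q] that] B.\<mu>_space[OF q] \<Psi>_image[OF A.end_borel_sub[OF that]] ..
  have Nf: "finite_measure N" unfolding N_def by (rule m'.finite_measure_distr[OF \<Psi>'_measurable[OF q]])
  interpret N: finite_measure N by (rule Nf)
  have Ns: "sets N = sets (end_borel T)" by (simp add: N_def)
  have acN: "absolutely_continuous (\<mu> x\<^sub>0) N"
    unfolding absolutely_continuous_def
  proof
    fix A assume "A \<in> null_sets (\<mu> x\<^sub>0)"
    then have A: "A \<in> sets (end_borel T)" "measure (\<mu> x\<^sub>0) A = 0" using A.\<mu>_sets[OF A.x0] by (auto simp: measure_def)
    have "measure N A = 0" using NA[OF A(1)] ac[OF A.x0 q A] by (simp add: pulled_measure_def)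
    then show "A \<in> null_sets N" using A(1) Ns by (auto simp: N.emeasure_eq_measure)
  qed
  have "measure N (ends T) > 0"
  proof -
    obtain u v where uv: "adj T u v" by (rule A.edge_ex)
    have "0 < measure N (half_ends T u v)" using NA[OF A.half_ends_sets[OF uv]] pulled_measure_pos[OF uv q] by simp
    also have "\<dots> \<le> measure N (ends T)"
    proof (rule N.finite_measure_mono)
      show "half_ends T u v \<subseteq> ends T" using A.half_ends_ends by blast
      show "ends T \<in> sets N" using Ns sets.top[of "end_borel T"] A.space_end_borel by simp
    qed
    finally show ?thesis .
  qed
  then obtain u v r where h: "adj T u v" "x\<^sub>0 \<in> half_tree T v u" "r > 0"
    "\<And>A. A \<in> sets (end_borel T) \<Longrightarrow> A \<subseteq> half_ends T u v \<Longrightarrow>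
       \<bar>measure N A - r * measure (\<mu> x\<^sub>0) A\<bar> \<le> 2 * e * r * measure (\<mu> x\<^sub>0) (half_ends T u v)"
    by (rule A.density_cylinder[OF A.x0 m.finite_measure_axioms A.\<mu>_sets[OF A.x0] Nf Ns acN _ e]) blast
  show ?thesis by (rule that[OF h(1,2,3)]) (use h(4) NA in metis)
qed

definition proportional_at :: "'t \<Rightarrow> 't \<Rightarrow> 's \<Rightarrow> bool" where
  "proportional_at u v q \<longleftrightarrow> q \<in> B.V \<and> (\<exists>t>0. \<forall>A\<in>sets (end_borel T). A \<subseteq> half_ends T u v \<longrightarrow> pulled_measure q A = t * measure (\<mu> u) A)"

text \<open>A translation that moves the cylinder of \<open>almost_proportional\<close> to one of finitely many
  edges \<open>(u0, v0)\<close> does not change the correspondence \<open>\<Psi>\<close>; it moves the base vertex \<open>F x\<^sub>0\<close> of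
  the second measure to some \<open>F w\<close>, which \<open>shadow_point\<close> replaces by a vertex \<open>q\<close> near \<open>F u0\<close>. So
  for every error \<open>e\<close> one of finitely many triples \<open>(u0, v0, q)\<close> does (\<open>P e\<close>), hence one triple
  does for all errors, and on its cylinder the measures are exactly proportional.\<close>

lemma proportional_somewhere: "\<exists>u v q. adj T u v \<and> proportional_at u v q"
proof -
  obtain R where R: "\<And>u v w. adj T u v \<Longrightarrow> w \<in> half_tree T v u \<Longrightarrow>
     \<exists>q\<in>B.V. B.d q (F u) \<le> R \<and> (\<forall>\<eta>\<in>half_ends T u v. busemann T' (\<Psi> \<eta>) (F w) q = real (B.d (F w) q))"
    using shadow_point by blast
  define Fin where "Fin = {(u, v, q). u \<in> A.\<sigma> ` verts G \<and> v \<in> nbhd T u \<and> q \<in> {q \<in> B.V. B.d (F u) q \<le> R}}"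
  define P where "P e = (\<lambda>(u, v, q). \<exists>t>0. \<forall>A\<in>sets (end_borel T). A \<subseteq> half_ends T u v \<longrightarrow>
      \<bar>pulled_measure q A - t * measure (\<mu> u) A\<bar> \<le> 2 * e * t * measure (\<mu> u) (half_ends T u v))" for e :: real
  have \<sigma>V: "u \<in> A.V" if "u \<in> A.\<sigma> ` verts G" for u using that A.\<sigma> by auto
  have finFin: "finite Fin"
  proof -
    have "Fin \<subseteq> (\<Union>u\<in>A.\<sigma> ` verts G. {u} \<times> nbhd T u \<times> {q \<in> B.V. B.d (F u) q \<le> R})" unfolding Fin_def by auto
    moreover have "finite \<dots>" using A.finG A.fin_nbhd[OF \<sigma>V] B.ball_finite[OF F_V[OF \<sigma>V]] by blast
    ultimately show ?thesis by (rule finite_subset)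
  qed
  have ex: "\<exists>z\<in>Fin. P e z" if e: "0 < e" "e \<le> 1" for e :: real
  proof -
    obtain u v r where h: "adj T u v" "x\<^sub>0 \<in> half_tree T v u" "r > 0"
      "\<And>A. A \<in> sets (end_borel T) \<Longrightarrow> A \<subseteq> half_ends T u v \<Longrightarrow>
         \<bar>pulled_measure (F x\<^sub>0) A - r * measure (\<mu> x\<^sub>0) A\<bar> \<le> 2 * e * r * measure (\<mu> x\<^sub>0) (half_ends T u v)"
      by (rule almost_proportional[OF e]) blast
    have V: "u \<in> A.V" "v \<in> A.V" using A.adj_verts[OF h(1)] by auto
    define g where "g = A.word_of u"
    have g: "g \<in> A.W" unfolding g_def by (rule A.word_of(1)[OF V(1)])
    obtain k where k: "k \<in> A.W" "\<And>z. z \<in> A.V \<Longrightarrow> \<alpha> k (\<alpha> g z) = z" "\<And>z. z \<in> A.V \<Longrightarrow> \<alpha> g (\<alpha> k z) = z"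
      by (rule A.W_inv[OF g]) blast
    interpret a: tree_iso T T "\<alpha> g" by (rule A.\<alpha>_iso[OF g])
    interpret ak: tree_iso T T "\<alpha> k" by (rule A.\<alpha>_iso[OF k(1)])
    define u0 v0 w where "u0 = A.\<sigma> (p u)" and "v0 = \<alpha> k v" and "w = \<alpha> k x\<^sub>0"
    have u0V: "u0 \<in> A.V" unfolding u0_def using A.\<sigma>[OF A.p_V[OF V(1)]] by simp
    have gu0: "\<alpha> g u0 = u" unfolding g_def u0_def by (rule A.word_of(2)[OF V(1)])
    have ku: "\<alpha> k u = u0" using k(2)[OF u0V] gu0 by simp
    have gv0: "\<alpha> g v0 = v" unfolding v0_def by (rule k(3)[OF V(2)])
    have uv0: "adj T u0 v0" using ak.iso_adj'[OF h(1)] ku by (simp add: v0_def)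
    have v0V: "v0 \<in> A.V" using A.adj_verts[OF uv0] by simp
    have w: "w \<in> half_tree T v0 u0" using ak.iso_half[OF V(2,1)] h(2) ku unfolding w_def v0_def by blast
    have wV: "w \<in> A.V" by (rule A.half_V[OF w])
    obtain q where q: "q \<in> B.V" "B.d q (F u0) \<le> R" "\<And>\<eta>. \<eta> \<in> half_ends T u0 v0 \<Longrightarrow> busemann T' (\<Psi> \<eta>) (F w) q = real (B.d (F w) q)"
      using R[OF uv0 w] by blast
    define D where "D = real (A.d x\<^sub>0 u)"
    define D' where "D' = real (B.d (F w) q)"
    define t where "t = r * exp (- \<delta> * D) * exp (\<delta> * D')"
    have tpos: "t > 0" unfolding t_def using h(3) by simp
    have Fw: "\<alpha>' g (F w) = F x\<^sub>0" using F_equiv[OF g wV] k(3)[OF A.x0] by (simp add: w_def)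
    have FwV: "F w \<in> B.V" by (rule F_V[OF wV])
    have key: "pulled_measure (F x\<^sub>0) (end_map (\<alpha> g) ` A) = exp (- \<delta> * D') * pulled_measure q A \<and>
        measure (\<mu> x\<^sub>0) (end_map (\<alpha> g) ` A) = exp (- \<delta> * D) * measure (\<mu> u0) A \<and>
        end_map (\<alpha> g) ` A \<in> sets (end_borel T) \<and> end_map (\<alpha> g) ` A \<subseteq> half_ends T u v"
      if A: "A \<in> sets (end_borel T)" "A \<subseteq> half_ends T u0 v0" for A
    proof -
      have s: "end_map (\<alpha> g) ` A \<in> sets (end_borel T)" by (rule a.end_map_sets[OF A(1)])
      have sub: "end_map (\<alpha> g) ` A \<subseteq> half_ends T u v" using a.iso_half_ends_image[OF u0V v0V] gu0 gv0 A(2) by auto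
      have "pulled_measure (F x\<^sub>0) (end_map (\<alpha> g) ` A) = pulled_measure (F w) A" using pulled_measure_equiv[OF g FwV A(1)] Fw by simp
      also have "\<dots> = exp (- \<delta> * D') * pulled_measure q A" unfolding D'_def by (rule pulled_measure_const[OF FwV q(1) A(1)]) (use q(3) A(2) in blast)
      finally have 1: "pulled_measure (F x\<^sub>0) (end_map (\<alpha> g) ` A) = exp (- \<delta> * D') * pulled_measure q A" .
      have "measure (\<mu> x\<^sub>0) (end_map (\<alpha> g) ` A) = exp (- \<delta> * D) * measure (\<mu> u) (end_map (\<alpha> g) ` A)"
        unfolding D_def by (rule A.\<mu>_away[OF h(1,2) s sub])
      also have "measure (\<mu> u) (end_map (\<alpha> g) ` A) = measure (\<mu> u0) A"
        using A.\<mu>_equiv_image[OF u0V A.\<alpha>_deck[OF g] A(1)] gu0 by simp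
      finally show ?thesis using 1 s sub by simp
    qed
    have img: "end_map (\<alpha> g) ` half_ends T u0 v0 = half_ends T u v" using a.iso_half_ends_image[OF u0V v0V] gu0 gv0 by simp
    have "\<bar>pulled_measure q A - t * measure (\<mu> u0) A\<bar> \<le> 2 * e * t * measure (\<mu> u0) (half_ends T u0 v0)"
      if A: "A \<in> sets (end_borel T)" "A \<subseteq> half_ends T u0 v0" for A
    proof -
      have b: "measure (\<mu> x\<^sub>0) (half_ends T u v) = exp (- \<delta> * D) * measure (\<mu> u0) (half_ends T u0 v0)"
        using key[OF A.half_ends_sets[OF uv0] subset_refl] img by simp
      have "\<bar>exp (- \<delta> * D') * pulled_measure q A - r * (exp (- \<delta> * D) * measure (\<mu> u0) A)\<bar>
          \<le> 2 * e * r * (exp (- \<delta> * D) * measure (\<mu> u0) (half_ends T u0 v0))"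
        using h(4)[of "end_map (\<alpha> g) ` A"] key[OF A] b by simp
      then have "exp (\<delta> * D') * \<bar>exp (- \<delta> * D') * pulled_measure q A - r * (exp (- \<delta> * D) * measure (\<mu> u0) A)\<bar>
          \<le> exp (\<delta> * D') * (2 * e * r * (exp (- \<delta> * D) * measure (\<mu> u0) (half_ends T u0 v0)))"
        by (intro mult_left_mono) simp_all
      moreover have "exp (\<delta> * D') * \<bar>exp (- \<delta> * D') * pulled_measure q A - r * (exp (- \<delta> * D) * measure (\<mu> u0) A)\<bar>
          = \<bar>pulled_measure q A - t * measure (\<mu> u0) A\<bar>"
      proof -
        have ee: "exp (\<delta> * D') * exp (- \<delta> * D') = 1" by (simp flip: exp_add)
        have "exp (\<delta> * D') * \<bar>z\<bar> = \<bar>exp (\<delta> * D') * z\<bar>" for z by (simp add: abs_mult)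
        moreover have "exp (\<delta> * D') * (exp (- \<delta> * D') * pulled_measure q A - r * (exp (- \<delta> * D) * measure (\<mu> u0) A))
            = (exp (\<delta> * D') * exp (- \<delta> * D')) * pulled_measure q A - t * measure (\<mu> u0) A"
          unfolding t_def by (simp only: right_diff_distrib mult.assoc) (simp only: mult_ac)
        ultimately show ?thesis using ee by simp
      qed
      moreover have "exp (\<delta> * D') * (2 * e * r * (exp (- \<delta> * D) * measure (\<mu> u0) (half_ends T u0 v0)))
          = 2 * e * t * measure (\<mu> u0) (half_ends T u0 v0)" unfolding t_def by (simp only: mult_ac)
      ultimately show ?thesis by (simp only:)
    qed
    then have "P e (u0, v0, q)" unfolding P_def prod.case using tpos by blast
    moreover have "(u0, v0, q) \<in> Fin"
      unfolding Fin_def using A.p_V[OF V(1)] uv0 q(1,2) B.dist_sym[of q] by (auto simp: u0_def nbhd_def)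
    ultimately show ?thesis by blast
  qed
  have mono: "P e' z" if "P e z" "e \<le> e'" for e e' z
  proof -
    obtain u v q where z: "z = (u, v, q)" by (cases z)
    have "\<exists>t>0. \<forall>A\<in>sets (end_borel T). A \<subseteq> half_ends T u v \<longrightarrow>
      \<bar>pulled_measure q A - t * measure (\<mu> u) A\<bar> \<le> 2 * e * t * measure (\<mu> u) (half_ends T u v)"
      using that(1) unfolding P_def z prod.case .
    then obtain t where t: "t > 0" "\<forall>A\<in>sets (end_borel T). A \<subseteq> half_ends T u v \<longrightarrow>
      \<bar>pulled_measure q A - t * measure (\<mu> u) A\<bar> \<le> 2 * e * t * measure (\<mu> u) (half_ends T u v)" by (elim exE conjE)
    have "2 * e * t * measure (\<mu> u) (half_ends T u v) \<le> 2 * e' * t * measure (\<mu> u) (half_ends T u v)"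
      using that(2) t(1) by (intro mult_right_mono) auto
    then have "\<forall>A\<in>sets (end_borel T). A \<subseteq> half_ends T u v \<longrightarrow>
      \<bar>pulled_measure q A - t * measure (\<mu> u) A\<bar> \<le> 2 * e' * t * measure (\<mu> u) (half_ends T u v)" using t(2) by (meson order_trans)
    then show ?thesis unfolding P_def z prod.case using t(1) by blast
  qed
  have "\<exists>z\<in>Fin. \<forall>e. 0 < e \<longrightarrow> P e z"
  proof (rule ccontr)
    assume "\<not> ?thesis"
    then have "\<forall>z\<in>Fin. \<exists>e. 0 < e \<and> \<not> P e z" by blast
    then obtain E where E: "\<And>z. z \<in> Fin \<Longrightarrow> 0 < E z \<and> \<not> P (E z) z" by metis
    define e where "e = Min (insert 1 (E ` Fin))"
    have "0 < e" unfolding e_def using E finFin by (subst Min_gr_iff) auto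
    moreover have "e \<le> 1" unfolding e_def using finFin by (intro Min_le) auto
    ultimately obtain z where z: "z \<in> Fin" "P e z" using ex by blast
    have "e \<le> E z" unfolding e_def using finFin z by (intro Min_le) auto
    then show False using mono[OF z(2)] E[OF z(1)] by blast
  qed
  then obtain u v q where uvq: "(u, v, q) \<in> Fin" "\<And>e. 0 < e \<Longrightarrow> P e (u, v, q)" by auto
  have uv: "adj T u v" and qV: "q \<in> B.V" using uvq(1) unfolding Fin_def nbhd_def by auto
  have uV: "u \<in> A.V" using A.adj_verts[OF uv] by simp
  let ?m = "\<lambda>A. measure (\<mu> u) A" and ?b = "half_ends T u v"
  have mb: "?m ?b > 0" by (rule A.\<mu>_half_ends_pos[OF uv uV])
  \<comment> \<open>the only possible factor; small errors force every approximate factor to be close to it\<close>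
  define t where "t = pulled_measure q ?b / ?m ?b"
  have tpos: "t > 0" unfolding t_def using pulled_measure_pos[OF uv qV] mb by simp
  have lb: "pulled_measure q ?b = t * ?m ?b" unfolding t_def using mb by simp
  have "pulled_measure q A = t * ?m A" if A: "A \<in> sets (end_borel T)" "A \<subseteq> ?b" for A
  proof -
    interpret finite_measure "\<mu> u" by (rule A.\<mu>_finite[OF uV])
    have mA: "?m A \<le> ?m ?b" by (rule finite_measure_mono[OF A(2)]) (use A.half_ends_sets[OF uv] A.\<mu>_sets[OF uV] in simp)
    have small: "\<bar>pulled_measure q A - t * ?m A\<bar> \<le> e * (8 * t * ?m ?b)" if e: "0 < e" "e \<le> 1/4" for e :: real
    proof -
      obtain s where s: "s > 0" "\<And>A. A \<in> sets (end_borel T) \<Longrightarrow> A \<subseteq> ?b \<Longrightarrow> \<bar>pulled_measure q A - s * ?m A\<bar> \<le> 2 * e * s * ?m ?b"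
        using uvq(2)[OF e(1)] unfolding P_def prod.case by blast
      have "\<bar>pulled_measure q ?b - s * ?m ?b\<bar> \<le> 2 * e * s * ?m ?b" by (rule s(2)[OF A.half_ends_sets[OF uv]]) simp
      then have "\<bar>t - s\<bar> * ?m ?b \<le> (2 * e * s) * ?m ?b"
        unfolding lb left_diff_distrib[symmetric] abs_mult using mb by simp
      then have ts: "\<bar>t - s\<bar> \<le> 2 * e * s" using mb by simp
      have "2 * e * s \<le> 1/2 * s" using e s(1) by (intro mult_right_mono) auto
      then have s2: "s \<le> 2 * t" using ts by linarith
      have "\<bar>pulled_measure q A - t * ?m A\<bar> \<le> \<bar>pulled_measure q A - s * ?m A\<bar> + \<bar>(s - t) * ?m A\<bar>"
        unfolding left_diff_distrib by linarith
      also have "\<dots> \<le> 2 * e * s * ?m ?b + 2 * e * s * ?m ?b"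
      proof (rule add_mono[OF s(2)[OF A]])
        have "\<bar>(s - t) * ?m A\<bar> = \<bar>t - s\<bar> * ?m A" by (simp add: abs_mult abs_minus_commute)
        also have "\<dots> \<le> (2 * e * s) * ?m ?b" by (rule mult_mono[OF ts mA]) (use e s in auto)
        finally show "\<bar>(s - t) * ?m A\<bar> \<le> 2 * e * s * ?m ?b" .
      qed
      also have "\<dots> = (4 * e * ?m ?b) * s" by simp
      also have "\<dots> \<le> (4 * e * ?m ?b) * (2 * t)" by (rule mult_left_mono[OF s2]) (use e in simp)
      finally show ?thesis by (simp add: algebra_simps)
    qed
    define K where "K = 8 * t * ?m ?b"
    have Kpos: "K > 0" unfolding K_def using tpos mb by simp
    have "\<bar>pulled_measure q A - t * ?m A\<bar> \<le> 0 + e" if e: "e > 0" for e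
    proof -
      have "\<bar>pulled_measure q A - t * ?m A\<bar> \<le> min (1/4) (e / K) * K" unfolding K_def
        by (rule small) (use e Kpos K_def in auto)
      also have "\<dots> \<le> e / K * K" by (rule mult_right_mono) (use Kpos in auto)
      finally show ?thesis using Kpos by simp
    qed
    then have "\<bar>pulled_measure q A - t * ?m A\<bar> \<le> 0" by (rule field_le_epsilon)
    then show ?thesis by simp
  qed
  then show ?thesis unfolding proportional_at_def using uv qV tpos by blast
qed

end

section \<open>Proportionality on all cylinders and the separation of ends\<close>

context conf_pair_ac
begin

lemma proportional_equivariant:
  assumes uv: "adj T u v" and g: "g \<in> A.W" and q: "proportional_at u v q"
  shows "proportional_at (\<alpha> g u) (\<alpha> g v) (\<alpha>' g q)"
proof -
  interpret a: tree_iso T T "\<alpha> g" by (rule A.\<alpha>_iso[OF g])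
  interpret i: tree_iso T T a.inv_iso by (rule a.inv_tree_iso)
  have V: "u \<in> A.V" "v \<in> A.V" using A.adj_verts[OF uv] by auto
  obtain t where t: "q \<in> B.V" "t > 0" "\<And>A. A \<in> sets (end_borel T) \<Longrightarrow> A \<subseteq> half_ends T u v \<Longrightarrow> pulled_measure q A = t * measure (\<mu> u) A"
    using q unfolding proportional_at_def by blast
  have "pulled_measure (\<alpha>' g q) A = t * measure (\<mu> (\<alpha> g u)) A"
    if A: "A \<in> sets (end_borel T)" "A \<subseteq> half_ends T (\<alpha> g u) (\<alpha> g v)" for A
  proof -
    define A0 where "A0 = end_map a.inv_iso ` A"
    have s: "A0 \<in> sets (end_borel T)" unfolding A0_def by (rule i.end_map_sets[OF A(1)])
    have im: "end_map (\<alpha> g) ` A0 = A"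
      unfolding A0_def image_image using a.inv_end' A.end_borel_sub[OF A(1)] by (force simp: image_def)
    have "A0 \<subseteq> end_map a.inv_iso ` half_ends T (\<alpha> g u) (\<alpha> g v)" unfolding A0_def using A(2) by blast
    also have "\<dots> = half_ends T u v" using i.iso_half_ends_image[OF a.iso_V[OF V(1)] a.iso_V[OF V(2)]] a.inv_left V by simp
    finally have "pulled_measure q A0 = t * measure (\<mu> u) A0" by (rule t(3)[OF s])
    then show ?thesis using pulled_measure_equiv[OF g t(1) s] A.\<mu>_equiv_image[OF V(1) A.\<alpha>_deck[OF g] s] im by simp
  qed
  then show ?thesis unfolding proportional_at_def using t(2) B.\<alpha>_V[OF g t(1)] by blast
qed

text \<open>For ends beyond the edge from \<open>u\<close> to \<open>v\<close>, the change of base vertex from \<open>a\<close> to \<open>u\<close> is a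
  factor.\<close>

lemma proportional_mono:
  assumes uv: "adj T u v" and ac: "adj T a c" and sub: "half_tree T u v \<subseteq> half_tree T a c" and q: "proportional_at a c q"
  shows "proportional_at u v q"
proof -
  obtain t where t: "q \<in> B.V" "t > 0" "\<And>A. A \<in> sets (end_borel T) \<Longrightarrow> A \<subseteq> half_ends T a c \<Longrightarrow> pulled_measure q A = t * measure (\<mu> a) A"
    using q unfolding proportional_at_def by blast
  have "a \<notin> half_tree T u v" using sub A.half_self'[OF ac] by blast
  then have a: "a \<in> half_tree T v u" using A.half_not[OF uv A.adj_verts(1)[OF ac]] by blast
  have "pulled_measure q A = (t * exp (- \<delta> * real (A.d a u))) * measure (\<mu> u) A" if A: "A \<in> sets (end_borel T)" "A \<subseteq> half_ends T u v" for A
    using t(3)[OF A(1) order_trans[OF A(2) A.half_ends_mono[OF sub]]] A.\<mu>_away[OF uv a A] by simp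
  moreover have "t * exp (- \<delta> * real (A.d a u)) > 0" using t(2) by simp
  ultimately show ?thesis unfolding proportional_at_def using t(1) by blast
qed

text \<open>Every edge lies beyond a translate of the edge of \<open>proportional_somewhere\<close>.\<close>

lemma proportional_everywhere: assumes uv: "adj T u v" shows "\<exists>q. proportional_at u v q"
proof -
  obtain a c q where h: "adj T a c" "proportional_at a c q" using proportional_somewhere by blast
  obtain \<gamma> where g: "\<gamma> \<in> carrier (deck_group T p)" "half_tree T u v \<subseteq> half_tree T (\<gamma> a) (\<gamma> c)"
    by (rule A.deck_translate_before[OF h(1) uv])
  obtain k where k: "k \<in> A.W" "\<alpha> k = \<gamma>" by (rule A.\<alpha>_surj[OF g(1)])
  have "proportional_at (\<gamma> a) (\<gamma> c) (\<alpha>' k q)" using proportional_equivariant[OF h(1) k(1) h(2)] k(2) by simp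
  moreover have "adj T (\<gamma> a) (\<gamma> c)" by (rule tree_iso.iso_adj'[OF A.deck_iso[OF g(1)] h(1)])
  ultimately show ?thesis using proportional_mono[OF uv _ g(2)] by blast
qed

text \<open>The least possible distance from \<open>q\<close> to \<open>F u\<close> depends only on the orbit of the edge, and
  there are finitely many orbits.\<close>

lemma proportional_nearby:
  obtains R where "\<And>u v. adj T u v \<Longrightarrow> \<exists>q. proportional_at u v q \<and> B.d q (F u) \<le> R"
proof -
  define Q where "Q u v n \<longleftrightarrow> (\<exists>q. proportional_at u v q \<and> B.d q (F u) \<le> n)" for u v n
  have trans: "Q a' b' n" if h: "adj T a b" "adj T a' b'" "p a = p a'" "p b = p b'" "Q a b n" for a b a' b' n
  proof -
    obtain q where q: "proportional_at a b q" "B.d q (F a) \<le> n" using h(5) unfolding Q_def by blast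
    obtain \<gamma> where g: "\<gamma> \<in> carrier (deck_group T p)" "\<gamma> a = a'" "\<gamma> b = b'" by (rule A.deck_edge[OF h(1-4)])
    obtain k where k: "k \<in> A.W" "\<alpha> k = \<gamma>" by (rule A.\<alpha>_surj[OF g(1)])
    have aV: "a \<in> A.V" using A.adj_verts[OF h(1)] by simp
    have qV: "q \<in> B.V" using q(1) unfolding proportional_at_def by blast
    have "proportional_at a' b' (\<alpha>' k q)" using proportional_equivariant[OF h(1) k(1) q(1)] k(2) g(2,3) by simp
    moreover have "B.d (\<alpha>' k q) (F a') = B.d q (F a)"
      using F_equiv[OF k(1) aV] k(2) g(2) B.\<alpha>_dist[OF k(1) qV F_V[OF aV]] by simp
    ultimately show ?thesis unfolding Q_def using q(2) by (intro exI[of _ "\<alpha>' k q"]) simp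
  qed
  define h where "h u v = (LEAST n. Q u v n)" for u v
  have fin: "finite {h a b | a b. adj T a b}"
  proof (rule A.finite_values)
    fix a b a' b' assume z: "adj T a b" "adj T a' b'" "p a = p a'" "p b = p b'"
    have "Q a b = Q a' b'" using trans[OF z] trans[OF z(2,1) z(3)[symmetric] z(4)[symmetric]] by blast
    then show "h a b = h a' b'" unfolding h_def by simp
  qed
  have "Q u v (Max {h a b | a b. adj T a b})" if uv: "adj T u v" for u v
  proof -
    have "\<exists>n. Q u v n" using proportional_everywhere[OF uv] unfolding Q_def by blast
    then have "Q u v (h u v)" unfolding h_def by (rule LeastI_ex)
    moreover have "h u v \<le> Max {h a b | a b. adj T a b}" by (rule Max_ge[OF fin]) (use uv in blast)
    ultimately show ?thesis unfolding Q_def by (meson order_trans)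
  qed
  then show ?thesis using that unfolding Q_def by blast
qed

text \<open>Apply \<open>proportional_nearby\<close> to the edges of the ray from \<open>y\<close> to \<open>\<zeta>\<close>, reversed: the ends
  beyond such an edge include those beyond the edge from \<open>w\<close> to \<open>y\<close>, and the vertices \<open>q\<close>
  converge to \<open>\<Psi> \<zeta>\<close>.\<close>

lemma near_end:
  assumes yw: "adj T y w" and \<zeta>: "\<zeta> \<in> half_ends T y w" and st: "adj T' s t" and b: "\<Psi> \<zeta> \<in> half_ends T' s t"
  obtains q k where "q \<in> half_tree T' s t" "k > 0"
    "\<And>A. A \<in> sets (end_borel T) \<Longrightarrow> A \<subseteq> half_ends T w y \<Longrightarrow> pulled_measure q A = k * measure (\<mu> y) A"
proof -
  note \<zeta>e = A.half_ends_ends[OF \<zeta>] and yV = A.adj_verts(1)[OF yw] and wV = A.adj_verts(2)[OF yw]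
  obtain R where R: "\<And>u v. adj T u v \<Longrightarrow> \<exists>q. proportional_at u v q \<and> B.d q (F u) \<le> R" using proportional_nearby by blast
  obtain r where r: "r \<in> \<zeta>" "r 0 = y" "r \<in> rays T" by (rule A.ray_from[OF \<zeta>e yV])
  have r1: "r (Suc 0) = w" by (rule A.half_ends_first[OF \<zeta> yw r(1,2)])
  have 1: "eventually (\<lambda>z. F z \<in> half_tree T' s t) (to_end T \<zeta>)"
    using AB.ext_lim(2)[OF F_coarse \<zeta>e] st b unfolding B.filterlim_to_end[OF \<Psi>_ends[OF \<zeta>e]] by blast
  have 2: "eventually (\<lambda>z. B.d (F z) s > R) (to_end T \<zeta>)"
    by (rule AB.eventually_far[OF F_coarse \<zeta>e]) (rule B.adj_verts(1)[OF st])
  obtain a c where ac: "adj T a c" "\<zeta> \<in> half_ends T a c" "\<forall>z\<in>half_tree T a c. F z \<in> half_tree T' s t \<and> B.d (F z) s > R"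
    using eventually_conj[OF 1 2] unfolding A.eventually_to_end[OF \<zeta>e] by blast
  have "\<forall>\<^sub>F n in sequentially. half_tree T (r n) (r (Suc n)) \<subseteq> half_tree T a c" by (rule A.ray_half_ends_half_sub[OF \<zeta>e r(1) ac(1,2)])
  then obtain n where n: "half_tree T (r n) (r (Suc n)) \<subseteq> half_tree T a c" by (auto simp: eventually_sequentially)
  let ?z = "r (Suc n)"
  have z: "F ?z \<in> half_tree T' s t" "B.d (F ?z) s > R" using ac(3) n A.half_self[OF A.rays_adj[OF r(3)]] by auto
  have e: "adj T ?z (r n)" by (rule adj_sym[OF A.rays_adj[OF r(3)]])
  obtain q where q: "proportional_at ?z (r n) q" "B.d q (F ?z) \<le> R" using R[OF e] by blast
  have qV: "q \<in> B.V" using q(1) unfolding proportional_at_def by blast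
  have qs: "q \<in> half_tree T' s t"
  proof (rule ccontr)
    assume "q \<notin> half_tree T' s t"
    then have "q \<in> half_tree T' t s" using B.half_not[OF st qV] by blast
    then have "B.d q (F ?z) = B.d q s + 1 + B.d t (F ?z)" using B.half_dist[OF st] z(1) by blast
    moreover have "B.d (F ?z) s = Suc (B.d (F ?z) t)" using z(1) by (simp add: half_tree_def)
    ultimately show False using z(2) q(2) B.dist_sym[of t "F ?z"] by simp
  qed
  have "half_tree T w y \<subseteq> half_tree T ?z (r n)" using A.ray_half_mono'[OF r(3), of 0 n] r(2) r1 by simp
  then have "proportional_at w y q" by (rule proportional_mono[OF adj_sym[OF yw] e _ q(1)])
  then obtain k where k: "k > 0" "\<And>A. A \<in> sets (end_borel T) \<Longrightarrow> A \<subseteq> half_ends T w y \<Longrightarrow> pulled_measure q A = k * measure (\<mu> w) A"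
    unfolding proportional_at_def by blast
  have "pulled_measure q A = (k * exp (- \<delta> * 1)) * measure (\<mu> y) A" if A: "A \<in> sets (end_borel T)" "A \<subseteq> half_ends T w y" for A
  proof -
    have "measure (\<mu> w) A = exp (- \<delta> * 1) * measure (\<mu> y) A"
      by (rule A.\<mu>_const[OF wV yV A(1)]) (use A.busemann_adj[OF adj_sym[OF yw]] A(2) in blast)
    then show ?thesis using k(2)[OF A] by simp
  qed
  moreover have "k * exp (- \<delta> * 1) > 0" using k(1) by simp
  ultimately show ?thesis using that[OF qs] by blast
qed

text \<open>Let \<open>q1\<close> and \<open>q2\<close> be the vertices of \<open>near_end\<close> close to the images of \<open>\<zeta>1\<close> and \<open>\<zeta>2\<close>. Near
  \<open>\<eta>1\<close> and near \<open>\<eta>2\<close> the measures pulled back from both are proportional to the same measure, so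
  by \<open>\<delta> > 0\<close> the Busemann function between \<open>q1\<close> and \<open>q2\<close> has the same value at the images of \<open>\<eta>1\<close>
  and \<open>\<eta>2\<close>. If an edge separated the images of \<open>\<zeta>1, \<eta>1\<close> from those of \<open>\<zeta>2, \<eta>2\<close>, these values
  would differ by at least two.\<close>

lemma no_crossing:
  assumes y: "adj T y w1" "adj T y w2" and \<zeta>: "\<zeta>1 \<in> half_ends T y w1" "\<zeta>2 \<in> half_ends T y w2"
    and \<eta>1: "\<eta>1 \<in> half_ends T w1 y" "\<eta>1 \<in> half_ends T w2 y" and \<eta>2: "\<eta>2 \<in> half_ends T w1 y" "\<eta>2 \<in> half_ends T w2 y"
    and st: "adj T' s t" and s: "\<Psi> \<zeta>1 \<in> half_ends T' s t" "\<Psi> \<eta>1 \<in> half_ends T' s t" and t: "\<Psi> \<zeta>2 \<in> half_ends T' t s" "\<Psi> \<eta>2 \<in> half_ends T' t s"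
  shows False
proof -
  note ts = adj_sym[OF st]
  obtain q1 k1 where q1: "q1 \<in> half_tree T' s t" "k1 > 0"
    "\<And>A. A \<in> sets (end_borel T) \<Longrightarrow> A \<subseteq> half_ends T w1 y \<Longrightarrow> pulled_measure q1 A = k1 * measure (\<mu> y) A"
    by (rule near_end[OF y(1) \<zeta>(1) st s(1)]) blast
  obtain q2 k2 where q2: "q2 \<in> half_tree T' t s" "k2 > 0"
    "\<And>A. A \<in> sets (end_borel T) \<Longrightarrow> A \<subseteq> half_ends T w2 y \<Longrightarrow> pulled_measure q2 A = k2 * measure (\<mu> y) A"
    by (rule near_end[OF y(2) \<zeta>(2) ts t(1)]) blast
  have qV: "q1 \<in> B.V" "q2 \<in> B.V" using q1 q2 B.half_V by blast+
  have yV: "y \<in> A.V" using A.adj_verts[OF y(1)] by simp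
  have ratio: "k1 = exp (- \<delta> * busemann T' (\<Psi> \<eta>) q1 q2) * k2"
    if \<eta>: "\<eta> \<in> half_ends T w1 y" "\<eta> \<in> half_ends T w2 y" for \<eta>
  proof -
    note \<eta>e = A.half_ends_ends[OF \<eta>(1)]
    obtain a c where ac: "adj T' a c" "\<Psi> \<eta> \<in> half_ends T' a c" "q1 \<in> half_tree T' c a" "q2 \<in> half_tree T' c a"
      by (rule B.busemann_nbhd[OF \<Psi>_ends[OF \<eta>e] qV])
    obtain e f where ef: "adj T e f" "\<eta> \<in> half_ends T e f" "\<And>\<xi>. \<xi> \<in> half_ends T e f \<Longrightarrow> \<Psi> \<xi> \<in> half_ends T' a c"
      by (rule AB.ext_cont[OF F_coarse \<eta>e ac(1,2)]) blast
    obtain g h where gh: "adj T g h" "\<eta> \<in> half_ends T g h" "half_tree T g h \<subseteq> half_tree T e f" "half_tree T g h \<subseteq> half_tree T w1 y"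
      by (rule A.half_ends_directed[OF ef(1,2) adj_sym[OF y(1)] \<eta>(1)])
    obtain m n where mn: "adj T m n" "\<eta> \<in> half_ends T m n" "half_tree T m n \<subseteq> half_tree T g h" "half_tree T m n \<subseteq> half_tree T w2 y"
      by (rule A.half_ends_directed[OF gh(1,2) adj_sym[OF y(2)] \<eta>(2)])
    let ?A = "half_ends T m n"
    have As: "?A \<in> sets (end_borel T)" by (rule A.half_ends_sets[OF mn(1)])
    have sub: "?A \<subseteq> half_ends T e f" "?A \<subseteq> half_ends T w1 y" "?A \<subseteq> half_ends T w2 y"
      using A.half_ends_mono[OF mn(3)] A.half_ends_mono[OF gh(3)] A.half_ends_mono[OF gh(4)] A.half_ends_mono[OF mn(4)] by auto
    have "busemann T' (\<Psi> \<xi>) q1 q2 = busemann T' (\<Psi> \<eta>) q1 q2" if "\<xi> \<in> ?A" for \<xi>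
    proof -
      have "\<Psi> \<xi> \<in> half_ends T' a c" using ef(3) sub(1) that by blast
      then show ?thesis using B.busemann_half[OF ac(1) _ ac(3,4)] ac(2) by simp
    qed
    then have "pulled_measure q1 ?A = exp (- \<delta> * busemann T' (\<Psi> \<eta>) q1 q2) * pulled_measure q2 ?A" by (rule pulled_measure_const[OF qV As])
    then have "k1 * measure (\<mu> y) ?A = exp (- \<delta> * busemann T' (\<Psi> \<eta>) q1 q2) * k2 * measure (\<mu> y) ?A"
      using q1(3)[OF As sub(2)] q2(3)[OF As sub(3)] by simp
    moreover have "measure (\<mu> y) ?A > 0" by (rule A.\<mu>_half_ends_pos[OF mn(1) yV])
    ultimately show ?thesis by simp
  qed
  have "exp (- \<delta> * busemann T' (\<Psi> \<eta>1) q1 q2) * k2 = exp (- \<delta> * busemann T' (\<Psi> \<eta>2) q1 q2) * k2"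
    using ratio[OF \<eta>1] ratio[OF \<eta>2] by (rule trans[OF sym])
  then have eq: "busemann T' (\<Psi> \<eta>1) q1 q2 = busemann T' (\<Psi> \<eta>2) q1 q2" using q2(2) A.\<delta>_pos by simp
  note V = B.adj_verts[OF st]
  note e1 = B.half_ends_ends[OF s(2)] and e2 = B.half_ends_ends[OF t(2)]
  have split: "busemann T' \<xi> q1 q2 = busemann T' \<xi> q1 t + busemann T' \<xi> t s - busemann T' \<xi> q2 s" if "\<xi> \<in> ends T'" for \<xi>
    using B.busemann_cocycle[OF that qV(1) V(2) qV(2)] B.busemann_cocycle[OF that V(2) V(1) qV(2)]
      B.busemann_anti[OF that V(1) qV(2)] by simp
  have "busemann T' (\<Psi> \<eta>1) q1 t \<le> real (B.d q1 t)" using B.busemann_le[OF e1 qV(1) V(2)] by linarith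
  moreover have "busemann T' (\<Psi> \<eta>1) t s = -1" using B.busemann_adj[OF st s(2)] B.busemann_anti[OF e1 V(1,2)] by simp
  moreover have "busemann T' (\<Psi> \<eta>1) q2 s = real (B.d q2 s)" by (rule B.busemann_half_ends[OF st s(2) q2(1)])
  moreover have "busemann T' (\<Psi> \<eta>2) q1 t = real (B.d q1 t)" by (rule B.busemann_half_ends[OF ts t(2) q1(1)])
  moreover have "busemann T' (\<Psi> \<eta>2) t s = 1" by (rule B.busemann_adj[OF ts t(2)])
  moreover have "busemann T' (\<Psi> \<eta>2) q2 s \<le> real (B.d q2 s)" using B.busemann_le[OF e2 qV(2) V(1)] by linarith
  ultimately show False using eq split[OF e1] split[OF e2] by linarith
qed

section \<open>Every edge of the second tree comes from an edge of the first\<close>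

text \<open>Call a branch of the first tree at a vertex mixed if the edge from \<open>s\<close> to \<open>t\<close> separates the
  images of two of its ends. If no branch at \<open>y\<close> is mixed, \<open>no_crossing\<close> allows only one branch
  on one of the two sides, and this branch is the wanted edge or its reverse. If a branch at \<open>y\<close>
  is mixed, \<open>no_crossing\<close> puts all the other branches on the same side, so that, seen from the
  next vertex, the branch back to \<open>y\<close> is not mixed. Following mixed branches for ever would give
  a ray, against the continuity of \<open>\<Psi>\<close> at its end.\<close>

lemma edge_preimage: assumes st: "adj T' s t" shows "\<exists>u v. adj T u v \<and> \<Psi> ` half_ends T u v = half_ends T' s t"
proof (rule ccontr)
  assume none: "\<not> ?thesis"
  note ts = adj_sym[OF st]
  \<comment> \<open>the branch at \<open>y\<close> through \<open>w\<close> has an end with image beyond the edge from \<open>s\<close> to \<open>t\<close>; \<open>N\<close> is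
    the same for the reverse edge\<close>
  define S where "S y w \<longleftrightarrow> (\<exists>\<zeta>\<in>half_ends T y w. \<Psi> \<zeta> \<in> half_ends T' s t)" for y w
  define N where "N y w \<longleftrightarrow> (\<exists>\<zeta>\<in>half_ends T y w. \<Psi> \<zeta> \<in> half_ends T' t s)" for y w
  have K: False if a: "adj T y s1" "adj T y n1" "adj T y s2" "adj T y n2" and h: "S y s1" "N y n1" "S y s2" "N y n2"
    and ne: "s1 \<noteq> s2" "s1 \<noteq> n2" "n1 \<noteq> s2" "n1 \<noteq> n2" for y s1 n1 s2 n2
  proof -
    obtain \<zeta>1 where z1: "\<zeta>1 \<in> half_ends T y s1" "\<Psi> \<zeta>1 \<in> half_ends T' s t" using h(1) unfolding S_def by blast
    obtain \<zeta>2 where z2: "\<zeta>2 \<in> half_ends T y n1" "\<Psi> \<zeta>2 \<in> half_ends T' t s" using h(2) unfolding N_def by blast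
    obtain \<eta>1 where e1: "\<eta>1 \<in> half_ends T y s2" "\<Psi> \<eta>1 \<in> half_ends T' s t" using h(3) unfolding S_def by blast
    obtain \<eta>2 where e2: "\<eta>2 \<in> half_ends T y n2" "\<Psi> \<eta>2 \<in> half_ends T' t s" using h(4) unfolding N_def by blast
    have op: "\<eta> \<in> half_ends T w y" if "\<eta> \<in> half_ends T y w'" "adj T y w" "adj T y w'" "w \<noteq> w'" for \<eta> w w'
      using A.half_ends_not[OF that(2) A.half_ends_ends[OF that(1)]] A.half_ends_branch_unique[OF that(2,3) _ that(1)] that(4) by blast
    show False
      by (rule no_crossing[OF a(1,2) z1(1) z2(1) op[OF e1(1) a(1,3) ne(1)] op[OF e1(1) a(2,3) ne(3)]
            op[OF e2(1) a(1,4) ne(2)] op[OF e2(1) a(2,4) ne(4)] st z1(2) e1(2) z2(2) e2(2)])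
  qed
  have image: "\<Psi> ` half_ends T u v = half_ends T' a c"
    if uv: "adj T u v" and eq: "\<And>\<xi>. \<xi> \<in> ends T \<Longrightarrow> \<xi> \<in> half_ends T u v \<longleftrightarrow> \<Psi> \<xi> \<in> half_ends T' a c" for u v a c
  proof (intro equalityI subsetI)
    fix \<eta> assume "\<eta> \<in> \<Psi> ` half_ends T u v" then show "\<eta> \<in> half_ends T' a c" using eq A.half_ends_ends by blast
  next
    fix \<eta> assume \<eta>: "\<eta> \<in> half_ends T' a c"
    note \<eta>e = B.half_ends_ends[OF \<eta>]
    have "\<Psi>' \<eta> \<in> half_ends T u v" using eq[OF \<Psi>'_ends[OF \<eta>e]] \<Psi>_\<Psi>'[OF \<eta>e] \<eta> by simp
    then show "\<eta> \<in> \<Psi> ` half_ends T u v" using \<Psi>_\<Psi>'[OF \<eta>e] by (metis imageI)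
  qed
  have dich: "\<Psi> \<xi> \<notin> half_ends T' s t \<longleftrightarrow> \<Psi> \<xi> \<in> half_ends T' t s" if "\<xi> \<in> ends T" for \<xi>
    by (rule B.half_ends_not[OF st \<Psi>_ends[OF that]])
  have mixed: "\<exists>w. adj T y w \<and> S y w \<and> N y w" if y: "y \<in> A.V" for y
  proof (rule ccontr)
    assume c: "\<not> ?thesis"
    have ex: "\<exists>w. adj T y w \<and> (\<exists>\<zeta>\<in>half_ends T y w. \<Psi> \<zeta> \<in> half_ends T' a c)" if ac: "adj T' a c" for a c
    proof -
      obtain \<eta> where \<eta>: "\<eta> \<in> half_ends T' a c" using B.half_ends_nonempty[OF ac] by blast
      note \<eta>e = B.half_ends_ends[OF \<eta>]
      obtain w where "adj T y w" "\<Psi>' \<eta> \<in> half_ends T y w" using A.branch_ex1[OF \<Psi>'_ends[OF \<eta>e] y] by blast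
      then show ?thesis using \<Psi>_\<Psi>'[OF \<eta>e] \<eta> by metis
    qed
    obtain wS where wS: "adj T y wS" "S y wS" using ex[OF st] unfolding S_def by blast
    obtain wN where wN: "adj T y wN" "N y wN" using ex[OF ts] unfolding N_def by blast
    have "(\<forall>w. adj T y w \<longrightarrow> S y w \<longrightarrow> w = wS) \<or> (\<forall>w. adj T y w \<longrightarrow> N y w \<longrightarrow> w = wN)"
    proof (rule ccontr)
      assume "\<not> ?thesis"
      then obtain s2 n2 where h: "adj T y s2" "S y s2" "s2 \<noteq> wS" "adj T y n2" "N y n2" "n2 \<noteq> wN" by blast
      show False by (rule K[OF wS(1) wN(1) h(1,4) wS(2) wN(2) h(2,5)]) (use h c wS wN in blast)+
    qed
    then show False
    proof
      assume u: "\<forall>w. adj T y w \<longrightarrow> S y w \<longrightarrow> w = wS"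
      have "\<xi> \<in> half_ends T y wS \<longleftrightarrow> \<Psi> \<xi> \<in> half_ends T' s t" if \<xi>: "\<xi> \<in> ends T" for \<xi>
      proof
        assume "\<xi> \<in> half_ends T y wS" then show "\<Psi> \<xi> \<in> half_ends T' s t" using dich[OF \<xi>] c wS unfolding N_def by blast
      next
        assume b: "\<Psi> \<xi> \<in> half_ends T' s t"
        obtain w where w: "adj T y w" "\<xi> \<in> half_ends T y w" using A.branch_ex1[OF \<xi> y] by blast
        then have "S y w" using b unfolding S_def by blast
        then show "\<xi> \<in> half_ends T y wS" using u w by blast
      qed
      then have "\<Psi> ` half_ends T y wS = half_ends T' s t" by (rule image[OF wS(1)])
      then show False using none wS(1) by blast
    next
      assume u: "\<forall>w. adj T y w \<longrightarrow> N y w \<longrightarrow> w = wN"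
      have "\<xi> \<in> half_ends T wN y \<longleftrightarrow> \<Psi> \<xi> \<in> half_ends T' s t" if \<xi>: "\<xi> \<in> ends T" for \<xi>
      proof -
        have "\<xi> \<in> half_ends T y wN \<longleftrightarrow> \<Psi> \<xi> \<in> half_ends T' t s"
        proof
          assume "\<xi> \<in> half_ends T y wN" then show "\<Psi> \<xi> \<in> half_ends T' t s" using dich[OF \<xi>] c wN unfolding S_def by blast
        next
          assume b: "\<Psi> \<xi> \<in> half_ends T' t s"
          obtain w where w: "adj T y w" "\<xi> \<in> half_ends T y w" using A.branch_ex1[OF \<xi> y] by blast
          then have "N y w" using b unfolding N_def by blast
          then show "\<xi> \<in> half_ends T y wN" using u w by blast
        qed
        then show ?thesis using dich[OF \<xi>] A.half_ends_not[OF wN(1) \<xi>] by blast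
      qed
      then have "\<Psi> ` half_ends T wN y = half_ends T' s t" by (rule image[OF adj_sym[OF wN(1)]])
      then show False using none adj_sym[OF wN(1)] by blast
    qed
  qed
  have pure: "\<not> (S w y \<and> N w y)" if yw: "adj T y w" and m: "S y w" "N y w" for y w
  proof
    assume h: "S w y \<and> N w y"
    have sub: "\<exists>w'. adj T y w' \<and> w' \<noteq> w \<and> \<xi> \<in> half_ends T y w'" if "\<xi> \<in> half_ends T w y" for \<xi>
      using that unfolding A.half_ends_split[OF adj_sym[OF yw]] nbhd_def by blast
    obtain s2 where s2: "adj T y s2" "s2 \<noteq> w" "S y s2" using h sub unfolding S_def by blast
    obtain n2 where n2: "adj T y n2" "n2 \<noteq> w" "N y n2" using h sub unfolding N_def by blast
    show False by (rule K[OF yw yw s2(1) n2(1) m s2(3) n2(3)]) (use s2 n2 in auto)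
  qed
  define m where "m y = (SOME w. adj T y w \<and> S y w \<and> N y w)" for y
  have m: "adj T y (m y) \<and> S y (m y) \<and> N y (m y)" if "y \<in> A.V" for y
    unfolding m_def by (rule someI_ex[OF mixed[OF that]])
  define r where "r n = (m ^^ n) x\<^sub>0" for n
  have rS: "r (Suc n) = m (r n)" for n by (simp add: r_def)
  have rV: "r n \<in> A.V" for n
  proof (induction n)
    case 0 then show ?case using A.x0 by (simp add: r_def)
  next
    case (Suc n) show ?case unfolding rS using m[OF Suc] A.adj_verts(2) by blast
  qed
  have rm: "adj T (r n) (r (Suc n))" "S (r n) (r (Suc n))" "N (r n) (r (Suc n))" for n
    unfolding rS using m[OF rV] by blast+
  have "r (Suc (Suc n)) \<noteq> r n" for n
  proof
    assume e: "r (Suc (Suc n)) = r n"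
    have "S (r (Suc n)) (r n) \<and> N (r (Suc n)) (r n)" using rm(2,3)[of "Suc n"] e by simp
    then show False using pure[OF rm(1-3)] by blast
  qed
  then have rr: "r \<in> rays T" using rm(1) by (simp add: rays_def)
  obtain \<xi> where \<xi>: "\<xi> \<in> ends T" "r \<in> \<xi>" using A.end_of_ray[OF rr] by blast
  have stop: "\<exists>n. \<forall>\<zeta>\<in>half_ends T (r n) (r (Suc n)). \<Psi> \<zeta> \<in> half_ends T' a c" if ac: "adj T' a c" and b: "\<Psi> \<xi> \<in> half_ends T' a c" for a c
  proof -
    obtain e f where ef: "adj T e f" "\<xi> \<in> half_ends T e f" "\<And>\<zeta>. \<zeta> \<in> half_ends T e f \<Longrightarrow> \<Psi> \<zeta> \<in> half_ends T' a c"
      by (rule AB.ext_cont[OF F_coarse \<xi>(1) ac b]) blast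
    have "\<forall>\<^sub>F n in sequentially. half_tree T (r n) (r (Suc n)) \<subseteq> half_tree T e f" by (rule A.ray_half_ends_half_sub[OF \<xi> ef(1,2)])
    then obtain n where "half_tree T (r n) (r (Suc n)) \<subseteq> half_tree T e f" by (auto simp: eventually_sequentially)
    then have "half_ends T (r n) (r (Suc n)) \<subseteq> half_ends T e f" by (rule A.half_ends_mono)
    then show ?thesis using ef(3) by blast
  qed
  show False
  proof (cases "\<Psi> \<xi> \<in> half_ends T' s t")
    case True
    then obtain n where n: "\<forall>\<zeta>\<in>half_ends T (r n) (r (Suc n)). \<Psi> \<zeta> \<in> half_ends T' s t" using stop[OF st] by blast
    obtain \<zeta> where "\<zeta> \<in> half_ends T (r n) (r (Suc n))" "\<Psi> \<zeta> \<in> half_ends T' t s" using rm(3)[of n] unfolding N_def by blast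
    then show False using n dich[OF A.half_ends_ends] by blast
  next
    case False
    then have "\<Psi> \<xi> \<in> half_ends T' t s" using dich[OF \<xi>(1)] by blast
    then obtain n where n: "\<forall>\<zeta>\<in>half_ends T (r n) (r (Suc n)). \<Psi> \<zeta> \<in> half_ends T' t s" using stop[OF ts] by blast
    obtain \<zeta> where "\<zeta> \<in> half_ends T (r n) (r (Suc n))" "\<Psi> \<zeta> \<in> half_ends T' s t" using rm(2)[of n] unfolding S_def by blast
    then show False using n dich[OF A.half_ends_ends] by blast
  qed
qed

end

section \<open>Trees are determined by the end sets of their edges\<close>

text \<open>The edges with a common origin \<open>y\<close> have disjoint end sets with no end set of an edge
  strictly between one of them and the complement of another. The image edges inherit this, which
  forces them to have a common origin, the image of \<open>y\<close>.\<close>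

lemma vertex_map:
  fixes \<Psi> :: "'t tree_end \<Rightarrow> 's tree_end"
  assumes A: "univ_cover G T p" and B: "univ_cover G' T' p'"
    and bij: "bij_betw \<Psi> (ends T) (ends T')"
    and E1: "\<And>s t. adj T' s t \<Longrightarrow> \<exists>u v. adj T u v \<and> \<Psi> ` half_ends T u v = half_ends T' s t"
    and E2: "\<And>u v. adj T u v \<Longrightarrow> \<exists>s t. adj T' s t \<and> \<Psi> ` half_ends T u v = half_ends T' s t"
  obtains H where "\<And>u v. adj T u v \<Longrightarrow> adj T' (H u) (H v) \<and> \<Psi> ` half_ends T u v = half_ends T' (H u) (H v)"
proof -
  interpret A: univ_cover G T p by fact
  interpret B: univ_cover G' T' p' by fact
  have inj: "inj_on \<Psi> (ends T)" and surj: "\<Psi> ` ends T = ends T'" using bij unfolding bij_betw_def by auto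
  have sub: "half_ends T u v \<subseteq> ends T" for u v using A.half_ends_ends by blast
  have compl: "\<Psi> ` half_ends T v u = half_ends T' c a" if uv: "adj T u v" and ac: "adj T' a c" and e: "\<Psi> ` half_ends T u v = half_ends T' a c" for u v a c
  proof -
    have "half_ends T v u = ends T - half_ends T u v" using A.half_ends_not[OF uv] sub by blast
    then have "\<Psi> ` half_ends T v u = ends T' - half_ends T' a c"
      using inj_on_image_set_diff[OF inj, of "ends T" "half_ends T u v"] sub surj e by auto
    also have "\<dots> = half_ends T' c a" using B.half_ends_not[OF ac] B.half_ends_ends by blast
    finally show ?thesis .
  qed
  have subI: "half_ends T u v \<subseteq> half_ends T x y \<longleftrightarrow> \<Psi> ` half_ends T u v \<subseteq> \<Psi> ` half_ends T x y" for u v x y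
    using inj_on_image_subset_iff[OF inj, of "half_ends T u v" "half_ends T x y"] sub by blast
  have origin: "a1 = a2"
    if w: "adj T y w1" "adj T y w2" and ac1: "adj T' a1 c1" and ac2: "adj T' a2 c2"
      and e: "\<Psi> ` half_ends T y w1 = half_ends T' a1 c1" "\<Psi> ` half_ends T y w2 = half_ends T' a2 c2" for y w1 w2 a1 c1 a2 c2
  proof (cases "w1 = w2")
    case True then show ?thesis using B.half_ends_eq(1)[OF ac1 ac2] e by simp
  next
    case False
    show ?thesis
    proof (rule ccontr)
      assume ne: "a1 \<noteq> a2"
      note V1 = B.adj_verts[OF ac1] and V2 = B.adj_verts[OF ac2]
      have dj: "half_ends T y w1 \<inter> half_ends T y w2 = {}" using A.half_ends_branch_unique[OF w] False by blast
      then have dj': "half_ends T' a1 c1 \<inter> half_ends T' a2 c2 = {}"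
        using inj_on_image_Int[OF inj sub sub, of y w1 y w2] e by simp
      have hd: "half_tree T' a1 c1 \<inter> half_tree T' a2 c2 = {}" using B.half_Int_half_ends[OF ac1 ac2] dj' by blast
      have c1: "c1 \<in> half_tree T' c2 a2" using hd B.half_self[OF ac1] B.half_not[OF ac2 V1(2)] by blast
      have a1: "a1 \<in> half_tree T' c2 a2"
      proof (rule ccontr)
        assume "a1 \<notin> half_tree T' c2 a2"
        then have "a1 \<in> half_tree T' a2 c2" using B.half_not[OF adj_sym[OF ac2] V1(1)] by blast
        then have "c1 = a2" "a1 = c2" using B.half_cross[OF ac2 adj_sym[OF ac1] c1] by auto
        then have e2: "\<Psi> ` half_ends T y w1 = \<Psi> ` half_ends T w2 y" using compl[OF w(2) ac2 e(2)] e(1) by simp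
        obtain w3 where w3: "adj T y w3" "w3 \<noteq> w1" "w3 \<noteq> w2" using A.nbr_avoid2[OF A.adj_verts(1)[OF w(1)]] by blast
        obtain \<xi> where \<xi>: "\<xi> \<in> half_ends T y w3" using A.half_ends_nonempty[OF w3(1)] by blast
        have "\<xi> \<in> half_ends T w2 y" using A.half_ends_not[OF w(2) A.half_ends_ends[OF \<xi>]] A.half_ends_branch_unique[OF w(2) w3(1) _ \<xi>] w3(3) by blast
        moreover have "half_ends T w2 y \<subseteq> half_ends T y w1" unfolding subI using e2 by simp
        ultimately show False using A.half_ends_branch_unique[OF w(1) w3(1) _ \<xi>] w3(2) by blast
      qed
      obtain g where g: "adj T' a1 g" "a2 \<in> half_tree T' a1 g" using B.half_towards[OF V1(1) V2(1) ne] by blast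
      have c1g: "c1 \<noteq> g"
      proof
        assume "c1 = g"
        then have a2: "a2 \<in> half_tree T' a1 c1" using g by simp
        have "c2 \<in> half_tree T' c1 a1" using hd B.half_self[OF ac2] B.half_not[OF ac1 V2(2)] by blast
        then have "c2 = a1" "a2 = c1" using B.half_cross[OF ac1 adj_sym[OF ac2] _ a2] by auto
        then show False using a1 B.half_self'[OF ac1] by simp
      qed
      have s1: "half_tree T' a1 c1 \<subseteq> half_tree T' g a1" by (rule B.half_succ(1)[OF adj_sym[OF g(1)] ac1 c1g])
      have c2: "c2 \<in> half_tree T' a1 g"
      proof (rule ccontr)
        assume "c2 \<notin> half_tree T' a1 g"
        then have "c2 \<in> half_tree T' g a1" using B.half_not[OF g(1) V2(2)] by blast
        then have "c2 = a1" using B.half_cross(1)[OF g(1) adj_sym[OF ac2] _ g(2)] by blast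
        then show False using a1 B.half_self'[OF adj_sym[OF ac2]] by simp
      qed
      have s2: "half_tree T' g a1 \<subseteq> half_tree T' c2 a2" by (rule B.half_sub[OF adj_sym[OF g(1)] adj_sym[OF ac2] a1 c2])
      obtain s t where st: "adj T s t" "\<Psi> ` half_ends T s t = half_ends T' g a1" using E1[OF adj_sym[OF g(1)]] by blast
      have b1: "half_ends T y w1 \<subseteq> half_ends T s t" unfolding subI e(1) st(2) by (rule B.half_ends_mono[OF s1])
      have b2: "half_ends T s t \<subseteq> half_ends T w2 y" unfolding subI compl[OF w(2) ac2 e(2)] st(2) by (rule B.half_ends_mono[OF s2])
      have h1: "half_tree T y w1 \<subseteq> half_tree T s t" by (rule A.half_ends_sub_half[OF w(1) st(1) b1])
      have h2: "half_tree T s t \<subseteq> half_tree T w2 y" by (rule A.half_ends_sub_half[OF st(1) adj_sym[OF w(2)] b2])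
      have w1: "w1 \<in> half_tree T s t" using h1 A.half_self[OF w(1)] by blast
      have "y \<in> half_tree T s t"
      proof (rule ccontr)
        assume "y \<notin> half_tree T s t"
        then have "y \<in> half_tree T t s" using A.half_not[OF st(1) A.adj_verts(1)[OF w(1)]] by blast
        then have "y = s" "w1 = t" using A.half_cross[OF st(1) w(1) _ w1] by auto
        then have "half_ends T' g a1 = half_ends T' a1 c1" using st(2) e(1) by simp
        then have "g = a1" by (rule B.half_ends_eq(1)[OF adj_sym[OF g(1)] ac1])
        then show False using B.adj_verts(3)[OF g(1)] by simp
      qed
      moreover have "w2 \<in> half_tree T t s"
        using h2 A.half_self'[OF adj_sym[OF w(2)]] A.half_not[OF st(1) A.adj_verts(2)[OF w(2)]] by blast
      ultimately have "w2 = s" "y = t" using A.half_cross[OF st(1) adj_sym[OF w(2)]] by auto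
      then have "half_ends T' g a1 = half_ends T' c2 a2" using st(2) compl[OF w(2) ac2 e(2)] by simp
      then have "a1 = a2" by (rule B.half_ends_eq(2)[OF adj_sym[OF g(1)] adj_sym[OF ac2]])
      then show False using ne by simp
    qed
  qed
  define H where "H y = (SOME a. \<exists>w c. adj T y w \<and> adj T' a c \<and> \<Psi> ` half_ends T y w = half_ends T' a c)" for y
  have H: "\<exists>c. adj T' (H y) c \<and> \<Psi> ` half_ends T y w = half_ends T' (H y) c" if yw: "adj T y w" for y w
  proof -
    obtain a c where ac: "adj T' a c" "\<Psi> ` half_ends T y w = half_ends T' a c" using E2[OF yw] by blast
    then have "\<exists>w c. adj T y w \<and> adj T' (H y) c \<and> \<Psi> ` half_ends T y w = half_ends T' (H y) c"
      unfolding H_def by (intro someI_ex[of "\<lambda>a. \<exists>w c. adj T y w \<and> adj T' a c \<and> \<Psi> ` half_ends T y w = half_ends T' a c"]) (use yw in blast)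
    then obtain w1 c1 where h: "adj T y w1" "adj T' (H y) c1" "\<Psi> ` half_ends T y w1 = half_ends T' (H y) c1" by blast
    have "a = H y" by (rule origin[OF yw h(1) ac(1) h(2) ac(2) h(3)])
    then show ?thesis using ac by blast
  qed
  have "adj T' (H u) (H v) \<and> \<Psi> ` half_ends T u v = half_ends T' (H u) (H v)" if uv: "adj T u v" for u v
  proof -
    obtain c where c: "adj T' (H u) c" "\<Psi> ` half_ends T u v = half_ends T' (H u) c" using H[OF uv] by blast
    obtain a where a: "adj T' (H v) a" "\<Psi> ` half_ends T v u = half_ends T' (H v) a" using H[OF adj_sym[OF uv]] by blast
    have "half_ends T' c (H u) = half_ends T' (H v) a" using compl[OF uv c] a(2) by simp
    then have "c = H v" by (rule B.half_ends_eq(1)[OF adj_sym[OF c(1)] a(1)])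
    then show ?thesis using c by simp
  qed
  then show ?thesis using that by blast
qed

section \<open>Null sets of the push-forward measures\<close>

context conf_pair
begin

lemma push_measurable:
  assumes z: "z \<in> A.V" shows "boundary_map b T x\<^sub>0 \<alpha> \<in> measurable (\<mu> z) (end_borel (cayley_tree b))"
proof -
  have "end_extension T A.C A.word_of \<in> measurable (\<mu> z) (end_borel (cayley_tree b))"
    using A.TC.ext_measurable[OF A.word_of_coarse A.locally_finite_tree_axioms] measurable_cong_sets[OF A.\<mu>_sets[OF z] refl] by blast
  then show ?thesis using measurable_cong[of "\<mu> z" "boundary_map b T x\<^sub>0 \<alpha>" "end_extension T A.C A.word_of"] A.boundary_map_ext A.\<mu>_space[OF z] by simp
qed

end

context conf_pair
begin

text \<open>A set of ends of the Cayley tree pulls back along the two boundary maps to sets that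
  correspond under \<open>\<Psi>\<close>.\<close>

lemma push_eval:
  assumes z: "z \<in> A.V" and z': "z' \<in> B.V" and D: "D \<in> sets (end_borel (cayley_tree b))"
  defines "A \<equiv> boundary_map b T x\<^sub>0 \<alpha> -` D \<inter> ends T"
  shows "A \<in> sets (end_borel T)"
    "emeasure (boundary_push b T x\<^sub>0 \<alpha> (\<mu> z)) D = emeasure (\<mu> z) A"
    "emeasure (boundary_push b T' x\<^sub>0' \<alpha>' (\<mu>' z')) D = emeasure (\<mu>' z') (\<Psi> ` A)"
proof -
  interpret s: conf_pair G' T' p' b x\<^sub>0' \<alpha>' \<delta> \<mu>' G T p x\<^sub>0 \<alpha> \<mu> by (rule pair_sym)
  show "A \<in> sets (end_borel T)"
    using measurable_sets[OF push_measurable[OF z] D] A.\<mu>_space[OF z] A.\<mu>_sets[OF z] by (simp add: A_def)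
  show "emeasure (boundary_push b T x\<^sub>0 \<alpha> (\<mu> z)) D = emeasure (\<mu> z) A"
    unfolding boundary_push_def emeasure_distr[OF push_measurable[OF z] D] A_def A.\<mu>_space[OF z] ..
  have "boundary_map b T' x\<^sub>0' \<alpha>' -` D \<inter> ends T' = \<Psi> ` A"
  proof (intro equalityI subsetI)
    fix \<eta> assume \<eta>: "\<eta> \<in> boundary_map b T' x\<^sub>0' \<alpha>' -` D \<inter> ends T'"
    then have e: "\<eta> \<in> ends T'" "boundary_map b T' x\<^sub>0' \<alpha>' (\<Psi> (\<Psi>' \<eta>)) \<in> D" using \<Psi>_\<Psi>' by auto
    then have "\<Psi>' \<eta> \<in> A" unfolding A_def using boundary_\<Psi>[OF \<Psi>'_ends[OF e(1)]] \<Psi>'_ends[OF e(1)] by simp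
    then show "\<eta> \<in> \<Psi> ` A" using \<Psi>_\<Psi>'[OF e(1)] by (metis imageI)
  next
    fix \<eta> assume "\<eta> \<in> \<Psi> ` A"
    then show "\<eta> \<in> boundary_map b T' x\<^sub>0' \<alpha>' -` D \<inter> ends T'" unfolding A_def using boundary_\<Psi> \<Psi>_ends by auto
  qed
  then show "emeasure (boundary_push b T' x\<^sub>0' \<alpha>' (\<mu>' z')) D = emeasure (\<mu>' z') (\<Psi> ` A)"
    unfolding boundary_push_def emeasure_distr[OF s.push_measurable[OF z'] D] B.\<mu>_space[OF z'] by simp
qed

lemma push_surj:
  assumes A: "A \<in> sets (end_borel T)"
  obtains D where "D \<in> sets (end_borel (cayley_tree b))" "boundary_map b T x\<^sub>0 \<alpha> -` D \<inter> ends T = A"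
proof
  let ?D = "end_extension A.C T A.orbit_map -` A \<inter> space (end_borel (cayley_tree b))"
  show "?D \<in> sets (end_borel (cayley_tree b))"
    by (rule measurable_sets[OF A.CT.ext_measurable[OF A.orbit_map_coarse A.C.locally_finite_tree_axioms] A])
  have "boundary_map b T x\<^sub>0 \<alpha> \<xi> \<in> ?D \<longleftrightarrow> \<xi> \<in> A" if "\<xi> \<in> ends T" for \<xi>
    using A.boundary_map_ext[OF that] A.ext_orb_word_of[OF that] A.TC.ext_lim(1)[OF A.word_of_coarse that]
    by (simp add: A.C.space_end_borel)
  then show "boundary_map b T x\<^sub>0 \<alpha> -` ?D \<inter> ends T = A" using A.end_borel_sub[OF A] by blast
qed

lemma ac_from_push:
  assumes mac: "mutually_absolutely_continuous (boundary_push b T x\<^sub>0 \<alpha> (\<mu> z)) (boundary_push b T' x\<^sub>0' \<alpha>' (\<mu>' z'))"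
    and z: "z \<in> A.V" "z' \<in> B.V" and xy: "x \<in> A.V" "y \<in> B.V" and A: "A \<in> sets (end_borel T)"
  shows "emeasure (\<mu> x) A = 0 \<longleftrightarrow> emeasure (\<mu>' y) (\<Psi> ` A) = 0"
proof -
  obtain D where D: "D \<in> sets (end_borel (cayley_tree b))" "boundary_map b T x\<^sub>0 \<alpha> -` D \<inter> ends T = A"
    by (rule push_surj[OF A])
  have "D \<in> sets (boundary_push b T x\<^sub>0 \<alpha> (\<mu> z))" using D(1) by (simp add: boundary_push_def)
  then have "emeasure (boundary_push b T x\<^sub>0 \<alpha> (\<mu> z)) D = 0 \<longleftrightarrow> emeasure (boundary_push b T' x\<^sub>0' \<alpha>' (\<mu>' z')) D = 0"
    using mac unfolding mutually_absolutely_continuous_def by blast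
  then have "emeasure (\<mu> z) A = 0 \<longleftrightarrow> emeasure (\<mu>' z') (\<Psi> ` A) = 0"
    unfolding push_eval(2)[OF z D(1)] push_eval(3)[OF z D(1)] D(2) .
  moreover have "emeasure (\<mu> x) A = 0 \<longleftrightarrow> emeasure (\<mu> z) A = 0"
    using A.\<mu>_null[OF xy(1) z(1) A] A.\<mu>_null[OF z(1) xy(1) A] by blast
  moreover have "emeasure (\<mu>' y) (\<Psi> ` A) = 0 \<longleftrightarrow> emeasure (\<mu>' z') (\<Psi> ` A) = 0"
    using B.\<mu>_null[OF xy(2) z(2) \<Psi>_sets[OF A]] B.\<mu>_null[OF z(2) xy(2) \<Psi>_sets[OF A]] by blast
  ultimately show ?thesis by blast
qed

section \<open>From the boundary correspondence to an isomorphism of graphs\<close>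

text \<open>The end sets determine the edges and \<open>\<Psi>\<close> is equivariant, so \<open>H\<close> is equivariant too. The
  vertices of the graphs are the orbits of the fundamental groups, so \<open>H\<close> descends to the
  quotients.\<close>

lemma graphs_iso:
  assumes H: "graph_iso T T' H" and half_ends: "\<And>u v. adj T u v \<Longrightarrow> \<Psi> ` half_ends T u v = half_ends T' (H u) (H v)"
  shows "isomorphic_graphs G G'"
proof -
  interpret H: tree_iso T T' H by unfold_locales (rule H)
  have eq: "H (\<alpha> g y) = \<alpha>' g (H y)" if g: "g \<in> A.W" and y: "y \<in> A.V" for g y
  proof -
    interpret a: tree_iso T T "\<alpha> g" by (rule A.\<alpha>_iso[OF g])
    interpret a': tree_iso T' T' "\<alpha>' g" by (rule B.\<alpha>_iso[OF g])
    obtain w where yw: "adj T y w" using A.nbr_avoid2[OF y] by blast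
    note wV = A.adj_verts(2)[OF yw]
    have "half_ends T' (H (\<alpha> g y)) (H (\<alpha> g w)) = \<Psi> ` half_ends T (\<alpha> g y) (\<alpha> g w)" using half_ends[OF a.iso_adj'[OF yw]] by simp
    also have "\<dots> = \<Psi> ` end_map (\<alpha> g) ` half_ends T y w" using a.iso_half_ends_image[OF y wV] by simp
    also have "\<dots> = end_map (\<alpha>' g) ` \<Psi> ` half_ends T y w"
      unfolding image_image by (rule image_cong[OF refl]) (rule \<Psi>_equiv[OF g A.half_ends_ends])
    also have "\<dots> = half_ends T' (\<alpha>' g (H y)) (\<alpha>' g (H w))"
      unfolding half_ends[OF yw] by (rule a'.iso_half_ends_image[OF H.iso_V[OF y] H.iso_V[OF wV]])
    finally show ?thesis
      by (rule B.half_ends_eq(1)[OF H.iso_adj'[OF a.iso_adj'[OF yw]] a'.iso_adj'[OF H.iso_adj'[OF yw]]])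
  qed
  define f where "f v = p' (H (A.\<sigma> v))" for v
  have \<sigma>: "A.\<sigma> v \<in> A.V" "p (A.\<sigma> v) = v" if "v \<in> verts G" for v using A.\<sigma>[OF that] by auto
  have fp: "p' (H x) = f (p x)" if x: "x \<in> A.V" for x
  proof -
    note l = A.word_of[OF x]
    have s: "A.\<sigma> (p x) \<in> A.V" by (rule \<sigma>(1)[OF A.p_V[OF x]])
    have "p' (H x) = p' (\<alpha>' (A.word_of x) (H (A.\<sigma> (p x))))" using eq[OF l(1) s] l(2) by simp
    then show ?thesis unfolding f_def using B.deck_p[OF B.\<alpha>_deck[OF l(1)] H.iso_V[OF s]] by simp
  qed
  have inj: "v = w" if v: "v \<in> verts G" and w: "w \<in> verts G" and e: "f v = f w" for v w
  proof -
    obtain \<gamma> where \<gamma>: "\<gamma> \<in> carrier (deck_group T' p')" "\<gamma> (H (A.\<sigma> v)) = H (A.\<sigma> w)"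
      by (rule B.deck_transitive[of "H (A.\<sigma> v)" "H (A.\<sigma> w)"]) (use H.iso_V \<sigma> v w e f_def in auto)
    obtain g where g: "g \<in> A.W" "\<alpha>' g = \<gamma>" by (rule B.\<alpha>_surj[OF \<gamma>(1)])
    have "H (\<alpha> g (A.\<sigma> v)) = H (A.\<sigma> w)" using eq[OF g(1) \<sigma>(1)[OF v]] g(2) \<gamma>(2) by simp
    then have "\<alpha> g (A.\<sigma> v) = A.\<sigma> w"
      using H.iso_inj A.\<alpha>_V[OF g(1) \<sigma>(1)[OF v]] \<sigma>(1)[OF w] by (simp add: inj_on_eq_iff)
    then show ?thesis using A.deck_p[OF A.\<alpha>_deck[OF g(1)] \<sigma>(1)[OF v]] \<sigma>(2)[OF v] \<sigma>(2)[OF w] by simp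
  qed
  have fV: "f v \<in> verts G'" if "v \<in> verts G" for v unfolding f_def by (rule B.p_V[OF H.iso_V[OF \<sigma>(1)[OF that]]])
  have surj: "v' \<in> f ` verts G" if v': "v' \<in> verts G'" for v'
  proof -
    obtain x' where x': "x' \<in> B.V" "p' x' = v'" using B.p_surj[OF v'] by blast
    then have "v' = f (p (H.inv_iso x'))" using fp[OF H.inv_V] H.inv_right by simp
    then show ?thesis using A.p_V[OF H.inv_V[OF x'(1)]] by blast
  qed
  have "graph_iso G G' f"
    unfolding graph_iso_def
  proof (intro conjI ballI)
    show "bij_betw f (verts G) (verts G')" unfolding bij_betw_def inj_on_def using inj surj fV by blast
    fix v w assume v: "v \<in> verts G" and w: "w \<in> verts G"
    show "adj G v w \<longleftrightarrow> adj G' (f v) (f w)"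
    proof
      assume "adj G v w"
      then obtain a where a: "adj T (A.\<sigma> v) a" "p a = w" using A.p_lift[OF \<sigma>(1)[OF v]] \<sigma>(2)[OF v] by metis
      have "adj G' (p' (H (A.\<sigma> v))) (p' (H a))" by (rule B.p_adj[OF H.iso_adj'[OF a(1)]])
      then show "adj G' (f v) (f w)" using fp[OF A.adj_verts(2)[OF a(1)]] a(2) by (simp add: f_def)
    next
      assume "adj G' (f v) (f w)"
      then obtain x' where x': "adj T' (H (A.\<sigma> v)) x'" "p' x' = f w"
        using B.p_lift[OF H.iso_V[OF \<sigma>(1)[OF v]]] f_def by metis
      define a where "a = H.inv_iso x'"
      have a: "a \<in> A.V" "H a = x'" unfolding a_def using H.inv_V H.inv_right B.adj_verts(2)[OF x'(1)] by auto
      have va: "adj T (A.\<sigma> v) a" using H.iso_adj[OF \<sigma>(1)[OF v] a(1)] a(2) x'(1) by simp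
      have "f (p a) = f w" using fp[OF a(1)] a(2) x'(2) by simp
      then have "p a = w" by (rule inj[OF A.p_V[OF a(1)] w])
      then show "adj G v w" using A.p_adj[OF va] \<sigma>(2)[OF v] by simp
    qed
  qed
  then show ?thesis unfolding isomorphic_graphs_def by blast
qed

end

text \<open>The hypothesis is symmetric in the two trees, so \<open>edge_preimage\<close> applies in both directions
  and the vertex maps obtained are inverse to each other.\<close>

lemma (in conf_pair) rigidity:
  assumes ac: "\<And>x y A. x \<in> A.V \<Longrightarrow> y \<in> B.V \<Longrightarrow> A \<in> sets (end_borel T) \<Longrightarrow>
      emeasure (\<mu> x) A = 0 \<longleftrightarrow> emeasure (\<mu>' y) (\<Psi> ` A) = 0"
  shows "isomorphic_graphs G G'"
proof -
  have m0: "measure (\<mu> x) A = 0 \<longleftrightarrow> emeasure (\<mu> x) A = 0" if "x \<in> A.V" for x A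
    using finite_measure.emeasure_eq_measure[OF A.\<mu>_finite[OF that]] by simp
  have m0': "measure (\<mu>' x) A = 0 \<longleftrightarrow> emeasure (\<mu>' x) A = 0" if "x \<in> B.V" for x A
    using finite_measure.emeasure_eq_measure[OF B.\<mu>_finite[OF that]] by simp
  interpret p: conf_pair_ac G T p b x\<^sub>0 \<alpha> \<delta> \<mu> G' T' p' x\<^sub>0' \<alpha>' \<mu>'
    by unfold_locales (use ac m0 m0' in blast)
  interpret s: conf_pair G' T' p' b x\<^sub>0' \<alpha>' \<delta> \<mu>' G T p x\<^sub>0 \<alpha> \<mu> by (rule pair_sym)
  interpret q: conf_pair_ac G' T' p' b x\<^sub>0' \<alpha>' \<delta> \<mu>' G T p x\<^sub>0 \<alpha> \<mu>
  proof unfold_locales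
    fix x y A assume h: "x \<in> B.V" "y \<in> A.V" "A \<in> sets (end_borel T')" "measure (\<mu>' x) A = 0"
    have s: "\<Psi>' ` A \<in> sets (end_borel T)" by (rule s.\<Psi>_sets[OF h(3)])
    have "\<Psi> ` (\<Psi>' ` A) = A"
      unfolding image_image using \<Psi>_\<Psi>' B.end_borel_sub[OF h(3)] by (force simp: image_def)
    then show "measure (\<mu> y) (\<Psi>' ` A) = 0" using ac[OF h(2,1) s] m0[OF h(2)] m0'[OF h(1)] h(4) by simp
  qed
  have bij: "bij_betw \<Psi> (ends T) (ends T')"
    by (rule bij_betw_byWitness[where f' = \<Psi>']) (use \<Psi>'_\<Psi> \<Psi>_\<Psi>' \<Psi>_ends \<Psi>'_ends in auto)
  have bij': "bij_betw \<Psi>' (ends T') (ends T)"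
    by (rule bij_betw_byWitness[where f' = \<Psi>]) (use \<Psi>'_\<Psi> \<Psi>_\<Psi>' \<Psi>_ends \<Psi>'_ends in auto)
  have ret: "\<Psi>' ` (\<Psi> ` half_ends T u v) = half_ends T u v" for u v
    unfolding image_image using \<Psi>'_\<Psi> A.half_ends_ends by (force simp: image_def)
  have forth: "\<Psi> ` (\<Psi>' ` half_ends T' u v) = half_ends T' u v" for u v
    unfolding image_image using \<Psi>_\<Psi>' B.half_ends_ends by (force simp: image_def)
  have E1: "\<exists>u v. adj T u v \<and> \<Psi> ` half_ends T u v = half_ends T' s t" if "adj T' s t" for s t by (rule p.edge_preimage[OF that])
  have E1': "\<exists>s t. adj T' s t \<and> \<Psi>' ` half_ends T' s t = half_ends T u v" if "adj T u v" for u v by (rule q.edge_preimage[OF that])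
  have E2: "\<exists>s t. adj T' s t \<and> \<Psi> ` half_ends T u v = half_ends T' s t" if "adj T u v" for u v using E1'[OF that] forth by metis
  have E2': "\<exists>u v. adj T u v \<and> \<Psi>' ` half_ends T' s t = half_ends T u v" if "adj T' s t" for s t using E1[OF that] ret by metis
  obtain H where H: "\<And>u v. adj T u v \<Longrightarrow> adj T' (H u) (H v) \<and> \<Psi> ` half_ends T u v = half_ends T' (H u) (H v)"
    using vertex_map[OF A.univ_cover_axioms B.univ_cover_axioms bij E1 E2] by metis
  obtain H' where H': "\<And>u v. adj T' u v \<Longrightarrow> adj T (H' u) (H' v) \<and> \<Psi>' ` half_ends T' u v = half_ends T (H' u) (H' v)"
    using vertex_map[OF B.univ_cover_axioms A.univ_cover_axioms bij' E1' E2'] by metis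
  have H'H: "H' (H y) = y" if y: "y \<in> A.V" for y
  proof -
    obtain w where yw: "adj T y w" using A.nbr_avoid2[OF y] by blast
    note h = H[OF yw]
    note h' = H'[of "H y" "H w"]
    have "half_ends T (H' (H y)) (H' (H w)) = half_ends T y w" using h h' ret[of y w] by simp
    then show ?thesis by (rule A.half_ends_eq(1)[rotated 2]) (use h h' yw in blast)+
  qed
  have HH': "H (H' y) = y" if y: "y \<in> B.V" for y
  proof -
    obtain w where yw: "adj T' y w" using B.nbr_avoid2[OF y] by blast
    note h = H'[OF yw]
    note h' = H[of "H' y" "H' w"]
    have "half_ends T' (H (H' y)) (H (H' w)) = half_ends T' y w" using h h' forth[of y w] by simp
    then show ?thesis by (rule B.half_ends_eq(1)[rotated 2]) (use h h' yw in blast)+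
  qed
  have HV: "H y \<in> B.V" if y: "y \<in> A.V" for y
  proof -
    obtain w where yw: "adj T y w" using A.nbr_avoid2[OF y] by blast
    show ?thesis using H[OF yw] B.adj_verts(1) by blast
  qed
  have H'V: "H' y \<in> A.V" if y: "y \<in> B.V" for y
  proof -
    obtain w where yw: "adj T' y w" using B.nbr_avoid2[OF y] by blast
    show ?thesis using H'[OF yw] A.adj_verts(1) by blast
  qed
  have "graph_iso T T' H"
    unfolding graph_iso_def
  proof (intro conjI ballI)
    show "bij_betw H A.V B.V" by (rule bij_betw_byWitness[where f' = H']) (use H'H HH' HV H'V in auto)
    show "adj T u v \<longleftrightarrow> adj T' (H u) (H v)" if "u \<in> A.V" "v \<in> A.V" for u v
      using H[of u v] H'[of "H u" "H v"] H'H that by auto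
  qed
  then show ?thesis by (rule graphs_iso) (use H in blast)
qed

section \<open>Transporting a marking along an isomorphism\<close>

lemma graph_iso_comp: "graph_iso T1 T2 f \<Longrightarrow> graph_iso T2 T3 g \<Longrightarrow> graph_iso T1 T3 (\<lambda>x. g (f x))"
proof -
  assume f: "graph_iso T1 T2 f" and g: "graph_iso T2 T3 g"
  have bij: "bij_betw f (verts T1) (verts T2)" "bij_betw g (verts T2) (verts T3)"
    using f g unfolding graph_iso_def by blast+
  have fV: "f u \<in> verts T2" if "u \<in> verts T1" for u using bij_betw_apply[OF bij(1) that] .
  show ?thesis
    unfolding graph_iso_def
  proof (intro conjI ballI)
    show "bij_betw (\<lambda>x. g (f x)) (verts T1) (verts T3)" using bij_betw_trans[OF bij] by (simp add: comp_def)
    fix u v assume uv: "u \<in> verts T1" "v \<in> verts T1"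
    have "adj T1 u v \<longleftrightarrow> adj T2 (f u) (f v)" using f uv unfolding graph_iso_def by blast
    also have "\<dots> \<longleftrightarrow> adj T3 (g (f u)) (g (f v))" using g fV[OF uv(1)] fV[OF uv(2)] unfolding graph_iso_def by blast
    finally show "adj T1 u v \<longleftrightarrow> adj T3 (g (f u)) (g (f v))" .
  qed
qed

text \<open>Conjugation with \<open>F\<close> is an isomorphism of the groups of deck transformations.\<close>

lemma (in marked_cover) transport_marking:
  assumes B: "univ_cover G' T' p'" and F: "graph_iso T T' F"
    and f: "inj_on f (verts G)" "\<And>z. z \<in> V \<Longrightarrow> p' (F z) = f (p z)"
  shows "marking b T' p' (F x\<^sub>0) (\<lambda>g. restrict (\<lambda>y. F (\<alpha> g (inv_into V F y))) (verts T'))"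
proof -
  interpret B: univ_cover G' T' p' by fact
  interpret F: tree_iso T T' F by unfold_locales (rule F)
  define \<alpha>' where "\<alpha>' g = restrict (\<lambda>y. F (\<alpha> g (F.inv_iso y))) B.V" for g
  have fp: "f (p (F.inv_iso y)) = p' y" if "y \<in> B.V" for y using f(2)[OF F.inv_V[OF that]] F.inv_right[OF that] by simp
  have deck: "\<alpha>' g \<in> carrier (deck_group T' p')" if g: "g \<in> W" for g
    unfolding \<alpha>'_def
  proof (rule B.deckI)
    have "graph_iso T T (\<alpha> g)" using \<alpha>_deck[OF g] by (simp add: deck_iff)
    then show "graph_iso T' T' (\<lambda>y. F (\<alpha> g (F.inv_iso y)))"
      by (intro graph_iso_comp[OF graph_iso_comp[OF F.inv_graph_iso] F])
    fix y assume y: "y \<in> B.V"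
    show "p' (F (\<alpha> g (F.inv_iso y))) = p' y"
      using f(2)[OF \<alpha>_V[OF g F.inv_V[OF y]]] deck_p[OF \<alpha>_deck[OF g] F.inv_V[OF y]] fp[OF y] by simp
  qed
  have "\<alpha>' \<in> iso (free_group b) (deck_group T' p')"
    unfolding iso_def hom_def
  proof (intro CollectI conjI ballI)
    show "\<alpha>' \<in> W \<rightarrow> carrier (deck_group T' p')" using deck by blast
    show "\<alpha>' (g \<otimes>\<^bsub>free_group b\<^esub> h) = \<alpha>' g \<otimes>\<^bsub>deck_group T' p'\<^esub> \<alpha>' h" if "g \<in> W" "h \<in> W" for g h
      unfolding B.deck_mult[OF deck[OF that(1)] deck[OF that(2)]] fg_mult
    proof
      fix y show "\<alpha>' (word_mult g h) y = compose B.V (\<alpha>' g) (\<alpha>' h) y"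
        using \<alpha>_mult[OF that F.inv_V] F.inv_left[OF \<alpha>_V[OF that(2) F.inv_V]] F.iso_V[OF \<alpha>_V[OF that(2) F.inv_V]]
        by (simp add: \<alpha>'_def compose_def)
    qed
    show "bij_betw \<alpha>' W (carrier (deck_group T' p'))"
    proof (rule bij_betw_imageI)
      show "inj_on \<alpha>' W"
      proof (rule inj_onI)
        fix g h assume gh: "g \<in> W" "h \<in> W" "\<alpha>' g = \<alpha>' h"
        have "\<alpha>' g (F x\<^sub>0) = \<alpha>' h (F x\<^sub>0)" using gh(3) by simp
        then have "F (\<alpha> g x\<^sub>0) = F (\<alpha> h x\<^sub>0)" by (simp add: \<alpha>'_def F.iso_V x0 F.inv_left)
        then have "\<alpha> g x\<^sub>0 = \<alpha> h x\<^sub>0" using F.iso_inj \<alpha>_V x0 gh by (simp add: inj_on_eq_iff)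
        then show "g = h" by (rule \<alpha>_eq[OF gh(1,2) x0])
      qed
      show "\<alpha>' ` W = carrier (deck_group T' p')"
      proof (intro equalityI subsetI)
        fix \<gamma> assume "\<gamma> \<in> \<alpha>' ` W" then show "\<gamma> \<in> carrier (deck_group T' p')" using deck by blast
      next
        fix \<gamma> assume g: "\<gamma> \<in> carrier (deck_group T' p')"
        interpret g: tree_iso T' T' \<gamma> by (rule B.deck_iso[OF g])
        have "restrict (\<lambda>z. F.inv_iso (\<gamma> (F z))) V \<in> carrier (deck_group T p)"
        proof (rule deckI)
          show "graph_iso T T (\<lambda>z. F.inv_iso (\<gamma> (F z)))"
            by (rule graph_iso_comp[OF graph_iso_comp[OF F g.iso] F.inv_graph_iso])
          fix z assume z: "z \<in> V"
          have "f (p (F.inv_iso (\<gamma> (F z)))) = f (p z)"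
            using fp[OF g.iso_V[OF F.iso_V[OF z]]] B.deck_p[OF g F.iso_V[OF z]] f(2)[OF z] by simp
          then show "p (F.inv_iso (\<gamma> (F z))) = p z"
            using inj_onD[OF f(1)] p_V[OF z] p_V[OF F.inv_V[OF g.iso_V[OF F.iso_V[OF z]]]] by blast
        qed
        then obtain k where k: "k \<in> W" "\<alpha> k = restrict (\<lambda>z. F.inv_iso (\<gamma> (F z))) V" by (rule \<alpha>_surj)
        have "\<alpha>' k = \<gamma>"
        proof
          fix y show "\<alpha>' k y = \<gamma> y"
          proof (cases "y \<in> B.V")
            case True
            then show ?thesis using k(2) F.inv_V F.inv_right g.iso_V by (simp add: \<alpha>'_def)
          next
            case False
            have "\<gamma> \<in> extensional B.V" using g by (simp add: B.deck_iff Bij_def)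
            then show ?thesis using False by (simp add: \<alpha>'_def extensional_def)
          qed
        qed
        then show "\<gamma> \<in> \<alpha>' ` W" using k(1) by blast
      qed
    qed
  qed
  then show ?thesis unfolding marking_def \<alpha>'_def using F.iso_V[OF x0] by simp
qed

lemma (in univ_cover) covering_iso:
  assumes f: "graph_iso G G' f" and wf: "wf_graph G'"
  shows "tree_cover T G' (\<lambda>x. f (p x))"
proof -
  have bij: "bij_betw f (verts G) (verts G')" and adj: "\<And>u v. u \<in> verts G \<Longrightarrow> v \<in> verts G \<Longrightarrow> adj G u v \<longleftrightarrow> adj G' (f u) (f v)"
    using f unfolding graph_iso_def by blast+
  note adjV = wf_graph_adj(2)[OF wf]
  have nb: "bij_betw f (nbhd G v) (nbhd G' (f v))" if v: "v \<in> verts G" for v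
  proof (rule bij_betw_imageI)
    have sub: "nbhd G v \<subseteq> verts G" using adjG_verts by (auto simp: nbhd_def)
    show "inj_on f (nbhd G v)" by (rule inj_on_subset[OF bij_betw_imp_inj_on[OF bij] sub])
    show "f ` nbhd G v = nbhd G' (f v)"
    proof (intro equalityI subsetI)
      fix w assume "w \<in> f ` nbhd G v" then show "w \<in> nbhd G' (f v)" using adj[OF v] sub by (auto simp: nbhd_def)
    next
      fix w assume "w \<in> nbhd G' (f v)"
      then have w: "adj G' (f v) w" by (simp add: nbhd_def)
      have "w \<in> f ` verts G" using adjV[OF w] bij by (simp add: bij_betw_def)
      then obtain u where u: "u \<in> verts G" "w = f u" by blast
      then show "w \<in> f ` nbhd G v" using adj[OF v u(1)] w by (auto simp: nbhd_def)
    qed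
  qed
  show ?thesis
  proof unfold_locales
    have "(\<lambda>x. f (p x)) ` V = f ` (p ` V)" by (simp add: image_image)
    also have "p ` V = verts G" using cover by (simp add: covering_def)
    also have "f ` verts G = verts G'" using bij by (simp add: bij_betw_def)
    finally show "covering T G' (\<lambda>x. f (p x))"
      unfolding covering_def using bij_betw_trans[OF p_bij nb[OF p_V]] by (simp add: comp_def)
  qed
qed

section \<open>The rigidity theorem\<close>

theorem theorem2p3:
  fixes G :: "'v graph" and T :: "'t graph" and p :: "'t \<Rightarrow> 'v"
    and \<delta> :: real and \<mu> :: "'t tree_end measure"
    and x\<^sub>0 :: 't and \<alpha> :: "letter list \<Rightarrow> 't \<Rightarrow> 't"
    and G' :: "'w graph" and T' :: "'s graph" and p' :: "'s \<Rightarrow> 'w"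
    and \<delta>' :: real and \<mu>' :: "'s tree_end measure"
    and b :: nat
  assumes "wf_graph G" and "finite (verts G)" and "connected_graph G" and "min_degree_ge 3 G"
    and "betti G = b"
    and "universal_covering T G p"
    and "conformal_measure T p \<delta> \<mu>"
    and "wf_graph G'" and "finite (verts G')" and "connected_graph G'" and "min_degree_ge 3 G'"
    and "betti G' = b"
    and "universal_covering T' G' p'"
    and "conformal_measure T' p' \<delta>' \<mu>'"
    and "b > 1"
    and "marking b T p x\<^sub>0 \<alpha>"
  shows "isomorphic_graphs G G' \<longleftrightarrow>
    (\<exists>x\<^sub>0' \<alpha>'. marking b T' p' x\<^sub>0' \<alpha>' \<and>
       \<delta> = \<delta>' \<and>
       mutually_absolutely_continuous (boundary_push b T x\<^sub>0 \<alpha> \<mu>) (boundary_push b T' x\<^sub>0' \<alpha>' \<mu>'))"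
proof -
  obtain \<nu> z where nu: "conformal_family T p \<delta> \<nu>" "z \<in> verts T" "\<mu> = \<nu> z"
    using assms(7) unfolding conformal_measure_def by blast
  obtain \<nu>' z' where nu': "conformal_family T' p' \<delta>' \<nu>'" "z' \<in> verts T'" "\<mu>' = \<nu>' z'"
    using assms(14) unfolding conformal_measure_def by blast
  interpret A: marked_conformal G T p b x\<^sub>0 \<alpha> \<delta> \<nu>
    by unfold_locales (use assms nu in blast)+
  interpret B: conformal_cover G' T' p' \<delta>' \<nu>'
    by unfold_locales (use assms nu' in blast)+
  show ?thesis
  proof
    assume "\<exists>x\<^sub>0' \<alpha>'. marking b T' p' x\<^sub>0' \<alpha>' \<and> \<delta> = \<delta>' \<and>
       mutually_absolutely_continuous (boundary_push b T x\<^sub>0 \<alpha> \<mu>) (boundary_push b T' x\<^sub>0' \<alpha>' \<mu>')"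
    then obtain x\<^sub>0' \<alpha>' where h: "marking b T' p' x\<^sub>0' \<alpha>'" "\<delta> = \<delta>'"
      "mutually_absolutely_continuous (boundary_push b T x\<^sub>0 \<alpha> (\<nu> z)) (boundary_push b T' x\<^sub>0' \<alpha>' (\<nu>' z'))"
      using nu(3) nu'(3) by blast
    interpret P: conf_pair G T p b x\<^sub>0 \<alpha> \<delta> \<nu> G' T' p' x\<^sub>0' \<alpha>' \<nu>'
      by unfold_locales (use h(1,2) nu' in auto)
    show "isomorphic_graphs G G'"
      by (rule P.rigidity) (rule P.ac_from_push[OF h(3) nu(2) nu'(2)])
  next
    assume "isomorphic_graphs G G'"
    then obtain f where f: "graph_iso G G' f" unfolding isomorphic_graphs_def by blast
    have bf: "inj_on f (verts G)" "f ` verts G = verts G'" using f unfolding graph_iso_def bij_betw_def by auto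
    have "f (p x\<^sub>0) \<in> verts G'" using A.p_V[OF A.x0] bf(2) by blast
    then obtain x' where x': "x' \<in> verts T'" "p' x' = f (p x\<^sub>0)" using B.p_surj by blast
    obtain F where F: "graph_iso T T' F" "F x\<^sub>0 = x'" "\<And>y. y \<in> verts T \<Longrightarrow> p' (F y) = f (p y)"
      by (rule lift_iso[OF A.covering_iso[OF f assms(8)] B.tree_cover_axioms A.x0 x'(1) x'(2)[symmetric]]) blast
    interpret F: tree_iso T T' F by unfold_locales (rule F(1))
    obtain k where k: "\<delta> = \<delta>'" "k > 0" "\<And>x A. x \<in> verts T \<Longrightarrow> A \<in> sets (end_borel T) \<Longrightarrow>
        measure (\<nu>' (F x)) (end_map F ` A) = k * measure (\<nu> x) A"
      by (rule conformal_unique[OF A.conformal_cover_axioms B.conformal_cover_axioms F(1,3)]) blast+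
    define \<alpha>' where "\<alpha>' g = restrict (\<lambda>y. F (\<alpha> g (inv_into (verts T) F y))) (verts T')" for g
    have mk': "marking b T' p' (F x\<^sub>0) \<alpha>'"
      unfolding \<alpha>'_def by (rule A.transport_marking[OF B.univ_cover_axioms F(1) bf(1) F(3)])
    interpret P: conf_pair G T p b x\<^sub>0 \<alpha> \<delta> \<nu> G' T' p' "F x\<^sub>0" \<alpha>' \<nu>'
      by unfold_locales (use mk' k(1) nu' in auto)
    have \<Psi>: "P.\<Psi> \<xi> = end_map F \<xi>" if \<xi>: "\<xi> \<in> ends T" for \<xi>
    proof -
      obtain D where D: "\<And>y. y \<in> A.V \<Longrightarrow> A.d (A.orbit_map (A.word_of y)) y \<le> D" using A.orbit_map_word_of by blast
      have "P.F y = F (A.orbit_map (A.word_of y))" if "y \<in> A.V" for y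
        by (simp add: \<alpha>'_def F.iso_V A.x0 F.inv_left)
      then have close: "B.d (P.F y) (F y) \<le> D" if "y \<in> A.V" for y
        using D[OF that] F.iso_dist[OF A.\<alpha>_V[OF A.word_of(1)[OF that] A.x0] that] that by simp
      have "end_extension T T' F \<xi> = P.\<Psi> \<xi>" by (rule P.AB.ext_close[OF P.F_coarse \<xi> F.iso_V close])
      then show ?thesis using P.AB.ext_eqI[OF \<xi> F.iso_end[OF \<xi>] F.iso_filterlim[OF \<xi>]] by simp
    qed
    have "mutually_absolutely_continuous (boundary_push b T x\<^sub>0 \<alpha> (\<nu> z)) (boundary_push b T' (F x\<^sub>0) \<alpha>' (\<nu>' z'))"
      unfolding mutually_absolutely_continuous_def
    proof (intro conjI ballI)
      show "sets (boundary_push b T x\<^sub>0 \<alpha> (\<nu> z)) = sets (boundary_push b T' (F x\<^sub>0) \<alpha>' (\<nu>' z'))"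
        by (simp add: boundary_push_def)
      fix D assume "D \<in> sets (boundary_push b T x\<^sub>0 \<alpha> (\<nu> z))"
      then have D: "D \<in> sets (end_borel (cayley_tree b))" by (simp add: boundary_push_def)
      define A where "A = boundary_map b T x\<^sub>0 \<alpha> -` D \<inter> ends T"
      note pe = P.push_eval[OF nu(2) nu'(2) D, folded A_def]
      have im: "P.\<Psi> ` A = end_map F ` A" by (rule image_cong[OF refl]) (use \<Psi> A.end_borel_sub[OF pe(1)] in blast)
      have s: "end_map F ` A \<in> sets (end_borel T')" by (rule F.end_map_sets[OF pe(1)])
      have Fz: "F z \<in> verts T'" by (rule F.iso_V[OF nu(2)])
      have "emeasure (\<nu>' z') (end_map F ` A) = 0 \<longleftrightarrow> emeasure (\<nu>' (F z)) (end_map F ` A) = 0"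
        using B.\<mu>_null[OF nu'(2) Fz s] B.\<mu>_null[OF Fz nu'(2) s] by blast
      also have "\<dots> \<longleftrightarrow> measure (\<nu>' (F z)) (end_map F ` A) = 0"
        using finite_measure.emeasure_eq_measure[OF B.\<mu>_finite[OF Fz]] by simp
      also have "\<dots> \<longleftrightarrow> measure (\<nu> z) A = 0" using k(2) k(3)[OF nu(2) pe(1)] by simp
      also have "\<dots> \<longleftrightarrow> emeasure (\<nu> z) A = 0"
        using finite_measure.emeasure_eq_measure[OF A.\<mu>_finite[OF nu(2)]] by simp
      finally show "emeasure (boundary_push b T x\<^sub>0 \<alpha> (\<nu> z)) D = 0 \<longleftrightarrow> emeasure (boundary_push b T' (F x\<^sub>0) \<alpha>' (\<nu>' z')) D = 0"
        unfolding pe(2,3) im by simp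
    qed
    then show "\<exists>x\<^sub>0' \<alpha>'. marking b T' p' x\<^sub>0' \<alpha>' \<and> \<delta> = \<delta>' \<and>
       mutually_absolutely_continuous (boundary_push b T x\<^sub>0 \<alpha> \<mu>) (boundary_push b T' x\<^sub>0' \<alpha>' \<mu>')"
      using mk' k(1) nu(3) nu'(3) by blast
  qed
qed

end
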